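(* Let $(\mathcal S,\mathcal D,E,B)$ satisfy assumptions (i)–(iv) of the context, with $k=\dim\mathcal S$. Let $\theta\in\mathcal S$ and $\{\eta_i\}_{i=1}^N\subset\mathcal D_\theta$. For $t\in(0,1]$ and $i=1,\dots,N$ let $\theta_i^t=\exp_\theta(t\eta_i)$, $\lambda_{\theta_i^t}=E(\theta_i^t)$, $\lambda_\theta=E(\theta)$. Let $V=\{v_i\}_{i=1}^N$ with $v_i=B_\theta\eta_i$ and $W^t=\{w_i^t\}_{i=1}^N$ with $w_i^t=\frac1t(T_i^t-\mathrm{id})$, where $T_i^t$ is the optimal transport map from $\lambda_\theta$ to $\lambda_{\theta_i^t}$. Let $F(V)$ and $F(W^t)$ be the operators on the Hilbert space $\mathcal H=L^2(\lambda_\theta;\mathbb R^d)$ given by $F(V)=\frac1N\sum_{i=1}^Nv_i\langle v_i,\cdot\rangle$ and $F(W^t)=\frac1N\sum_{i=1}^Nw_i^t\langle w_i^t,\cdot\rangle$. (i) Eigenvalues: Let $(\mu_i)_{i=1}^m$ and $(\nu_i^t)_{i=1}^{n^t}$ be the non-zero eigenvalues of $F(V)$ and $F(W^t)$, sorted in decreasing order (both lists thought of as followed by infinitely many zero eigenvalues). Then $m=\dim\operatorname{span}V\le k=\dim T_\theta\mathcal S$ and $n^t\le N$. There is a constant $C\in(0,\infty)$, not depending on $\theta$ or $(\eta_i)_i$, such that for $t\in(0,1/C)$ $$|\mu_i-\nu_i^t|\le C\sqrt t\quad\text{for }i=1,\dots,m,\qquad 0\le\nu_i^t\le C\sqrt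 t\quad\text{for }i=m+1,\dots,n^t.$$ In particular, if $t$ is sufficiently small such that $L_t:=\mu_m-2C\sqrt t>0$, then $\nu_m^t-\nu_{m+1}^t\ge L_t$. (ii) Eigenvectors: Let $\mathcal V_m$ be the span of the top $m$ (orthonormal) eigenvectors of $F(V)$ and $\mathcal W_m^t$ the span of the top $m$ (orthonormal) eigenvectors of $F(W^t)$. Then, for the same $C$, for $t\in(0,1/C)$, $$d(\mathcal W_m^t,\mathcal V_m)\le\frac{2C\sqrt t}{\mu_m},$$ where $d$ is the subspace distance defined in the context.
   Context: $\Omega\subset\mathbb R^d$ is compact and convex, $\mathcal P(\Omega)$ is the set of probability measures on $\Omega$, $\mathrm W$ is the Wasserstein-2 distance, $\mathrm W(\mu,\nu)^2=\inf_{\pi}\int|x-y|^2\,d\pi$ over couplings $\pi$ of $\mu,\nu$. For absolutely continuous $\mu$, the optimal transport map from $\mu$ to $\nu$ is the ($\mu$-a.e. unique) map $T$ such that $(\mathrm{id},T)_\#\mu$ is the optimal coupling (Brenier). $L^2(\mu)$ means $L^2(\mu;\mathbb R^d)$. $\|\cdot\|_{C^1(\mathbb R^d)}$ is the supremum norm of the function and its first derivatives. $\#$ denotes push-forward. Assumptions. (i) $\mathcal S$ is a compact, connected, $k$-dimensional smooth Riemannian manifold with tangent norms $\|\eta\|_\theta$ ($\eta\in T_\theta\mathcal S$) and induced distance $d_{\mathcal S}$. $\mathcal D\subset T\mathcal S$ is a subset on which the Riemannian exponential map is well defined, such that $(\theta,\eta)\in\mathcal D$ implies $(\theta,t\eta)\in\mathcal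 D$ for $t\in[0,1]$; for every $(\theta,\eta)\in\mathcal D$ the curve $\gamma(t)=\exp_\theta(t\eta)$, $t\in[0,1]$, is a constant speed geodesic from $\theta$ to $\exp_\theta(\eta)$ with $\|\dot\gamma(t)\|_{\gamma(t)}=\|\eta\|_\theta=d_{\mathcal S}(\theta,\exp_\theta(\eta))$ for $t\in[0,1]$; and, with $\mathcal D_\theta=\{\eta:(\theta,\eta)\in\mathcal D\}$, for any $\theta_0,\theta_1\in\mathcal S$ there is $\eta\in\mathcal D_{\theta_0}$ with $\theta_1=\exp_{\theta_0}(\eta)$. ($\mathcal S$ may have a boundary as long as it is a geodesically convex subset of a larger, not necessarily compact, such manifold and the construction of geodesics via $\mathcal D$ remains valid.) (ii) $E:\mathcal S\to\mathcal P(\Omega)$ is a bi-Lipschitz bijection from $(\mathcal S,d_{\mathcal S})$ onto $\Lambda:=E(\mathcal S)$ with metric $\mathrm W$; write $\lambda_\theta=E(\theta)$. All $\lambda\in\Lambda$ are absolutely continuous with respect to Lebesgue measure. (iii) For each $\theta\in\mathcal S$, $B_\theta:T_\theta\mathcal S\to C^1(\mathbb R^d;\mathbb R^d)$ is linear with values in gradient vector fields, and there is $C_0\in(0,\infty)$ such that for all $(\theta,\eta)\in\mathcal D$, $x\in\mathbb R^d$, $t\in[0,1]$, with $\gamma(t)=\exp_\theta(t\eta)$: $C_0^{-1}\|\eta\|_\theta\le\|B_\theta\eta\|_{L^2(\lambda_\theta)}\le C_0\|\eta\|_\theta$; $\|B_\theta\eta\|_{C^1(\mathbb R^d)}\le C_0\|\eta\|_\theta$;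 $|\partial_t[B_{\gamma(t)}\dot\gamma(t)](x)|\le C_0\|\eta\|_\theta^2$. (iv) For every Lipschitz curve $\gamma:[0,1]\to\mathcal S$, let $v(t,\cdot)=B_{\gamma(t)}\dot\gamma(t)$ (defined for a.e. $t$) and let $\varphi:[0,1]\times\Omega\to\mathbb R^d$ be the solution of $\varphi(0,\cdot)=\mathrm{id}$, $\partial_t\varphi(t,\cdot)=v(t,\varphi(t,\cdot))$ for a.e. $t$; then $\lambda_{\gamma(t)}=\varphi(t,\cdot)_\#\lambda_{\gamma(0)}$ for all $t\in[0,1]$. Eigenvalues are counted with multiplicity; $m\ge1$ is understood where $\mu_m$ appears. "Top $m$ eigenvectors" means orthonormal eigenvectors for the $m$ largest eigenvalues of the (zero-padded) sorted list. "span $V$" is the linear span of the $v_i$ in $\mathcal H$. Subspace distance. For $m$-dimensional subspaces $X,Y$ of a Hilbert space, the principal angles are defined inductively: $\theta_1=\cos^{-1}(\max|\langle x,y\rangle|)$ over unit vectors $x\in X,y\in Y$, with maximizer $(x_1,y_1)$; for $j>1$, $\theta_j=\cos^{-1}(\max|\langle x,y\rangle|)$ over unit vectors $x\in X$ orthogonal to $x_1,\dots,x_{j-1}$ and unit vectors $y\in Y$ orthogonal to $y_1,\dots,y_{j-1}$, with maximizer $(x_j,y_j)$. Then $d(X,Y)=\sqrt{\sum_{j=1}^m\sin(\theta_j)^2}$. *)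

theory Defs
  imports "HOL-Probability.Probability" "HOL-Library.More_List"
begin

primrec Ck_on :: "nat \<Rightarrow> ('a::euclidean_space \<Rightarrow> 'b::real_normed_vector) \<Rightarrow> 'a set \<Rightarrow> bool" where
  "Ck_on 0 f U \<longleftrightarrow> continuous_on U f"
| "Ck_on (Suc n) f U \<longleftrightarrow>
     (\<forall>x\<in>U. f differentiable (at x)) \<and>
     (\<forall>u. Ck_on n (\<lambda>x. frechet_derivative f (at x) u) U)"

definition smooth_on :: "('a::euclidean_space \<Rightarrow> 'b::real_normed_vector) \<Rightarrow> 'a set \<Rightarrow> bool" where
  "smooth_on f U \<longleftrightarrow> (\<forall>n. Ck_on n f U)"

text \<open>A chart is a pair of its domain and its coordinate map. The points of a manifold without
  boundary are the elements of the type \<open>'p\<close>, whose topology is Hausdorff and second countable.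
  The model space is \<open>'e\<close>, so the dimension is \<open>DIM('e)\<close>.\<close>

type_synonym ('p, 'e) chart = "'p set \<times> ('p \<Rightarrow> 'e)"

abbreviation chart_inv :: "('p, 'e) chart \<Rightarrow> 'e \<Rightarrow> 'p" where
  "chart_inv c \<equiv> inv_into (fst c) (snd c)"

definition smooth_atlas ::
  "('p::{t2_space, second_countable_topology}, 'e::euclidean_space) chart set \<Rightarrow> bool" where
  "smooth_atlas A \<longleftrightarrow>
     (\<Union>c\<in>A. fst c) = UNIV \<and>
     (\<forall>c\<in>A. open (fst c) \<and> open (snd c ` fst c) \<and>
        homeomorphism (fst c) (snd c ` fst c) (snd c) (chart_inv c)) \<and>
     (\<forall>c\<in>A. \<forall>c'\<in>A. smooth_on (snd c' \<circ> chart_inv c) (snd c ` (fst c \<inter> fst c')))"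

text \<open>The tangent space at \<open>p\<close> is identified with \<open>'e\<close> through a chart around \<open>p\<close> that is
  selected once and for all: a vector of \<open>'e\<close> stands for the tangent vector at \<open>p\<close> that has these
  coordinates in the chart \<open>chart_at A p\<close>. The selected chart need not depend continuously
  on \<open>p\<close>, so smoothness is always expressed in the charts of the atlas.\<close>

definition chart_at :: "('p, 'e) chart set \<Rightarrow> 'p \<Rightarrow> ('p, 'e) chart" where
  "chart_at A p = (SOME c. c \<in> A \<and> p \<in> fst c)"

text \<open>Coefficients of a field of bilinear forms \<open>g\<close> in the chart \<open>c\<close> at the coordinate point
  \<open>x\<close>; the derivative of the change of coordinates maps coordinate vectors of \<open>c\<close> to
  tangent vectors.\<close>

definition metric_coeff ::
  "('p, 'e::euclidean_space) chart set \<Rightarrow> ('p \<Rightarrow> 'e \<Rightarrow> 'e \<Rightarrow> real) \<Rightarrow> ('p, 'e) chart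
    \<Rightarrow> 'e \<Rightarrow> 'e \<Rightarrow> 'e \<Rightarrow> real" where
  "metric_coeff A g c x u w =
     (let p = chart_inv c x;
          J = frechet_derivative (snd (chart_at A p) \<circ> chart_inv c) (at x)
      in g p (J u) (J w))"

definition riemannian_manifold ::
  "('p::{t2_space, second_countable_topology}, 'e::euclidean_space) chart set
    \<Rightarrow> ('p \<Rightarrow> 'e \<Rightarrow> 'e \<Rightarrow> real) \<Rightarrow> bool" where
  "riemannian_manifold A g \<longleftrightarrow>
     smooth_atlas A \<and>
     (\<forall>p. bilinear (g p) \<and> (\<forall>u w. g p u w = g p w u) \<and> (\<forall>u. u \<noteq> 0 \<longrightarrow> 0 < g p u u)) \<and>
     (\<forall>c\<in>A. \<forall>u w. smooth_on (\<lambda>x. metric_coeff A g c x u w) (snd c ` fst c))"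

definition tangent_norm :: "('p \<Rightarrow> 'e \<Rightarrow> 'e \<Rightarrow> real) \<Rightarrow> 'p \<Rightarrow> 'e \<Rightarrow> real" where
  "tangent_norm g p u = sqrt (g p u u)"

text \<open>All curves are parametrised by \<open>[0,1]\<close>; their values outside are irrelevant.\<close>

definition chart_velocity ::
  "('p, 'e::euclidean_space) chart \<Rightarrow> (real \<Rightarrow> 'p) \<Rightarrow> real \<Rightarrow> 'e" where
  "chart_velocity c \<gamma> t = vector_derivative (snd c \<circ> \<gamma>) (at t within {0..1})"

definition velocity ::
  "('p, 'e::euclidean_space) chart set \<Rightarrow> (real \<Rightarrow> 'p) \<Rightarrow> real \<Rightarrow> 'e" where
  "velocity A \<gamma> t = chart_velocity (chart_at A (\<gamma> t)) \<gamma> t"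

definition curve_differentiable ::
  "('p, 'e::euclidean_space) chart set \<Rightarrow> (real \<Rightarrow> 'p) \<Rightarrow> real \<Rightarrow> bool" where
  "curve_differentiable A \<gamma> t \<longleftrightarrow>
     (snd (chart_at A (\<gamma> t)) \<circ> \<gamma>) differentiable (at t within {0..1})"

definition C1_curve ::
  "('p::topological_space, 'e::euclidean_space) chart set \<Rightarrow> (real \<Rightarrow> 'p) \<Rightarrow> bool" where
  "C1_curve A \<gamma> \<longleftrightarrow>
     continuous_on {0..1} \<gamma> \<and>
     (\<forall>c\<in>A. (\<forall>t\<in>{0..1}. \<gamma> t \<in> fst c \<longrightarrow> (snd c \<circ> \<gamma>) differentiable (at t within {0..1})) \<and>
        continuous_on {t\<in>{0..1}. \<gamma> t \<in> fst c} (chart_velocity c \<gamma>))"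

definition curve_length ::
  "('p, 'e::euclidean_space) chart set \<Rightarrow> ('p \<Rightarrow> 'e \<Rightarrow> 'e \<Rightarrow> real) \<Rightarrow> (real \<Rightarrow> 'p) \<Rightarrow> real" where
  "curve_length A g \<gamma> = integral {0..1} (\<lambda>t. tangent_norm g (\<gamma> t) (velocity A \<gamma> t))"

text \<open>Allowing piecewise \<open>C\<^sup>1\<close> curves would not change the infimum: the pieces can
  be reparametrised to start and end with velocity zero.\<close>

definition riem_dist ::
  "('p::topological_space, 'e::euclidean_space) chart set \<Rightarrow> ('p \<Rightarrow> 'e \<Rightarrow> 'e \<Rightarrow> real) \<Rightarrow> 'p set
    \<Rightarrow> 'p \<Rightarrow> 'p \<Rightarrow> real" where
  "riem_dist A g S p q =
     Inf {curve_length A g \<gamma> | \<gamma>. C1_curve A \<gamma> \<and> \<gamma> ` {0..1} \<subseteq> S \<and> \<gamma> 0 = p \<and> \<gamma> 1 = q}"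

text \<open>Christoffel symbols of the first kind of the Levi-Civita connection,
  \<open>(\<partial>\<^sub>u G(v,w) + \<partial>\<^sub>v G(u,w) - \<partial>\<^sub>w G(u,v)) / 2\<close>.\<close>

definition christoffel ::
  "('p, 'e::euclidean_space) chart set \<Rightarrow> ('p \<Rightarrow> 'e \<Rightarrow> 'e \<Rightarrow> real) \<Rightarrow> ('p, 'e) chart
    \<Rightarrow> 'e \<Rightarrow> 'e \<Rightarrow> 'e \<Rightarrow> 'e \<Rightarrow> real" where
  "christoffel A g c x u v w =
     (let d = (\<lambda>h a b. frechet_derivative (\<lambda>y. metric_coeff A g c y a b) (at x) h)
      in (d u v w + d v u w - d w u v) / 2)"

text \<open>The geodesic equation in coordinates, with the index lowered by the metric.\<close>

definition geodesic ::
  "('p::topological_space, 'e::euclidean_space) chart set \<Rightarrow> ('p \<Rightarrow> 'e \<Rightarrow> 'e \<Rightarrow> real)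
    \<Rightarrow> (real \<Rightarrow> 'p) \<Rightarrow> bool" where
  "geodesic A g \<gamma> \<longleftrightarrow>
     continuous_on {0..1} \<gamma> \<and>
     (\<forall>c\<in>A. \<forall>t\<in>{0..1}. \<gamma> t \<in> fst c \<longrightarrow>
        (snd c \<circ> \<gamma>) differentiable (at t within {0..1}) \<and>
        (\<exists>a. (chart_velocity c \<gamma> has_vector_derivative a) (at t within {0..1}) \<and>
           (\<forall>w. metric_coeff A g c (snd c (\<gamma> t)) a w +
              christoffel A g c (snd c (\<gamma> t)) (chart_velocity c \<gamma> t) (chart_velocity c \<gamma> t) w = 0)))"

definition geodesic_from ::
  "('p::topological_space, 'e::euclidean_space) chart set \<Rightarrow> ('p \<Rightarrow> 'e \<Rightarrow> 'e \<Rightarrow> real)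
    \<Rightarrow> 'p \<Rightarrow> 'e \<Rightarrow> (real \<Rightarrow> 'p) \<Rightarrow> bool" where
  "geodesic_from A g p u \<gamma> \<longleftrightarrow> geodesic A g \<gamma> \<and> \<gamma> 0 = p \<and> velocity A \<gamma> 0 = u"

text \<open>The exponential map is meaningful at \<open>(p, u)\<close> if some curve satisfies
  \<open>geodesic_from A g p u\<close>, i.e. if the geodesic with these initial data exists up to time 1.\<close>

definition riem_exp ::
  "('p::topological_space, 'e::euclidean_space) chart set \<Rightarrow> ('p \<Rightarrow> 'e \<Rightarrow> 'e \<Rightarrow> real)
    \<Rightarrow> 'p \<Rightarrow> 'e \<Rightarrow> 'p" where
  "riem_exp A g p u = (THE q. \<exists>\<gamma>. geodesic_from A g p u \<gamma> \<and> \<gamma> 1 = q)"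

definition geodesically_convex ::
  "('p::topological_space, 'e::euclidean_space) chart set \<Rightarrow> ('p \<Rightarrow> 'e \<Rightarrow> 'e \<Rightarrow> real) \<Rightarrow> 'p set \<Rightarrow> bool"
where
  "geodesically_convex A g S \<longleftrightarrow>
     (\<forall>p\<in>S. \<forall>q\<in>S. \<exists>\<gamma>. geodesic A g \<gamma> \<and> \<gamma> 0 = p \<and> \<gamma> 1 = q \<and> \<gamma> ` {0..1} \<subseteq> S \<and>
        curve_length A g \<gamma> = riem_dist A g UNIV p q)"

definition prob_on :: "'d::euclidean_space set \<Rightarrow> 'd measure set" where
  "prob_on \<Omega> = {\<mu>. sets \<mu> = sets borel \<and> prob_space \<mu> \<and> emeasure \<mu> \<Omega> = 1}"

definition couplings ::
  "'d::euclidean_space measure \<Rightarrow> 'd measure \<Rightarrow> ('d \<times> 'd) measure set" where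
  "couplings \<mu> \<nu> = {\<pi>. sets \<pi> = sets borel \<and> distr \<pi> borel fst = \<mu> \<and> distr \<pi> borel snd = \<nu>}"

definition transport_cost :: "('d::euclidean_space \<times> 'd) measure \<Rightarrow> ennreal" where
  "transport_cost \<pi> = (\<integral>\<^sup>+ z. ennreal ((norm (fst z - snd z))\<^sup>2) \<partial>\<pi>)"

definition wasserstein :: "'d::euclidean_space measure \<Rightarrow> 'd measure \<Rightarrow> real" where
  "wasserstein \<mu> \<nu> = sqrt (enn2real (INF \<pi>\<in>couplings \<mu> \<nu>. transport_cost \<pi>))"

definition optimal_coupling ::
  "'d::euclidean_space measure \<Rightarrow> 'd measure \<Rightarrow> ('d \<times> 'd) measure \<Rightarrow> bool" where
  "optimal_coupling \<mu> \<nu> \<pi> \<longleftrightarrow>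
     \<pi> \<in> couplings \<mu> \<nu> \<and> (\<forall>\<pi>'\<in>couplings \<mu> \<nu>. transport_cost \<pi> \<le> transport_cost \<pi>')"

definition optimal_map ::
  "'d::euclidean_space measure \<Rightarrow> 'd measure \<Rightarrow> ('d \<Rightarrow> 'd) \<Rightarrow> bool" where
  "optimal_map \<mu> \<nu> T \<longleftrightarrow>
     T \<in> borel_measurable borel \<and> optimal_coupling \<mu> \<nu> (distr \<mu> borel (\<lambda>x. (x, T x)))"

text \<open>Elements of the Hilbert space are represented by functions, and equality in the Hilbert
  space is equality almost everywhere. The notions of linear algebra below are the usual ones
  with equality read in this way.\<close>

definition L2 :: "'d::euclidean_space measure \<Rightarrow> ('d \<Rightarrow> 'd) set" where
  "L2 M = {f \<in> borel_measurable M. integrable M (\<lambda>x. (norm (f x))\<^sup>2)}"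

definition L2_inner :: "'d::euclidean_space measure \<Rightarrow> ('d \<Rightarrow> 'd) \<Rightarrow> ('d \<Rightarrow> 'd) \<Rightarrow> real" where
  "L2_inner M f g = (LINT x|M. f x \<bullet> g x)"

definition L2_norm :: "'d::euclidean_space measure \<Rightarrow> ('d \<Rightarrow> 'd) \<Rightarrow> real" where
  "L2_norm M f = sqrt (L2_inner M f f)"

definition L2_span ::
  "'d::euclidean_space measure \<Rightarrow> nat \<Rightarrow> (nat \<Rightarrow> 'd \<Rightarrow> 'd) \<Rightarrow> ('d \<Rightarrow> 'd) set" where
  "L2_span M n f = {h \<in> L2 M. \<exists>c. AE x in M. h x = (\<Sum>i<n. c i *\<^sub>R f i x)}"

definition L2_independent ::
  "'d::euclidean_space measure \<Rightarrow> nat \<Rightarrow> (nat \<Rightarrow> 'd \<Rightarrow> 'd) \<Rightarrow> bool" where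
  "L2_independent M n f \<longleftrightarrow>
     (\<forall>c. (AE x in M. (\<Sum>i<n. c i *\<^sub>R f i x) = 0) \<longrightarrow> (\<forall>i<n. c i = 0))"

definition L2_has_dim :: "'d::euclidean_space measure \<Rightarrow> ('d \<Rightarrow> 'd) set \<Rightarrow> nat \<Rightarrow> bool" where
  "L2_has_dim M X n \<longleftrightarrow>
     (\<exists>b. (\<forall>i<n. b i \<in> X) \<and> L2_independent M n b \<and> X \<subseteq> L2_span M n b)"

definition eigenspace ::
  "'d::euclidean_space measure \<Rightarrow> (('d \<Rightarrow> 'd) \<Rightarrow> 'd \<Rightarrow> 'd) \<Rightarrow> real \<Rightarrow> ('d \<Rightarrow> 'd) set" where
  "eigenspace M F a = {f \<in> L2 M. AE x in M. F f x = a *\<^sub>R f x}"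

text \<open>The decreasing list of all non-zero eigenvalues, each repeated according to the dimension
  of its eigenspace; numbers that are not eigenvalues have a zero-dimensional eigenspace. There
  is at most one such list.\<close>

definition nonzero_eigenvalues ::
  "'d::euclidean_space measure \<Rightarrow> (('d \<Rightarrow> 'd) \<Rightarrow> 'd \<Rightarrow> 'd) \<Rightarrow> real list \<Rightarrow> bool" where
  "nonzero_eigenvalues M F l \<longleftrightarrow>
     sorted_wrt (\<ge>) l \<and> 0 \<notin> set l \<and>
     (\<forall>a. a \<noteq> 0 \<longrightarrow> L2_has_dim M (eigenspace M F a) (count_list l a))"

text \<open>Orthonormal eigenvectors for the first \<open>m\<close> entries of the zero-padded list \<open>l\<close>.\<close>

definition top_eigenvectors ::
  "'d::euclidean_space measure \<Rightarrow> (('d \<Rightarrow> 'd) \<Rightarrow> 'd \<Rightarrow> 'd) \<Rightarrow> real list \<Rightarrow> nat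
    \<Rightarrow> (nat \<Rightarrow> 'd \<Rightarrow> 'd) \<Rightarrow> bool" where
  "top_eigenvectors M F l m e \<longleftrightarrow>
     (\<forall>i<m. e i \<in> eigenspace M F (nth_default 0 l i)) \<and>
     (\<forall>i<m. \<forall>j<m. L2_inner M (e i) (e j) = (if i = j then 1 else 0))"

definition empirical_operator ::
  "'d::euclidean_space measure \<Rightarrow> nat \<Rightarrow> (nat \<Rightarrow> 'd \<Rightarrow> 'd) \<Rightarrow> ('d \<Rightarrow> 'd) \<Rightarrow> 'd \<Rightarrow> 'd" where
  "empirical_operator M N v f x = (1 / real N) *\<^sub>R (\<Sum>i<N. L2_inner M (v i) f *\<^sub>R v i x)"

definition unit_orth ::
  "'d::euclidean_space measure \<Rightarrow> ('d \<Rightarrow> 'd) set \<Rightarrow> (nat \<Rightarrow> 'd \<Rightarrow> 'd) \<Rightarrow> nat \<Rightarrow> ('d \<Rightarrow> 'd) set" where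
  "unit_orth M X x j = {u \<in> X. L2_norm M u = 1 \<and> (\<forall>i<j. L2_inner M u (x i) = 0)}"

definition principal_vectors ::
  "'d::euclidean_space measure \<Rightarrow> nat \<Rightarrow> ('d \<Rightarrow> 'd) set \<Rightarrow> ('d \<Rightarrow> 'd) set
    \<Rightarrow> (nat \<Rightarrow> 'd \<Rightarrow> 'd) \<times> (nat \<Rightarrow> 'd \<Rightarrow> 'd) \<Rightarrow> bool" where
  "principal_vectors M m X Y = (\<lambda>(x, y).
     \<forall>j<m. x j \<in> unit_orth M X x j \<and> y j \<in> unit_orth M Y y j \<and>
       (\<forall>u\<in>unit_orth M X x j. \<forall>w\<in>unit_orth M Y y j.
          \<bar>L2_inner M u w\<bar> \<le> \<bar>L2_inner M (x j) (y j)\<bar>))"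

text \<open>The principal angles do not depend on the choice of the maximisers.\<close>

definition subspace_dist ::
  "'d::euclidean_space measure \<Rightarrow> nat \<Rightarrow> ('d \<Rightarrow> 'd) set \<Rightarrow> ('d \<Rightarrow> 'd) set \<Rightarrow> real" where
  "subspace_dist M m X Y =
     (let (x, y) = (SOME xy. principal_vectors M m X Y xy);
          ang = (\<lambda>j. arccos \<bar>L2_inner M (x j) (y j)\<bar>)
      in sqrt (\<Sum>j<m. (sin (ang j))\<^sup>2))"

text \<open>\<open>S\<close> is either the whole (then closed) manifold, or a full-dimensional geodesically convex
  part of it, possibly with boundary; tangent spaces at boundary points are those of the
  ambient manifold.\<close>

definition parameter_manifold ::
  "('p::{t2_space, second_countable_topology}, 'e::euclidean_space) chart set
    \<Rightarrow> ('p \<Rightarrow> 'e \<Rightarrow> 'e \<Rightarrow> real) \<Rightarrow> 'p set \<Rightarrow> ('p \<times> 'e) set \<Rightarrow> bool" where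
  "parameter_manifold A g S D \<longleftrightarrow>
     riemannian_manifold A g \<and> compact S \<and> connected S \<and>
     (S = UNIV \<or> S \<subseteq> closure (interior S) \<and> geodesically_convex A g S) \<and>
     D \<subseteq> S \<times> UNIV \<and>
     (\<forall>(p, u)\<in>D.
        (\<exists>\<gamma>. geodesic_from A g p u \<gamma>) \<and>
        (\<forall>t\<in>{0..1}. (p, t *\<^sub>R u) \<in> D) \<and>
        (let \<gamma> = (\<lambda>t. riem_exp A g p (t *\<^sub>R u)) in
           geodesic_from A g p u \<gamma> \<and>
           (\<forall>t\<in>{0..1}. \<gamma> t \<in> S \<and>
              tangent_norm g (\<gamma> t) (velocity A \<gamma> t) = tangent_norm g p u) \<and>
           tangent_norm g p u = riem_dist A g S p (riem_exp A g p u))) \<and>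
     (\<forall>p\<in>S. \<forall>q\<in>S. \<exists>u. (p, u) \<in> D \<and> q = riem_exp A g p u)"

definition bi_lipschitz_embedding ::
  "'d::euclidean_space set \<Rightarrow> 'p set \<Rightarrow> ('p \<Rightarrow> 'p \<Rightarrow> real) \<Rightarrow> ('p \<Rightarrow> 'd measure) \<Rightarrow> bool" where
  "bi_lipschitz_embedding \<Omega> S dS E \<longleftrightarrow>
     E ` S \<subseteq> prob_on \<Omega> \<and> inj_on E S \<and>
     (\<exists>L>0. \<forall>p\<in>S. \<forall>q\<in>S. dS p q / L \<le> wasserstein (E p) (E q) \<and>
        wasserstein (E p) (E q) \<le> L * dS p q) \<and>
     (\<forall>p\<in>S. absolutely_continuous lborel (E p))"

definition C1_norm :: "('d::euclidean_space \<Rightarrow> 'd) \<Rightarrow> ennreal" where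
  "C1_norm f = max (SUP x. ennreal (norm (f x)))
     (SUP x. ennreal (onorm (frechet_derivative f (at x))))"

definition tangent_fields ::
  "('p::topological_space, 'e::euclidean_space) chart set \<Rightarrow> ('p \<Rightarrow> 'e \<Rightarrow> 'e \<Rightarrow> real) \<Rightarrow> 'p set
    \<Rightarrow> ('p \<times> 'e) set \<Rightarrow> ('p \<Rightarrow> 'd::euclidean_space measure) \<Rightarrow> ('p \<Rightarrow> 'e \<Rightarrow> 'd \<Rightarrow> 'd) \<Rightarrow> bool" where
  "tangent_fields A g S D E B \<longleftrightarrow>
     (\<forall>p\<in>S. (\<forall>x. linear (\<lambda>u. B p u x)) \<and>
        (\<forall>u. Ck_on 1 (B p u) UNIV \<and> (\<exists>\<psi>. \<forall>x. gderiv \<psi> x (B p u x)))) \<and>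
     (\<exists>C\<^sub>0>0. \<forall>(p, u)\<in>D.
        tangent_norm g p u / C\<^sub>0 \<le> L2_norm (E p) (B p u) \<and>
        L2_norm (E p) (B p u) \<le> C\<^sub>0 * tangent_norm g p u \<and>
        C1_norm (B p u) \<le> ennreal (C\<^sub>0 * tangent_norm g p u) \<and>
        (let \<gamma> = (\<lambda>t. riem_exp A g p (t *\<^sub>R u)) in
           \<forall>x. \<forall>t\<in>{0..1}. \<exists>a.
             ((\<lambda>s. B (\<gamma> s) (velocity A \<gamma> s) x) has_vector_derivative a) (at t within {0..1}) \<and>
             norm a \<le> C\<^sub>0 * (tangent_norm g p u)\<^sup>2))"

definition abs_continuous_on_01 :: "(real \<Rightarrow> 'a::real_normed_vector) \<Rightarrow> bool" where
  "abs_continuous_on_01 f \<longleftrightarrow>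
     (\<forall>\<epsilon>>0. \<exists>\<delta>>0. \<forall>n::nat. \<forall>a b :: nat \<Rightarrow> real.
        (\<forall>i<n. 0 \<le> a i \<and> a i \<le> b i \<and> b i \<le> 1) \<and>
        disjoint_family_on (\<lambda>i. {a i<..<b i}) {..<n} \<and> (\<Sum>i<n. b i - a i) < \<delta> \<longrightarrow>
        (\<Sum>i<n. norm (f (b i) - f (a i))) < \<epsilon>)"

text \<open>The flow equation is solved in the sense of Caratheodory: absolutely continuous
  trajectories satisfying the equation for almost every time.\<close>

definition flow_along ::
  "('p, 'e::euclidean_space) chart set \<Rightarrow> 'd::euclidean_space set \<Rightarrow> ('p \<Rightarrow> 'e \<Rightarrow> 'd \<Rightarrow> 'd)
    \<Rightarrow> (real \<Rightarrow> 'p) \<Rightarrow> (real \<Rightarrow> 'd \<Rightarrow> 'd) \<Rightarrow> bool" where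
  "flow_along A \<Omega> B \<gamma> \<phi> \<longleftrightarrow>
     (\<forall>x\<in>\<Omega>. \<phi> 0 x = x \<and> abs_continuous_on_01 (\<lambda>t. \<phi> t x)) \<and>
     (AE t in lborel. t \<in> {0..1} \<longrightarrow>
        curve_differentiable A \<gamma> t \<and>
        (\<forall>x\<in>\<Omega>. ((\<lambda>s. \<phi> s x) has_vector_derivative B (\<gamma> t) (velocity A \<gamma> t) (\<phi> t x))
           (at t within {0..1})))"

text \<open>The flow is only defined on \<open>\<Omega>\<close>, which carries the measures; hence the
  restriction before the push-forward.\<close>

definition flow_compatible ::
  "('p::topological_space, 'e::euclidean_space) chart set \<Rightarrow> ('p \<Rightarrow> 'e \<Rightarrow> 'e \<Rightarrow> real) \<Rightarrow> 'p set
    \<Rightarrow> 'd::euclidean_space set \<Rightarrow> ('p \<Rightarrow> 'd measure) \<Rightarrow> ('p \<Rightarrow> 'e \<Rightarrow> 'd \<Rightarrow> 'd) \<Rightarrow> bool" where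
  "flow_compatible A g S \<Omega> E B \<longleftrightarrow>
     (\<forall>\<gamma> \<phi>. \<gamma> ` {0..1} \<subseteq> S \<and>
        (\<exists>L. \<forall>s\<in>{0..1}. \<forall>t\<in>{0..1}. riem_dist A g S (\<gamma> s) (\<gamma> t) \<le> L * \<bar>s - t\<bar>) \<and>
        flow_along A \<Omega> B \<gamma> \<phi> \<longrightarrow>
        (\<forall>t\<in>{0..1}. E (\<gamma> t) = distr (restrict_space (E (\<gamma> 0)) \<Omega>) borel (\<phi> t)))"

end

theory Submission
  imports Defs "HOL-Complex_Analysis.Great_Picard"
begin

text \<open>
  The vector field \<open>v = B \<theta> \<eta>\<close> is a Lipschitz gradient, so for small \<open>t\<close> the map \<open>x + t v x\<close> is the gradient
  of a function that is uniformly convex and uniformly smooth. The flow along the geodesic gives a map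
  \<open>\<phi> t\<close> that pushes \<open>\<lambda>\<^sub>\<theta>\<close> to the target of the optimal map \<open>T\<close> and satisfies \<open>\<phi> t x = x + t v x + O(t\<^sup>2)\<close>
  uniformly. Testing the dual problem with the Legendre transform of the convex function shows that
  \<open>T\<close> is at most twice as far from \<open>x + t v x\<close> in \<open>L\<^sup>2\<close> as \<open>\<phi> t\<close> is; hence
  \<open>(T - id) / t = v + O(t)\<close> in \<open>L\<^sup>2\<close>, with constants depending only on \<open>C\<^sub>0\<close> and a bound for \<open>\<parallel>\<eta>\<parallel>\<close>. Such a
  bound exists because \<open>E\<close> is bi-Lipschitz and \<open>\<Omega>\<close> is bounded. The statements on eigenvalues and
  eigenvectors then follow from Weyl's inequality and a perturbation bound of Davis-Kahan type.
\<close>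

section \<open>Finite-rank operators in inner product spaces\<close>

text \<open>The constant has to be uniform in \<theta>, in the tangent vectors and in the sample
  size. Averaging over the sample keeps the operator bound free of \<open>N\<close>. The fields
  depend linearly on their tangent vectors, so the rank \<open>m\<close> is at most
  \<open>DIM('e)\<close>; this is what turns the loss \<open>2 ^ m\<close> in the angle estimate
  into part of a uniform constant. All bounds come out linear in \<open>t\<close>, and the rate
  \<open>sqrt t\<close> follows from \<open>t \<le> 1\<close>. No regularity of the optimal maps
  beyond measurability is assumed, so they are compared with the flow maps using only that both have
  the same push-forward and that the optimal map costs no more. Elements of the Hilbert space are
  functions identified almost everywhere, and the eigenvectors in the statement are arbitrary
  admissible choices. Each spectral comparison therefore fixes a finite orthonormal system that
  captures all functions involved and passes to coordinates, where genuine equalities hold.\<close>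

lemma homogeneous_system_nontrivial:
  fixes a :: "'j \<Rightarrow> 'k \<Rightarrow> real"
  assumes "finite J" "finite K" "card J < card K"
  shows "\<exists>c. (\<exists>k\<in>K. c k \<noteq> 0) \<and> (\<forall>j\<in>J. (\<Sum>k\<in>K. c k * a j k) = 0)"
  using assms
proof (induction J arbitrary: K a rule: finite_induct)
  case empty
  then obtain k where "k \<in> K" by fastforce
  then show ?case by (intro exI[of _ "\<lambda>_. 1"]) auto
next
  case (insert j0 J)
  show ?case
  proof (cases "\<forall>k\<in>K. a j0 k = 0")
    case True
    obtain c where "\<exists>k\<in>K. c k \<noteq> 0" "\<forall>j\<in>J. (\<Sum>k\<in>K. c k * a j k) = 0"
      using insert.IH[of K a] insert.prems insert.hyps by auto
    then show ?thesis using True by (intro exI[of _ c]) auto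
  next
    case False
    then obtain p where p: "p \<in> K" "a j0 p \<noteq> 0" by auto
    \<comment> \<open>Gaussian elimination: subtracting a multiple of the pivot row
      \<open>j0\<close> cancels the coefficient of \<open>p\<close> in every other row, so one
      equation and one unknown disappear together.\<close>
    define a' where "a' j k = a j k - a j p * a j0 k / a j0 p" for j k
    have cd: "card J < card (K - {p})" using insert p by simp
    obtain c where c: "\<exists>k\<in>K-{p}. c k \<noteq> 0" "\<forall>j\<in>J. (\<Sum>k\<in>K-{p}. c k * a' j k) = 0"
      using insert.IH[of "K-{p}" a'] insert.prems cd by auto
    \<comment> \<open>Back substitution: the value at \<open>p\<close> is the one that makes
      equation \<open>j0\<close> hold.\<close>
    define d where "d = c(p := - (\<Sum>k\<in>K-{p}. c k * a j0 k) / a j0 p)"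
    have split: "(\<Sum>k\<in>K. d k * a j k) = d p * a j p + (\<Sum>k\<in>K-{p}. c k * a j k)" for j
    proof -
      have "(\<Sum>k\<in>K-{p}. d k * a j k) = (\<Sum>k\<in>K-{p}. c k * a j k)"
        by (rule sum.cong) (auto simp: d_def)
      then show ?thesis using p insert.prems by (simp add: sum.remove[of K p])
    qed
    have 1: "(\<Sum>k\<in>K. d k * a j0 k) = 0" unfolding split using p by (simp add: d_def)
    have 2: "(\<Sum>k\<in>K. d k * a j k) = 0" if "j \<in> J" for j
    proof -
      have "0 = (\<Sum>k\<in>K-{p}. c k * a' j k)" using c that by simp
      also have "\<dots> = (\<Sum>k\<in>K-{p}. c k * a j k - (a j p / a j0 p) * (c k * a j0 k))"
        by (rule sum.cong) (auto simp: a'_def algebra_simps)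
      also have "\<dots> = (\<Sum>k\<in>K-{p}. c k * a j k) - (a j p / a j0 p) * (\<Sum>k\<in>K-{p}. c k * a j0 k)"
        by (simp add: sum_subtractf sum_distrib_left)
      finally show ?thesis unfolding split using p by (simp add: d_def)
    qed
    have "\<exists>k\<in>K. d k \<noteq> 0" using c by (auto simp: d_def)
    with 1 2 show ?thesis by (intro exI[of _ d]) auto
  qed
qed

section \<open>Orthonormal systems and orthogonal projection\<close>

definition orthonormal :: "nat \<Rightarrow> (nat \<Rightarrow> 'a::real_inner) \<Rightarrow> bool" where
  "orthonormal n e \<longleftrightarrow> (\<forall>i<n. \<forall>j<n. e i \<bullet> e j = (if i = j then 1 else 0))"

definition proj :: "nat \<Rightarrow> (nat \<Rightarrow> 'a::real_inner) \<Rightarrow> 'a \<Rightarrow> 'a" where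
  "proj n e x = (\<Sum>i<n. (x \<bullet> e i) *\<^sub>R e i)"

lemma orthonormalD: "orthonormal n e \<Longrightarrow> i < n \<Longrightarrow> j < n \<Longrightarrow> e i \<bullet> e j = (if i = j then 1 else 0)"
  by (simp add: orthonormal_def)

lemma orthonormal_mono: "orthonormal n e \<Longrightarrow> m \<le> n \<Longrightarrow> orthonormal m e"
  by (simp add: orthonormal_def)

lemma orthonormal_norm: "orthonormal n e \<Longrightarrow> i < n \<Longrightarrow> norm (e i) = 1"
  by (simp add: norm_eq_sqrt_inner orthonormalD)

lemma inner_orthonormal_sum:
  assumes "orthonormal n e" "i < n"
  shows "(\<Sum>k<n. c k *\<^sub>R e k) \<bullet> e i = c i"
proof -
  have "(\<Sum>k<n. c k *\<^sub>R e k) \<bullet> e i = (\<Sum>k<n. if k = i then c k else 0)"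
    unfolding inner_sum_left using assms by (intro sum.cong) (auto simp: orthonormalD)
  then show ?thesis using assms by simp
qed

lemma norm_orthonormal_sum:
  assumes "orthonormal n e"
  shows "(norm (\<Sum>k<n. c k *\<^sub>R e k))\<^sup>2 = (\<Sum>k<n. (c k)\<^sup>2)"
  unfolding power2_norm_eq_inner inner_sum_right
  using inner_orthonormal_sum[OF assms] by (intro sum.cong) (auto simp: power2_eq_square)

lemma proj_in_span: "proj n e x \<in> span (e ` {..<n})"
  unfolding proj_def by (intro span_sum span_scale span_base) auto

lemma inner_proj: "orthonormal n e \<Longrightarrow> i < n \<Longrightarrow> proj n e x \<bullet> e i = x \<bullet> e i"
  unfolding proj_def by (rule inner_orthonormal_sum)

lemma proj_linear: "proj n e (x + y) = proj n e x + proj n e y" "proj n e (c *\<^sub>R x) = c *\<^sub>R proj n e x"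
  by (simp_all add: proj_def inner_add_left scaleR_add_left sum.distrib scaleR_sum_right)

lemma proj_diff: "proj n e (x - y) = proj n e x - proj n e y"
  by (simp add: proj_def inner_diff_left scaleR_diff_left sum_subtractf)

lemma proj_span:
  assumes "orthonormal n e" "x \<in> span (e ` {..<n})"
  shows "proj n e x = x"
  using assms(2)
proof (induction rule: span_induct)
  case base
  then show ?case by (auto simp: subspace_def proj_linear) (simp add: proj_def)
next
  case (step x)
  then obtain i where i: "i < n" "x = e i" by auto
  have "proj n e x = (\<Sum>k<n. if k = i then e k else 0)"
    unfolding proj_def i using assms(1) i by (intro sum.cong) (auto simp: orthonormalD)
  then show ?case using i by simp
qed

lemma span_eq_zero_of_orthogonal:
  assumes "x \<in> span V" "\<And>v. v \<in> V \<Longrightarrow> y \<bullet> v = 0"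
  shows "y \<bullet> x = 0"
  using assms(1)
  by (induction rule: span_induct) (auto simp: subspace_def inner_add_right assms(2))

lemma proj_orthogonal:
  assumes "orthonormal n e" "y \<in> span (e ` {..<n})"
  shows "(x - proj n e x) \<bullet> y = 0"
  using assms(2)
  by (rule span_eq_zero_of_orthogonal) (auto simp: inner_diff_left inner_proj[OF assms(1)])

lemma norm_proj:
  assumes "orthonormal n e"
  shows "(norm (proj n e x))\<^sup>2 = (\<Sum>i<n. (x \<bullet> e i)\<^sup>2)"
  unfolding proj_def by (rule norm_orthonormal_sum[OF assms])

lemma norm_proj_diff:
  assumes "orthonormal n e"
  shows "(norm (x - proj n e x))\<^sup>2 = (norm x)\<^sup>2 - (norm (proj n e x))\<^sup>2"
proof -
  have "(x - proj n e x) \<bullet> proj n e x = 0" by (rule proj_orthogonal[OF assms proj_in_span])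
  then have "x \<bullet> proj n e x = proj n e x \<bullet> proj n e x" by (simp add: inner_diff_left)
  then show ?thesis unfolding power2_norm_eq_inner
    by (simp add: inner_diff_left inner_diff_right inner_commute)
qed

lemma bessel: "orthonormal n e \<Longrightarrow> (\<Sum>i<n. (x \<bullet> e i)\<^sup>2) \<le> (norm x)\<^sup>2"
  using norm_proj_diff[of n e x] norm_proj[of n e x] zero_le_power2[of "norm (x - proj n e x)"] by linarith

lemma norm_diff_proj_le: "orthonormal n e \<Longrightarrow> norm (x - proj n e x) \<le> norm x"
  by (rule power2_le_imp_le) (simp_all add: norm_proj_diff)

lemma orthonormal_extend:
  assumes "orthonormal n e" "norm x = 1" "\<And>i. i < n \<Longrightarrow> x \<bullet> e i = 0"
  shows "orthonormal (Suc n) (e(n := x))"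
proof -
  have "e i \<bullet> x = 0" if "i < n" for i using assms(3)[OF that] by (simp add: inner_commute)
  then show ?thesis using assms by (auto simp: orthonormal_def less_Suc_eq norm_eq_1)
qed

text \<open>If \<open>m\<close> exceeded \<open>n\<close>, a nontrivial combination of the
  \<open>g i\<close> would be orthogonal to every \<open>e j\<close>. Lying in their span, it equals
  its projection and hence vanishes, which orthonormality of \<open>g\<close> forbids.\<close>

lemma orthonormal_card_le:
  assumes "orthonormal m g" "orthonormal n e" "\<And>i. i < m \<Longrightarrow> g i \<in> span (e ` {..<n})"
  shows "m \<le> n"
proof (rule ccontr)
  assume "\<not> m \<le> n"
  then have "card {..<n} < card {..<m}" by simp
  from homogeneous_system_nontrivial[OF _ _ this, of "\<lambda>j k. g k \<bullet> e j"]
  obtain c where c: "\<exists>k<m. c k \<noteq> 0" "\<forall>j<n. (\<Sum>k<m. c k * (g k \<bullet> e j)) = 0" by auto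
  define x where "x = (\<Sum>k<m. c k *\<^sub>R g k)"
  have "x \<in> span (e ` {..<n})" unfolding x_def using assms(3) by (intro span_sum span_scale) auto
  then have "x = proj n e x" using proj_span[OF assms(2)] by simp
  also have "\<dots> = 0" unfolding proj_def x_def using c by (simp add: inner_sum_left)
  finally have "(\<Sum>k<m. (c k)\<^sup>2) = 0" using norm_orthonormal_sum[OF assms(1), of c] x_def by simp
  then show False using c by (auto simp: sum_nonneg_eq_0_iff)
qed

text \<open>A vector missed by the \<open>g i\<close> leaves a nonzero residue; normalised, it
  extends them to \<open>Suc n\<close> orthonormal vectors inside a span of dimension
  \<open>n\<close>.\<close>

lemma orthonormal_span_eq:
  assumes "orthonormal n g" "orthonormal n e" "\<And>i. i < n \<Longrightarrow> g i \<in> span (e ` {..<n})"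
    and "x \<in> span (e ` {..<n})"
  shows "x \<in> span (g ` {..<n})"
proof (rule ccontr)
  assume nx: "x \<notin> span (g ` {..<n})"
  define w where "w = x - proj n g x"
  have w0: "w \<noteq> 0" using nx proj_in_span[of n g x] unfolding w_def by auto
  have "span (g ` {..<n}) \<subseteq> span (e ` {..<n})" using assms(3) by (intro span_minimal) auto
  then have we: "w \<in> span (e ` {..<n})"
    unfolding w_def using assms(4) proj_in_span[of n g x] by (intro span_diff) auto
  have "orthonormal (Suc n) (g(n := w /\<^sub>R norm w))"
    using w0 proj_orthogonal[OF assms(1), of _ x]
    by (intro orthonormal_extend[OF assms(1)]) (auto simp: w_def span_base)
  moreover have "(g(n := w /\<^sub>R norm w)) i \<in> span (e ` {..<n})" if "i < Suc n" for i
    using assms(3) span_scale[OF we] that by (auto simp: less_Suc_eq)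
  ultimately have "Suc n \<le> n" using orthonormal_card_le[OF _ assms(2)] by blast
  then show False by simp
qed

section \<open>Compact unit spheres of finite-dimensional subspaces\<close>

text \<open>The ambient space may be infinite-dimensional and incomplete, so compactness comes from
  the coefficients: combinations with coefficients in \<open>[-1,1]\<close> are a continuous image
  of a cube, built up one coordinate at a time, and the unit sphere is a closed part of it.\<close>

lemma compact_span_sphere:
  fixes b :: "nat \<Rightarrow> 'a::real_inner"
  assumes "orthonormal n b"
  shows "compact {x \<in> span (b ` {..<n}). norm x = 1}"
proof -
  have box: "compact {\<Sum>i<k. c i *\<^sub>R b i | c. \<forall>i<k. \<bar>c i\<bar> \<le> (1::real)}" (is "compact (?B k)") for k
  proof (induction k)
    case 0
    have "?B 0 = {0}" by auto
    then show ?case by simp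
  next
    case (Suc k)
    have eq: "?B (Suc k) = (\<lambda>(c, x). x + c *\<^sub>R b k) ` ({-1..1} \<times> ?B k)" (is "_ = ?R")
    proof (intro equalityI subsetI)
      fix x assume "x \<in> ?B (Suc k)"
      then obtain c where c: "x = (\<Sum>i<Suc k. c i *\<^sub>R b i)" "\<forall>i<Suc k. \<bar>c i\<bar> \<le> 1" by auto
      have "(c k, \<Sum>i<k. c i *\<^sub>R b i) \<in> {-1..1} \<times> ?B k" using c by (auto simp: abs_le_iff)
      then show "x \<in> ?R" using c by (intro image_eqI[where x = "(c k, \<Sum>i<k. c i *\<^sub>R b i)"]) auto
    next
      fix x assume "x \<in> ?R"
      then obtain a c where c: "x = (\<Sum>i<k. c i *\<^sub>R b i) + a *\<^sub>R b k" "\<forall>i<k. \<bar>c i\<bar> \<le> 1" "\<bar>a\<bar> \<le> 1"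
        by (auto simp: abs_le_iff)
      then show "x \<in> ?B (Suc k)"
        by (auto simp: less_Suc_eq intro!: exI[of _ "c(k := a)"] sum.cong)
    qed
    show ?case unfolding eq
      by (intro compact_continuous_image compact_Times Suc) (auto simp: case_prod_unfold intro!: continuous_intros)
  qed
  have "{x \<in> span (b ` {..<n}). norm x = 1} = ?B n \<inter> {x. norm x = 1}"
  proof (intro equalityI subsetI)
    fix x assume x: "x \<in> {x \<in> span (b ` {..<n}). norm x = 1}"
    then have "x = (\<Sum>i<n. (x \<bullet> b i) *\<^sub>R b i)" using proj_span[OF assms, of x] by (simp add: proj_def)
    moreover have "\<bar>x \<bullet> b i\<bar> \<le> 1" if "i < n" for i
      using Cauchy_Schwarz_ineq2[of x "b i"] x orthonormal_norm[OF assms that] by simp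
    ultimately show "x \<in> ?B n \<inter> {x. norm x = 1}" using x by (auto intro!: exI[of _ "\<lambda>i. x \<bullet> b i"])
  next
    fix x assume "x \<in> ?B n \<inter> {x. norm x = 1}"
    then show "x \<in> {x \<in> span (b ` {..<n}). norm x = 1}"
      by (auto intro!: span_sum span_scale intro: span_base)
  qed
  moreover have "closed {x::'a. norm x = 1}" by (intro closed_Collect_eq continuous_intros)
  ultimately show ?thesis using box by (simp add: compact_Int_closed)
qed

text \<open>The feasible set of the \<open>j\<close>-th maximisation, both for eigenvectors
  (Rayleigh quotient) and for principal angles.\<close>

definition unit_complement :: "'a::real_inner set \<Rightarrow> (nat \<Rightarrow> 'a) \<Rightarrow> nat \<Rightarrow> 'a set" where
  "unit_complement X x j = {u \<in> X. norm u = 1 \<and> (\<forall>i<j. u \<bullet> x i = 0)}"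

lemma compact_unit_complement:
  assumes "orthonormal m f"
  shows "compact (unit_complement (span (f ` {..<m})) x j)"
proof -
  have "unit_complement (span (f ` {..<m})) x j =
      {x \<in> span (f ` {..<m}). norm x = 1} \<inter> (\<Inter>i<j. {u. u \<bullet> x i = 0})"
    by (auto simp: unit_complement_def)
  then show ?thesis
    by (auto intro!: compact_Int_closed compact_span_sphere[OF assms] closed_INT closed_Collect_eq continuous_intros)
qed

lemma unit_complement_nonempty:
  assumes "orthonormal m f" "j < m"
  shows "unit_complement (span (f ` {..<m})) x j \<noteq> {}"
proof -
  have "card {..<j} < card {..<m}" using assms by simp
  from homogeneous_system_nontrivial[OF _ _ this, of "\<lambda>j k. f k \<bullet> x j"]
  obtain c where c: "\<exists>k<m. c k \<noteq> 0" "\<forall>i<j. (\<Sum>k<m. c k * (f k \<bullet> x i)) = 0" by auto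
  define z where "z = (\<Sum>k<m. c k *\<^sub>R f k)"
  have "(norm z)\<^sup>2 = (\<Sum>k<m. (c k)\<^sup>2)" unfolding z_def by (rule norm_orthonormal_sum[OF assms(1)])
  moreover have "\<dots> \<noteq> 0" using c by (auto simp: sum_nonneg_eq_0_iff)
  ultimately have x0: "z \<noteq> 0" by auto
  have "z \<in> span (f ` {..<m})" unfolding z_def by (intro span_sum span_scale span_base) auto
  moreover have "z \<bullet> x i = 0" if "i < j" for i using c that by (simp add: z_def inner_sum_left)
  ultimately have "z /\<^sub>R norm z \<in> unit_complement (span (f ` {..<m})) x j"
    using x0 by (auto simp: unit_complement_def span_scale)
  then show ?thesis by auto
qed

text \<open>First-order condition at an extremum: \<open>s\<close> may have either sign, and near
  zero the linear term dominates.\<close>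

lemma linear_term_vanishes:
  fixes a b :: real
  assumes "\<And>s. 0 \<le> s * a + s\<^sup>2 * b"
  shows "a = 0"
proof (rule ccontr)
  assume a: "a \<noteq> 0"
  \<comment> \<open>With \<open>c = \<bar>b\<bar> + 1 > b\<close> the expression becomes
    \<open>(a / c)\<^sup>2 * (b - c)\<close>, which is negative.\<close>
  define s where "s = - a / (\<bar>b\<bar> + 1)"
  define c where "c = \<bar>b\<bar> + 1"
  have b: "c > 0" "b - c < 0" by (auto simp: c_def)
  have "s * a + s\<^sup>2 * b = (a\<^sup>2 / c\<^sup>2) * (b - c)"
    unfolding s_def c_def[symmetric] using b by (simp add: field_simps power2_eq_square)
  also have "\<dots> < 0" using a b by (intro mult_pos_neg) auto
  finally show False using assms[of s] by simp
qed

section \<open>Spectral theorem for symmetric nonnegative operators of finite rank\<close>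

text \<open>Each eigenvector maximises the Rayleigh quotient among unit vectors orthogonal to the
  earlier ones. The last conjunct is carried through the induction because it gives the decreasing
  order: a new maximiser was already a competitor at every earlier stage.\<close>

lemma greedy_eigenbasis:
  fixes F :: "'a::real_inner \<Rightarrow> 'a"
  assumes b: "orthonormal n b" and F: "linear F" and sym: "\<And>x y. F x \<bullet> y = x \<bullet> F y"
    and psd: "\<And>x. 0 \<le> F x \<bullet> x" and rng: "\<And>x. F x \<in> span (b ` {..<n})"
    and j: "j \<le> n"
  shows "\<exists>e \<mu>. orthonormal j e \<and> (\<forall>i<j. e i \<in> span (b ` {..<n}) \<and> F (e i) = \<mu> i *\<^sub>R e i \<and> 0 \<le> \<mu> i) \<and>
     (\<forall>i<j. \<forall>k<i. \<mu> i \<le> \<mu> k) \<and>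
     (\<forall>x\<in>span (b ` {..<n}). (\<forall>i<j. x \<bullet> e i = 0) \<longrightarrow> (\<forall>i<j. F x \<bullet> x \<le> \<mu> i * (norm x)\<^sup>2))"
  using j
proof (induction j)
  case 0
  then show ?case by (auto simp: orthonormal_def)
next
  case (Suc j)
  let ?U = "span (b ` {..<n})"
  obtain e \<mu> where e0: "orthonormal j e"
    "\<forall>i<j. e i \<in> ?U \<and> F (e i) = \<mu> i *\<^sub>R e i \<and> 0 \<le> \<mu> i" "\<forall>i<j. \<forall>k<i. \<mu> i \<le> \<mu> k"
    "\<forall>x\<in>?U. (\<forall>i<j. x \<bullet> e i = 0) \<longrightarrow> (\<forall>i<j. F x \<bullet> x \<le> \<mu> i * (norm x)\<^sup>2)"
    using Suc.IH[OF Suc_leD[OF Suc.prems]] by blast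
  have e: "orthonormal j e" "\<And>i. i < j \<Longrightarrow> e i \<in> ?U" "\<And>i. i < j \<Longrightarrow> F (e i) = \<mu> i *\<^sub>R e i"
    "\<And>i. i < j \<Longrightarrow> 0 \<le> \<mu> i" "\<And>i k. i < j \<Longrightarrow> k < i \<Longrightarrow> \<mu> i \<le> \<mu> k"
    "\<And>x i. x \<in> ?U \<Longrightarrow> (\<forall>i<j. x \<bullet> e i = 0) \<Longrightarrow> i < j \<Longrightarrow> F x \<bullet> x \<le> \<mu> i * (norm x)\<^sup>2"
    using e0 by simp_all
  define K where "K = unit_complement ?U e j"
  have "compact K" unfolding K_def by (rule compact_unit_complement[OF b])
  moreover have "K \<noteq> {}" unfolding K_def using Suc.prems by (intro unit_complement_nonempty[OF b]) simp
  \<comment> \<open>\<open>F\<close> is only assumed to be linear; on the span of \<open>b\<close>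
    continuity is read off its finite expansion.\<close>
  moreover have "continuous_on K (\<lambda>x. F x \<bullet> x)"
  proof -
    have "continuous_on ?U (\<lambda>x. \<Sum>i<n. (x \<bullet> b i) *\<^sub>R F (b i))" by (intro continuous_intros)
    moreover have "F x = (\<Sum>i<n. (x \<bullet> b i) *\<^sub>R F (b i))" if "x \<in> ?U" for x
    proof -
      have "F x = F (proj n b x)" using proj_span[OF b that] by simp
      then show ?thesis unfolding proj_def by (simp add: linear_sum[OF F] linear_scale[OF F])
    qed
    ultimately have "continuous_on ?U F" by (simp cong: continuous_on_cong)
    then have "continuous_on K F" by (rule continuous_on_subset) (auto simp: K_def unit_complement_def)
    then show ?thesis by (intro continuous_intros)
  qed
  ultimately obtain x0 where x0: "x0 \<in> K" "\<And>x. x \<in> K \<Longrightarrow> F x \<bullet> x \<le> F x0 \<bullet> x0"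
    using continuous_attains_sup[of K "\<lambda>x. F x \<bullet> x"] by auto
  define l where "l = F x0 \<bullet> x0"
  have x0': "x0 \<in> ?U" "norm x0 = 1" "\<And>i. i < j \<Longrightarrow> x0 \<bullet> e i = 0" using x0 by (auto simp: K_def unit_complement_def)
  have max: "F x \<bullet> x \<le> l * (norm x)\<^sup>2" if x: "x \<in> ?U" "\<forall>i<j. x \<bullet> e i = 0" for x
  proof (cases "x = 0")
    case True
    then show ?thesis by simp
  next
    case False
    then have "x /\<^sub>R norm x \<in> K" using x by (auto simp: K_def unit_complement_def span_scale)
    then have "F (x /\<^sub>R norm x) \<bullet> (x /\<^sub>R norm x) \<le> l" using x0 l_def by blast
    then show ?thesis using False by (simp add: linear_scale[OF F] field_simps power2_eq_square)
  qed
  \<comment> \<open>Moving the maximiser in an admissible direction \<open>y\<close> gives a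
    quadratic inequality in \<open>s\<close>; its linear coefficient is twice the inner product in
    question, up to sign.\<close>
  have ort: "(F x0 - l *\<^sub>R x0) \<bullet> y = 0" if y: "y \<in> ?U" "\<forall>i<j. y \<bullet> e i = 0" for y
  proof -
    have "0 \<le> s * (2 * (l * (x0 \<bullet> y) - F x0 \<bullet> y)) + s\<^sup>2 * (l * (y \<bullet> y) - F y \<bullet> y)" for s
    proof -
      have "F (x0 + s *\<^sub>R y) \<bullet> (x0 + s *\<^sub>R y) \<le> l * (norm (x0 + s *\<^sub>R y))\<^sup>2"
        using x0' y by (intro max) (auto simp: span_add span_scale inner_add_left)
      moreover have "x0 \<bullet> x0 = 1" using x0' by (simp add: norm_eq_1)
      moreover have "F y \<bullet> x0 = F x0 \<bullet> y" using sym[of y x0] by (simp add: inner_commute)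
      moreover have "x0 \<bullet> F x0 = l" by (simp add: l_def inner_commute)
      ultimately show ?thesis unfolding power2_norm_eq_inner
        by (simp add: linear_add[OF F] linear_scale[OF F] inner_add_left inner_add_right
            algebra_simps power2_eq_square inner_commute)
    qed
    from linear_term_vanishes[OF this] show ?thesis by (simp add: inner_diff_left)
  qed
  \<comment> \<open>The residual is itself an admissible direction: by symmetry of \<open>F\<close>
    it is orthogonal to the earlier eigenvectors. So it is orthogonal to itself, and
    \<open>x0\<close> is an eigenvector.\<close>
  have "F x0 - l *\<^sub>R x0 \<in> ?U" using rng x0' by (intro span_diff span_scale) auto
  moreover have "(F x0 - l *\<^sub>R x0) \<bullet> e i = 0" if "i < j" for i
    using that x0' e(3) by (simp add: inner_diff_left sym)
  ultimately have "(F x0 - l *\<^sub>R x0) \<bullet> (F x0 - l *\<^sub>R x0) = 0" using ort by blast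
  then have eig: "F x0 = l *\<^sub>R x0" by simp
  have l0: "0 \<le> l" unfolding l_def by (rule psd)
  have lm: "l \<le> \<mu> i" if "i < j" for i using e(6)[of x0 i] x0' that by (simp add: l_def)
  define e' where "e' = e(j := x0)"
  define \<mu>' where "\<mu>' = \<mu>(j := l)"
  have "orthonormal (Suc j) e'" unfolding e'_def using x0' e by (intro orthonormal_extend) auto
  moreover have "e' i \<in> ?U \<and> F (e' i) = \<mu>' i *\<^sub>R e' i \<and> 0 \<le> \<mu>' i" if "i < Suc j" for i
    using that e(2-4) x0' eig l0 by (auto simp: e'_def \<mu>'_def less_Suc_eq)
  moreover have "\<mu>' i \<le> \<mu>' k" if "i < Suc j" "k < i" for i k
    using that e(5) lm by (auto simp: \<mu>'_def less_Suc_eq)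
  moreover have "F x \<bullet> x \<le> \<mu>' i * (norm x)\<^sup>2"
    if "x \<in> ?U" "\<forall>i<Suc j. x \<bullet> e' i = 0" "i < Suc j" for x i
  proof -
    have "\<forall>i<j. x \<bullet> e i = 0" using that(2) by (auto simp: e'_def less_Suc_eq)
    then show ?thesis using that e(6)[of x i] max[of x] by (auto simp: \<mu>'_def less_Suc_eq)
  qed
  ultimately show ?case by blast
qed

text \<open>Only strictly positive eigenvalues are listed, so \<open>m\<close> is the rank of
  \<open>F\<close>; zero padding is added where two operators are compared.\<close>

definition spectral_form :: "nat \<Rightarrow> (nat \<Rightarrow> 'a::real_inner) \<Rightarrow> (nat \<Rightarrow> real) \<Rightarrow> ('a \<Rightarrow> 'a) \<Rightarrow> bool" where
  "spectral_form m e \<mu> F \<longleftrightarrow> orthonormal m e \<and> (\<forall>i<m. 0 < \<mu> i) \<and> (\<forall>i<m. \<forall>k<i. \<mu> i \<le> \<mu> k) \<and>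
     (\<forall>x. F x = (\<Sum>i<m. (\<mu> i * (e i \<bullet> x)) *\<^sub>R e i))"

theorem spectral_theorem_finite_rank:
  fixes F :: "'a::real_inner \<Rightarrow> 'a"
  assumes b: "orthonormal n b" and F: "linear F" and sym: "\<And>x y. F x \<bullet> y = x \<bullet> F y"
    and psd: "\<And>x. 0 \<le> F x \<bullet> x" and rng: "\<And>x. F x \<in> span (b ` {..<n})"
  obtains m e \<mu> where "spectral_form m e \<mu> F" "\<And>i. i < m \<Longrightarrow> e i \<in> span (b ` {..<n})"
proof -
  obtain e \<mu> where e: "orthonormal n e" "\<And>i. i < n \<Longrightarrow> e i \<in> span (b ` {..<n})" 
    "\<And>i. i < n \<Longrightarrow> F (e i) = \<mu> i *\<^sub>R e i"
    "\<And>i. i < n \<Longrightarrow> 0 \<le> \<mu> i" "\<And>i k. i < n \<Longrightarrow> k < i \<Longrightarrow> \<mu> i \<le> \<mu> k"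
    using greedy_eigenbasis[OF b F sym psd rng order_refl] by metis
  \<comment> \<open>Cuts the decreasing list at its first zero; the alternative
    \<open>m \<ge> n\<close> makes the minimum exist when there is none.\<close>
  define m where "m = (LEAST m. m \<ge> n \<or> \<mu> m = 0)"
  have m: "m \<ge> n \<or> \<mu> m = 0" unfolding m_def by (rule LeastI[of _ n]) simp
  have m': "k < n \<and> \<mu> k \<noteq> 0" if "k < m" for k using not_less_Least[OF that[unfolded m_def]] by auto
  have mn: "m \<le> n" unfolding m_def by (rule Least_le) simp
  have z: "\<mu> i = 0" if "m \<le> i" "i < n" for i
    using m that e(4,5)[of i] e(5)[of i m] by (cases "i = m") auto
  have rep: "F x = (\<Sum>i<m. (\<mu> i * (e i \<bullet> x)) *\<^sub>R e i)" for x
  proof -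
    have "F x \<in> span (e ` {..<n})" by (rule orthonormal_span_eq[OF e(1) b e(2) rng])
    then have "F x = proj n e (F x)" using proj_span[OF e(1)] by simp
    also have "\<dots> = (\<Sum>i<n. (\<mu> i * (e i \<bullet> x)) *\<^sub>R e i)" unfolding proj_def
      using e(3) by (intro sum.cong) (auto simp: sym inner_commute)
    also have "\<dots> = (\<Sum>i<m. (\<mu> i * (e i \<bullet> x)) *\<^sub>R e i)"
      using mn z by (intro sum.mono_neutral_right) auto
    finally show ?thesis .
  qed
  have pos: "0 < \<mu> i" if "i < m" for i using m'[OF that] e(4)[of i] by auto
  have "spectral_form m e \<mu> F" unfolding spectral_form_def
    using orthonormal_mono[OF e(1) mn] pos rep e(5) mn by auto
  then show ?thesis using that e(2) mn by auto
qed

lemma spectral_form_quadratic: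
  assumes "spectral_form m e \<mu> F"
  shows "F x \<bullet> x = (\<Sum>i<m. \<mu> i * (x \<bullet> e i)\<^sup>2)"
proof -
  have "F x \<bullet> x = (\<Sum>i<m. (\<mu> i * (e i \<bullet> x)) *\<^sub>R e i) \<bullet> x" using assms by (simp add: spectral_form_def)
  also have "\<dots> = (\<Sum>i<m. \<mu> i * (e i \<bullet> x) * (e i \<bullet> x))" by (simp add: inner_sum_left)
  finally show ?thesis by (simp add: power2_eq_square inner_commute[of x] mult.assoc)
qed

section \<open>Perturbation of eigenvalues and eigenspaces\<close>

text \<open>Courant-Fischer argument: among the combinations of the first \<open>i + 1\<close>
  eigenvectors of \<open>F\<close> there is a nonzero \<open>x\<close> orthogonal to the first
  \<open>i\<close> eigenvectors of \<open>G\<close>. On \<open>x\<close> the form of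
  \<open>F\<close> is at least \<open>\<mu> i\<close> and that of \<open>G\<close> at most the
  padded \<open>\<nu> i\<close>, each times \<open>(norm x)\<^sup>2\<close>.\<close>

lemma weyl_one_sided:
  assumes F: "spectral_form m e \<mu> F" and G: "spectral_form n f \<nu> G"
    and d: "\<And>x. F x \<bullet> x \<le> G x \<bullet> x + \<delta> * (norm x)\<^sup>2" and d0: "0 \<le> \<delta>"
  shows "(if i < m then \<mu> i else 0) \<le> (if i < n then \<nu> i else 0) + \<delta>"
proof (cases "i < m")
  case False
  have "0 \<le> (if i < n then \<nu> i else 0)" using G by (auto simp: spectral_form_def less_imp_le)
  then show ?thesis using False d0 by simp
next
  case True
  have oe: "orthonormal m e" and \<mu>: "\<And>i. i < m \<Longrightarrow> 0 < \<mu> i" "\<And>i k. i < m \<Longrightarrow> k < i \<Longrightarrow> \<mu> i \<le> \<mu> k"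
    using F by (auto simp: spectral_form_def)
  have of: "orthonormal n f" and \<nu>: "\<And>i. i < n \<Longrightarrow> 0 < \<nu> i" "\<And>i k. i < n \<Longrightarrow> k < i \<Longrightarrow> \<nu> i \<le> \<nu> k"
    using G by (auto simp: spectral_form_def)
  have "card {..<i} < card {..i}" by simp
  from homogeneous_system_nontrivial[OF _ _ this, of "\<lambda>j k. e k \<bullet> f j"]
  obtain c where c: "\<exists>k\<le>i. c k \<noteq> 0" "\<forall>j<i. (\<Sum>k\<le>i. c k * (e k \<bullet> f j)) = 0" by auto
  define x where "x = (\<Sum>k<Suc i. c k *\<^sub>R e k)"
  have oe': "orthonormal (Suc i) e" using orthonormal_mono[OF oe] True by simp
  have nx: "(norm x)\<^sup>2 = (\<Sum>k<Suc i. (c k)\<^sup>2)" unfolding x_def by (rule norm_orthonormal_sum[OF oe'])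
  moreover have "\<dots> \<noteq> 0" using c by (auto simp: sum_nonneg_eq_0_iff lessThan_Suc_atMost simp del: sum.lessThan_Suc)
  ultimately have x0: "0 < (norm x)\<^sup>2" by (metis zero_less_power2 power2_eq_iff_nonneg zero_eq_power2)
  have xe: "x \<bullet> e k = c k" if "k < Suc i" for k unfolding x_def by (rule inner_orthonormal_sum[OF oe' that])
  have xf: "x \<bullet> f j = 0" if "j < i" for j using c that
    by (simp add: x_def inner_sum_left lessThan_Suc_atMost del: sum.lessThan_Suc)
  have "\<mu> i * (norm x)\<^sup>2 = (\<Sum>k<Suc i. \<mu> i * (c k)\<^sup>2)" by (simp add: nx sum_distrib_left del: sum.lessThan_Suc)
  also have "\<dots> \<le> (\<Sum>k<Suc i. \<mu> k * (x \<bullet> e k)\<^sup>2)"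
  proof (rule sum_mono)
    fix k assume k: "k \<in> {..<Suc i}"
    have "\<mu> i \<le> \<mu> k" using k \<mu>(2)[OF True, of k] by (cases "k = i") auto
    then show "\<mu> i * (c k)\<^sup>2 \<le> \<mu> k * (x \<bullet> e k)\<^sup>2" using xe k by (auto intro!: mult_right_mono)
  qed
  also have "\<dots> \<le> (\<Sum>k<m. \<mu> k * (x \<bullet> e k)\<^sup>2)"
    using True \<mu>(1) by (intro sum_mono2) (auto intro!: mult_nonneg_nonneg intro: less_imp_le)
  also have "\<dots> = F x \<bullet> x" by (rule spectral_form_quadratic[OF F, symmetric])
  also have "\<dots> \<le> G x \<bullet> x + \<delta> * (norm x)\<^sup>2" by (rule d)
  also have "G x \<bullet> x = (\<Sum>k<n. \<nu> k * (x \<bullet> f k)\<^sup>2)" by (rule spectral_form_quadratic[OF G])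
  \<comment> \<open>Terms with \<open>k < i\<close> vanish by the choice of \<open>x\<close>. A term
    with \<open>k \<ge> i\<close> exists only if \<open>i < n\<close>, and then monotonicity
    applies; so the padding value 0 is correct for \<open>i \<ge> n\<close>.\<close>
  also have "\<dots> \<le> (\<Sum>k<n. (if i < n then \<nu> i else 0) * (x \<bullet> f k)\<^sup>2)"
  proof (rule sum_mono)
    fix k assume k: "k \<in> {..<n}"
    show "\<nu> k * (x \<bullet> f k)\<^sup>2 \<le> (if i < n then \<nu> i else 0) * (x \<bullet> f k)\<^sup>2"
    proof (cases "k < i")
      case True
      then show ?thesis using xf by simp
    next
      case False
      then have "\<nu> k \<le> (if i < n then \<nu> i else 0)" using k \<nu>(2)[of k i] by (cases "k = i") auto
      then show ?thesis by (rule mult_right_mono) simp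
    qed
  qed
  also have "\<dots> = (if i < n then \<nu> i else 0) * (\<Sum>k<n. (x \<bullet> f k)\<^sup>2)" by (simp add: sum_distrib_left)
  also have "\<dots> \<le> (if i < n then \<nu> i else 0) * (norm x)\<^sup>2"
    using bessel[OF of, of x] \<nu>(1) by (intro mult_left_mono) (auto intro: less_imp_le)
  finally have "\<mu> i * (norm x)\<^sup>2 \<le> ((if i < n then \<nu> i else 0) + \<delta>) * (norm x)\<^sup>2" by (simp add: algebra_simps)
  then show ?thesis using x0 True by (simp only: mult_le_cancel_right_pos if_True)
qed

lemma weyl_inequality:
  assumes F: "spectral_form m e \<mu> F" and G: "spectral_form n f \<nu> G"
    and d: "\<And>x. norm (F x - G x) \<le> \<delta> * norm x" and d0: "0 \<le> \<delta>"
  shows "\<bar>(if i < m then \<mu> i else 0) - (if i < n then \<nu> i else 0)\<bar> \<le> \<delta>"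
proof -
  have 1: "\<bar>(F x - G x) \<bullet> x\<bar> \<le> \<delta> * (norm x)\<^sup>2" for x
  proof -
    have "\<bar>(F x - G x) \<bullet> x\<bar> \<le> norm (F x - G x) * norm x" by (rule Cauchy_Schwarz_ineq2)
    also have "\<dots> \<le> \<delta> * norm x * norm x" by (intro mult_right_mono d) simp
    finally show ?thesis by (simp add: power2_eq_square)
  qed
  have "F x \<bullet> x \<le> G x \<bullet> x + \<delta> * (norm x)\<^sup>2" "G x \<bullet> x \<le> F x \<bullet> x + \<delta> * (norm x)\<^sup>2" for x
    using 1[of x] by (simp_all add: inner_diff_left abs_le_iff)
  from weyl_one_sided[OF F G this(1) d0, of i] weyl_one_sided[OF G F this(2) d0, of i]
  show ?thesis unfolding abs_le_iff by linarith
qed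

text \<open>Since \<open>F\<close> maps into the span of the \<open>g i\<close>, the part of \<open>x = G x'\<close> orthogonal to that
  span equals the one of \<open>G x' - F x'\<close>; no spectral gap of \<open>G\<close> is needed.\<close>

lemma davis_kahan:
  assumes F: "spectral_form m e \<mu> F" and g: "orthonormal m g" "\<And>i. i < m \<Longrightarrow> F (g i) = \<mu> i *\<^sub>R g i"
    and G: "linear G" and f: "orthonormal m f" "\<And>i. i < m \<Longrightarrow> G (f i) = \<nu> i *\<^sub>R f i"
    and d: "\<And>x. norm (F x - G x) \<le> \<delta> * norm x" and d0: "0 \<le> \<delta>"
    and w: "\<And>i. i < m \<Longrightarrow> \<bar>\<mu> i - \<nu> i\<bar> \<le> \<delta>"
    and x: "x \<in> span (f ` {..<m})" and m: "1 \<le> m"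
  shows "norm (x - proj m g x) \<le> 2 * \<delta> / \<mu> (m - 1) * norm x"
proof -
  define l where "l = \<mu> (m - 1)"
  have l0: "0 < l" using F m by (simp add: spectral_form_def l_def)
  have lm: "l \<le> \<mu> i" if "i < m" for i
    using F that m unfolding l_def spectral_form_def by (cases "i = m - 1") auto
  have "norm (x - proj m g x) \<le> 2 * \<delta> / l * norm x"
  \<comment> \<open>For \<open>l \<le> 2 * \<delta>\<close> the factor is at least 1 and the claim
    is trivial. Otherwise every \<open>\<nu> i\<close> is at least \<open>l / 2\<close>, so
    \<open>G\<close> can be inverted on the span of \<open>f\<close>.\<close>
  proof (cases "l \<le> 2 * \<delta>")
    case True
    then have "1 * norm x \<le> 2 * \<delta> / l * norm x" using l0 by (intro mult_right_mono) (auto simp: field_simps)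
    then show ?thesis using norm_diff_proj_le[OF g(1), of x] by linarith
  next
    case False
    have \<nu>: "l / 2 \<le> \<nu> i" if "i < m" for i using w[OF that] lm[OF that] False unfolding abs_le_iff by linarith
    \<comment> \<open>The preimage of \<open>x\<close> under \<open>G\<close>; the lower bound on
      \<open>\<nu>\<close> gives \<open>norm y \<le> 2 / l * norm x\<close>, which is where the
      factor 2 of the claim arises.\<close>
    define y where "y = (\<Sum>i<m. ((x \<bullet> f i) / \<nu> i) *\<^sub>R f i)"
    have "G y = (\<Sum>i<m. ((x \<bullet> f i) / \<nu> i) *\<^sub>R (\<nu> i *\<^sub>R f i))"
      unfolding y_def by (simp add: linear_sum[OF G] linear_scale[OF G] f(2) del: scaleR_scaleR)
    also have "\<dots> = proj m f x" unfolding proj_def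
    proof (intro sum.cong refl)
      fix i assume "i \<in> {..<m}"
      then have "\<nu> i \<noteq> 0" using \<nu>[of i] l0 by force
      then show "((x \<bullet> f i) / \<nu> i) *\<^sub>R (\<nu> i *\<^sub>R f i) = (x \<bullet> f i) *\<^sub>R f i" by simp
    qed
    finally have Gy: "G y = x" using proj_span[OF f(1) x] by simp
    have "(norm y)\<^sup>2 = (\<Sum>i<m. ((x \<bullet> f i) / \<nu> i)\<^sup>2)" unfolding y_def by (rule norm_orthonormal_sum[OF f(1)])
    also have "\<dots> \<le> (\<Sum>i<m. (2 / l)\<^sup>2 * (x \<bullet> f i)\<^sup>2)"
    proof (rule sum_mono)
      fix i assume "i \<in> {..<m}"
      then have "0 < l / 2" "l / 2 \<le> \<nu> i" using \<nu> l0 by auto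
      then have "1 / \<nu> i \<le> 2 / l" "0 < \<nu> i" using l0 by (auto simp: field_simps)
      then have "(1 / \<nu> i)\<^sup>2 \<le> (2 / l)\<^sup>2" by (intro power_mono) auto
      then have "(1 / \<nu> i)\<^sup>2 * (x \<bullet> f i)\<^sup>2 \<le> (2 / l)\<^sup>2 * (x \<bullet> f i)\<^sup>2" by (rule mult_right_mono) simp
      then show "((x \<bullet> f i) / \<nu> i)\<^sup>2 \<le> (2 / l)\<^sup>2 * (x \<bullet> f i)\<^sup>2" by (simp add: power_divide)
    qed
    also have "\<dots> \<le> (2 / l)\<^sup>2 * (norm x)\<^sup>2"
      unfolding sum_distrib_left[symmetric] by (intro mult_left_mono bessel[OF f(1)]) simp
    finally have "(norm y)\<^sup>2 \<le> (2 / l * norm x)\<^sup>2" unfolding power_mult_distrib .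
    then have ny: "norm y \<le> 2 / l * norm x" by (rule power2_le_imp_le) (use l0 in simp)
    have Fs: "F z \<in> span (e ` {..<m})" for z
    proof -
      have "F z = (\<Sum>i<m. (\<mu> i * (e i \<bullet> z)) *\<^sub>R e i)" using F by (simp add: spectral_form_def)
      then show ?thesis by (auto intro!: span_sum span_scale intro: span_base)
    qed
    have "F y \<in> span (e ` {..<m})" by (rule Fs)
    \<comment> \<open>The \<open>g i\<close> are eigenvectors for positive eigenvalues and so lie in
      the range of \<open>F\<close>; being \<open>m\<close> orthonormal vectors in the span of
      \<open>m\<close> others, they span it.\<close>
    then have "F y \<in> span (g ` {..<m})"
    proof (rule orthonormal_span_eq[OF g(1), rotated 2])
      show "orthonormal m e" using F by (simp add: spectral_form_def)
      fix i assume i: "i < m"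
      have "\<mu> i *\<^sub>R g i \<in> span (e ` {..<m})" unfolding g(2)[OF i, symmetric] by (rule Fs)
      then have "(1 / \<mu> i) *\<^sub>R \<mu> i *\<^sub>R g i \<in> span (e ` {..<m})" by (rule span_scale)
      then show "g i \<in> span (e ` {..<m})" using lm[OF i] l0 by simp
    qed
    then have "F y - proj m g (F y) = 0" using proj_span[OF g(1)] by simp
    then have "x - proj m g x = (G y - F y) - proj m g (G y - F y)" by (simp add: Gy proj_diff)
    then have "norm (x - proj m g x) \<le> norm (F y - G y)"
      using norm_diff_proj_le[OF g(1), of "G y - F y"] by (simp add: norm_minus_commute)
    also have "\<dots> \<le> \<delta> * norm y" by (rule d)
    also have "\<dots> \<le> \<delta> * (2 / l * norm x)" by (intro mult_left_mono d0 ny)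
    finally show ?thesis by (simp add: mult_ac)
  qed
  then show ?thesis unfolding l_def .
qed


section \<open>Principal angles in an inner product space\<close>

text \<open>The counterpart of \<open>principal_vectors\<close> after passing to
  coordinates.\<close>

definition principal_pair ::
  "nat \<Rightarrow> 'a::real_inner set \<Rightarrow> 'a set \<Rightarrow> (nat \<Rightarrow> 'a) \<Rightarrow> (nat \<Rightarrow> 'a) \<Rightarrow> bool" where
  "principal_pair m X Y x y \<longleftrightarrow> (\<forall>j<m. x j \<in> unit_complement X x j \<and> y j \<in> unit_complement Y y j \<and>
     (\<forall>u\<in>unit_complement X x j. \<forall>w\<in>unit_complement Y y j. \<bar>u \<bullet> w\<bar> \<le> \<bar>x j \<bullet> y j\<bar>))"

lemma unit_complement_cong: "(\<And>i. i < j \<Longrightarrow> x i = x' i) \<Longrightarrow> unit_complement X x j = unit_complement X x' j"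
  by (auto simp: unit_complement_def)

lemma principal_pair_exists:
  assumes "orthonormal m f" "orthonormal m e"
  shows "\<exists>x y. principal_pair m (span (f ` {..<m})) (span (e ` {..<m})) x y"
proof -
  let ?X = "span (f ` {..<m})" and ?Y = "span (e ` {..<m})"
  have "k \<le> m \<Longrightarrow> \<exists>x y. principal_pair k ?X ?Y x y" for k
  proof (induction k)
    case 0
    then show ?case by (auto simp: principal_pair_def)
  next
    case (Suc k)
    then obtain x y where xy: "principal_pair k ?X ?Y x y" by auto
    let ?P = "unit_complement ?X x k \<times> unit_complement ?Y y k"
    have "compact ?P" by (intro compact_Times compact_unit_complement assms)
    moreover have "?P \<noteq> {}" using unit_complement_nonempty[OF assms(1)] unit_complement_nonempty[OF assms(2)] Suc.prems by auto
    moreover have "continuous_on ?P (\<lambda>p. \<bar>fst p \<bullet> snd p\<bar>)" by (intro continuous_intros)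
    ultimately have "\<exists>p\<in>?P. \<forall>q\<in>?P. \<bar>fst q \<bullet> snd q\<bar> \<le> \<bar>fst p \<bullet> snd p\<bar>" by (rule continuous_attains_sup)
    then obtain p where p: "p \<in> ?P" "\<And>q. q \<in> ?P \<Longrightarrow> \<bar>fst q \<bullet> snd q\<bar> \<le> \<bar>fst p \<bullet> snd p\<bar>" by blast
    define x' where "x' = x(k := fst p)"
    define y' where "y' = y(k := snd p)"
    \<comment> \<open>The constraint at stage \<open>j\<close> looks only at indices below
      \<open>j\<close>, so redefining index \<open>k\<close> leaves the stages up to and including
      \<open>k\<close> unchanged.\<close>
    have ux: "unit_complement ?X x' j = unit_complement ?X x j" if "j \<le> k" for j
      using that by (intro unit_complement_cong) (auto simp: x'_def)
    have uy: "unit_complement ?Y y' j = unit_complement ?Y y j" if "j \<le> k" for j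
      using that by (intro unit_complement_cong) (auto simp: y'_def)
    have "principal_pair (Suc k) ?X ?Y x' y'" unfolding principal_pair_def
    proof (intro allI impI)
      fix j assume j: "j < Suc k"
      show "x' j \<in> unit_complement ?X x' j \<and> y' j \<in> unit_complement ?Y y' j \<and>
        (\<forall>u\<in>unit_complement ?X x' j. \<forall>w\<in>unit_complement ?Y y' j. \<bar>u \<bullet> w\<bar> \<le> \<bar>x' j \<bullet> y' j\<bar>)"
      proof (cases "j = k")
        case True
        then show ?thesis using p ux[of k] uy[of k] by (auto simp: x'_def y'_def)
      next
        case False
        then have jk: "j < k" using j by simp
        then have "x' j = x j" "y' j = y j" by (auto simp: x'_def y'_def)
        then show ?thesis using xy jk ux[of j] uy[of j] by (simp add: principal_pair_def)
      qed
    qed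
    then show ?case by blast
  qed
  then show ?thesis by blast
qed

text \<open>Each new maximum is tested with the projection of \<open>x j\<close> onto \<open>Y\<close>, corrected to be orthogonal
  to the earlier \<open>y i\<close>; the correction is controlled by the earlier angles through Bessel's
  inequality. This loses a factor \<open>2 ^ j\<close>, which is harmless because \<open>m\<close> is bounded.\<close>

lemma principal_pair_sine_bound:
  fixes X Y :: "'a::real_inner set"
  assumes e: "orthonormal m e" and Y: "Y = span (e ` {..<m})"
    and xy: "principal_pair m X Y x y"
    and gap: "\<And>u. u \<in> X \<Longrightarrow> norm (u - proj m e u) \<le> \<epsilon> * norm u" and eps: "0 \<le> \<epsilon>" and j: "j < m"
  shows "1 - (x j \<bullet> y j)\<^sup>2 \<le> 2 ^ j * \<epsilon>\<^sup>2"
  using j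
proof (induction j rule: less_induct)
  case (less j)
  have xu: "x i \<in> X" "norm (x i) = 1" "\<And>k. k < i \<Longrightarrow> x i \<bullet> x k = 0" if "i < m" for i
    using xy that by (auto simp: principal_pair_def unit_complement_def)
  have yu: "y i \<in> Y" "norm (y i) = 1" "\<And>k. k < i \<Longrightarrow> y i \<bullet> y k = 0" if "i < m" for i
    using xy that by (auto simp: principal_pair_def unit_complement_def)
  have ony: "orthonormal j y" unfolding orthonormal_def
  proof (intro allI impI)
    fix i k assume "i < j" "k < j"
    then have "y i \<bullet> y i = 1" "k < i \<Longrightarrow> y i \<bullet> y k = 0" "i < k \<Longrightarrow> y k \<bullet> y i = 0"
      using less.prems yu[of i] yu[of k] by (auto simp: norm_eq_1)
    then show "y i \<bullet> y k = (if i = k then 1 else 0)"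
      by (cases i k rule: linorder_cases) (auto simp: inner_commute)
  qed
  define z where "z = proj m e (x j)"
  define z' where "z' = z - proj j y z"
  have zY: "z \<in> Y" unfolding z_def Y by (rule proj_in_span)
  have "proj j y z \<in> span Y" unfolding proj_def using yu less.prems by (auto intro!: span_sum span_scale intro: span_base)
  then have z'Y: "z' \<in> Y" using zY unfolding z'_def Y by (auto simp: span_span intro!: span_diff)
  have zin: "z \<bullet> u = x j \<bullet> u" if "u \<in> Y" for u
    using proj_orthogonal[OF e, of u "x j"] that unfolding z_def Y by (simp add: inner_diff_left)
  have bound: "(x j \<bullet> y i)\<^sup>2 \<le> 1 - (x i \<bullet> y i)\<^sup>2" if i: "i < j" for i
  proof -
    define q where "q k = (if k = 0 then x i else x j)" for k :: nat
    have "x i \<bullet> x j = 0" "x j \<bullet> x i = 0" using xu(3)[of j i] i less.prems by (auto simp: inner_commute)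
    then have "orthonormal 2 q" using xu(2)[of i] xu(2)[of j] i less.prems
      by (auto simp: orthonormal_def q_def norm_eq_1)
    from bessel[OF this, of "y i"] have "(y i \<bullet> x i)\<^sup>2 + (y i \<bullet> x j)\<^sup>2 \<le> 1"
      using yu(2)[of i] i less.prems by (simp add: numeral_2_eq_2 q_def)
    then show ?thesis by (simp add: inner_commute)
  qed
  have "(norm (x j - z))\<^sup>2 \<le> \<epsilon>\<^sup>2"
    using gap[OF xu(1)[OF less.prems]] xu(2)[OF less.prems] eps unfolding z_def by (intro power_mono) auto
  then have nz: "(norm z)\<^sup>2 \<ge> 1 - \<epsilon>\<^sup>2"
    using norm_proj_diff[OF e, of "x j"] xu(2)[OF less.prems] unfolding z_def by simp
  have "(\<Sum>i<j. (z \<bullet> y i)\<^sup>2) \<le> (\<Sum>i<j. 2 ^ i * \<epsilon>\<^sup>2)"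
  proof (rule sum_mono)
    fix i assume "i \<in> {..<j}"
    then have i: "i < j" "i < m" using less.prems by auto
    have "(z \<bullet> y i)\<^sup>2 \<le> 1 - (x i \<bullet> y i)\<^sup>2" using bound[OF i(1)] zin yu(1)[OF i(2)] by simp
    then show "(z \<bullet> y i)\<^sup>2 \<le> 2 ^ i * \<epsilon>\<^sup>2" using less.IH[OF i] by linarith
  qed
  \<comment> \<open>The geometric sum falls short of \<open>2 ^ j * \<epsilon>\<^sup>2\<close> by
    one \<open>\<epsilon>\<^sup>2\<close>, exactly what the projection onto \<open>Y\<close> has
    already cost in \<open>nz\<close>. This is why powers of 2 reproduce themselves in the
    induction.\<close>
  also have "(\<Sum>i<j. 2 ^ i * \<epsilon>\<^sup>2) = 2 ^ j * \<epsilon>\<^sup>2 - \<epsilon>\<^sup>2"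
    by (induction j) (simp_all add: algebra_simps)
  finally have nz': "(norm z')\<^sup>2 \<ge> 1 - 2 ^ j * \<epsilon>\<^sup>2"
    unfolding z'_def norm_proj_diff[OF ony] norm_proj[OF ony] using nz by linarith
  have "(norm z')\<^sup>2 \<le> (x j \<bullet> y j)\<^sup>2"
  proof (cases "z' = 0")
    case True
    then show ?thesis by simp
  next
    case False
    define w where "w = z' /\<^sub>R norm z'"
    have "w \<in> Y" using z'Y unfolding w_def Y by (rule span_scale)
    moreover have "z' \<bullet> y i = 0" if "i < j" for i
      unfolding z'_def using that by (intro proj_orthogonal[OF ony]) (auto intro: span_base)
    ultimately have "w \<in> unit_complement Y y j" using False by (auto simp: unit_complement_def w_def)
    then have "\<bar>x j \<bullet> w\<bar> \<le> \<bar>x j \<bullet> y j\<bar>" using xy less.prems unfolding principal_pair_def by blast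
    \<comment> \<open>\<open>x j - z\<close> is orthogonal to \<open>Y\<close>, and
      \<open>z - z'\<close> is orthogonal to \<open>z'\<close>; hence \<open>x j\<close> and
      \<open>z\<close> have the same inner product with \<open>z'\<close> as \<open>z'\<close>
      itself.\<close>
    moreover have "x j \<bullet> w = norm z'"
    proof -
      have "z' \<bullet> proj j y z = 0" unfolding z'_def by (rule proj_orthogonal[OF ony proj_in_span])
      then have "z \<bullet> z' = z' \<bullet> z'" by (simp add: z'_def inner_diff_left inner_diff_right inner_commute)
      then have "x j \<bullet> z' = (norm z')\<^sup>2" using zin[OF z'Y] by (simp add: power2_norm_eq_inner)
      then show ?thesis using False by (simp add: w_def power2_eq_square)
    qed
    ultimately show ?thesis by (metis abs_le_square_iff abs_norm_cancel)
  qed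
  then show ?case using nz' by linarith
qed

section \<open>Empirical operators on square-integrable fields\<close>

text \<open>The number of coordinates depends on the functions at hand, so a single inner product
  space with orthonormal systems of every length is wanted. Finite support keeps all inner products
  finite sums, without any convergence question.\<close>

typedef fin_seq = "{f :: nat \<Rightarrow> real. finite {i. f i \<noteq> 0}}" morphisms entry Fin_seq
  by (intro exI[of _ "\<lambda>_. 0"]) simp

lemma finite_entry: "finite {i. entry f i \<noteq> 0}"
  using entry[of f] by simp

lemma fin_seq_eqI: "(\<And>i. entry f i = entry g i) \<Longrightarrow> f = g"
  by (metis entry_inject ext)

instantiation fin_seq :: real_inner
begin

definition "0 = Fin_seq (\<lambda>_. 0)"
definition "f + g = Fin_seq (\<lambda>i. entry f i + entry g i)"
definition "- f = Fin_seq (\<lambda>i. - entry f i)"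
definition "f - g = Fin_seq (\<lambda>i. entry f i - entry g i)"
definition "c *\<^sub>R f = Fin_seq (\<lambda>i. c * entry f i)"
definition "f \<bullet> g = (\<Sum>i | entry f i \<noteq> 0. entry f i * entry g i)"
definition "norm (f :: fin_seq) = sqrt (f \<bullet> f)"
definition "sgn (f :: fin_seq) = inverse (norm f) *\<^sub>R f"
definition "dist (f :: fin_seq) g = norm (f - g)"
definition "uniformity = (INF e\<in>{0<..}. principal {(f :: fin_seq, g). dist f g < e})"
definition "open (U :: fin_seq set) \<longleftrightarrow> (\<forall>f\<in>U. eventually (\<lambda>(f', g). f' = f \<longrightarrow> g \<in> U) uniformity)"

lemma entry_simps:
  "entry 0 i = 0" "entry (f + g) i = entry f i + entry g i" "entry (- f) i = - entry f i"
  "entry (f - g) i = entry f i - entry g i" "entry (c *\<^sub>R f) i = c * entry f i"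
proof -
  have "finite {i. entry f i + entry g i \<noteq> 0}" "finite {i. entry f i - entry g i \<noteq> 0}"
    by (rule finite_subset[OF _ finite_UnI[OF finite_entry[of f] finite_entry[of g]]], auto)+
  moreover have "finite {i. - entry f i \<noteq> 0}" "finite {i. c * entry f i \<noteq> 0}"
    by (rule finite_subset[OF _ finite_entry[of f]], auto)+
  ultimately show "entry 0 i = 0" "entry (f + g) i = entry f i + entry g i" "entry (- f) i = - entry f i"
    "entry (f - g) i = entry f i - entry g i" "entry (c *\<^sub>R f) i = c * entry f i"
    by (simp_all add: zero_fin_seq_def plus_fin_seq_def uminus_fin_seq_def minus_fin_seq_def
        scaleR_fin_seq_def Fin_seq_inverse)
qed

text \<open>The definition sums over the support of the first argument only. Allowing any finite
  superset lets symmetry and linearity be checked over one common index set.\<close>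

lemma inner_fin_seq: "finite I \<Longrightarrow> {i. entry f i \<noteq> 0} \<subseteq> I \<Longrightarrow> f \<bullet> g = (\<Sum>i\<in>I. entry f i * entry g i)"
  unfolding inner_fin_seq_def by (rule sum.mono_neutral_left) auto

instance
proof
  fix x y z :: fin_seq and a b r :: real
  show "x + y + z = x + (y + z)" "x + y = y + x" "0 + x = x" "- x + x = 0" "x - y = x + - y"
    "a *\<^sub>R (x + y) = a *\<^sub>R x + a *\<^sub>R y" "(a + b) *\<^sub>R x = a *\<^sub>R x + b *\<^sub>R x"
    "a *\<^sub>R b *\<^sub>R x = (a * b) *\<^sub>R x" "1 *\<^sub>R x = x"
    by (rule fin_seq_eqI, simp add: entry_simps algebra_simps)+
  show "dist x y = norm (x - y)" "sgn x = inverse (norm x) *\<^sub>R x" "norm x = sqrt (x \<bullet> x)"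
    "uniformity = (INF e\<in>{0<..}. principal {(x :: fin_seq, y). dist x y < e})"
    by (simp_all add: dist_fin_seq_def sgn_fin_seq_def norm_fin_seq_def uniformity_fin_seq_def)
  show "open U \<longleftrightarrow> (\<forall>x\<in>U. eventually (\<lambda>(x', y). x' = x \<longrightarrow> y \<in> U) uniformity)" for U :: "fin_seq set"
    by (rule open_fin_seq_def)
  define I where "I = {i. entry x i \<noteq> 0} \<union> {i. entry y i \<noteq> 0}"
  have I: "finite I" by (auto simp: I_def finite_entry)
  have sub: "{i. entry x i \<noteq> 0} \<subseteq> I" "{i. entry y i \<noteq> 0} \<subseteq> I" "{i. entry (x + y) i \<noteq> 0} \<subseteq> I"
    "{i. entry (r *\<^sub>R x) i \<noteq> 0} \<subseteq> I"
    by (auto simp: I_def entry_simps)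
  have sums: "x \<bullet> u = (\<Sum>i\<in>I. entry x i * entry u i)" "y \<bullet> u = (\<Sum>i\<in>I. entry y i * entry u i)"
    "(x + y) \<bullet> u = (\<Sum>i\<in>I. entry (x + y) i * entry u i)"
    "(r *\<^sub>R x) \<bullet> u = (\<Sum>i\<in>I. entry (r *\<^sub>R x) i * entry u i)" for u
    using inner_fin_seq[OF I, of x] inner_fin_seq[OF I, of y] inner_fin_seq[OF I, of "x + y"]
      inner_fin_seq[OF I, of "r *\<^sub>R x"] sub by blast+
  show "x \<bullet> y = y \<bullet> x" by (simp add: sums mult.commute)
  show "(x + y) \<bullet> z = x \<bullet> z + y \<bullet> z" by (simp add: sums entry_simps algebra_simps sum.distrib)
  show "(r *\<^sub>R x) \<bullet> y = r * (x \<bullet> y)" by (simp add: sums entry_simps algebra_simps sum_distrib_left)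
  show "0 \<le> x \<bullet> x" by (simp add: inner_fin_seq_def sum_nonneg)
  show "(x \<bullet> x = 0) = (x = 0)"
  proof
    assume "x \<bullet> x = 0"
    then have "\<forall>i\<in>{i. entry x i \<noteq> 0}. entry x i * entry x i = 0"
      unfolding inner_fin_seq_def by (subst (asm) sum_nonneg_eq_0_iff) (auto simp: finite_entry)
    then show "x = 0" by (intro fin_seq_eqI) (auto simp: entry_simps)
  qed (simp add: inner_fin_seq_def entry_simps)
qed

end

definition unit_seq :: "nat \<Rightarrow> fin_seq" where
  "unit_seq k = Fin_seq (\<lambda>i. if i = k then 1 else 0)"

lemma orthonormal_unit_seq: "orthonormal n unit_seq"
proof -
  have e: "entry (unit_seq k) i = (if i = k then 1 else 0)" for i k
    unfolding unit_seq_def by (subst Fin_seq_inverse) auto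
  have "unit_seq i \<bullet> unit_seq j = (\<Sum>k\<in>{i}. entry (unit_seq i) k * entry (unit_seq j) k)" for i j
    by (rule inner_fin_seq) (auto simp: e)
  then show ?thesis by (auto simp: orthonormal_def e)
qed

section \<open>Linear algebra of square-integrable fields modulo null functions\<close>

lemma L2_bound:
  fixes f :: "'d::euclidean_space \<Rightarrow> 'd"
  assumes "f \<in> borel_measurable M" "integrable M b" "\<And>x. (norm (f x))\<^sup>2 \<le> b x"
  shows "f \<in> L2 M"
  using assms(1) unfolding L2_def
  by (auto intro!: Bochner_Integration.integrable_bound[OF assms(2)] AE_I2 order_trans[OF assms(3)])

lemma L2_add:
  assumes "f \<in> L2 M" "g \<in> L2 M"
  shows "(\<lambda>x. f x + g x) \<in> L2 M"
proof (rule L2_bound)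
  show "integrable M (\<lambda>x. 2 * (norm (f x))\<^sup>2 + 2 * (norm (g x))\<^sup>2)" using assms by (auto simp: L2_def intro: borel_measurable_inner)
  show "(norm (f x + g x))\<^sup>2 \<le> 2 * (norm (f x))\<^sup>2 + 2 * (norm (g x))\<^sup>2" for x
  proof -
    have "0 \<le> (norm (f x - g x))\<^sup>2" by simp
    then show ?thesis unfolding power2_norm_eq_inner
      by (simp add: inner_add_left inner_add_right inner_diff_left inner_diff_right)
  qed
qed (use assms in \<open>auto simp: L2_def intro: borel_measurable_inner\<close>)

lemma L2_scale: "f \<in> L2 M \<Longrightarrow> (\<lambda>x. c *\<^sub>R f x) \<in> L2 M"
  by (rule L2_bound[of _ _ "\<lambda>x. c\<^sup>2 * (norm (f x))\<^sup>2"]) (auto simp: L2_def power_mult_distrib)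

lemma L2_zero: "(\<lambda>x. 0) \<in> L2 M"
  by (simp add: L2_def)

lemma L2_diff: "f \<in> L2 M \<Longrightarrow> g \<in> L2 M \<Longrightarrow> (\<lambda>x. f x - g x) \<in> L2 M"
  using L2_add[of f M "\<lambda>x. (-1) *\<^sub>R g x"] L2_scale[of g M "-1"] by simp

lemma L2_sum: "finite I \<Longrightarrow> (\<And>i. i \<in> I \<Longrightarrow> f i \<in> L2 M) \<Longrightarrow> (\<lambda>x. \<Sum>i\<in>I. f i x) \<in> L2 M"
  by (induction I rule: finite_induct) (auto intro: L2_zero L2_add)

lemma L2_combination: "finite I \<Longrightarrow> (\<And>i. i \<in> I \<Longrightarrow> f i \<in> L2 M) \<Longrightarrow> (\<lambda>x. \<Sum>i\<in>I. c i *\<^sub>R f i x) \<in> L2 M"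
  by (intro L2_sum L2_scale)

lemma L2_integrable_inner:
  assumes "f \<in> L2 M" "g \<in> L2 M"
  shows "integrable M (\<lambda>x. f x \<bullet> g x)"
proof (rule Bochner_Integration.integrable_bound)
  show "integrable M (\<lambda>x. (norm (f x))\<^sup>2 + (norm (g x))\<^sup>2)" using assms by (auto simp: L2_def intro: borel_measurable_inner)
  show "(\<lambda>x. f x \<bullet> g x) \<in> borel_measurable M" using assms by (auto simp: L2_def intro: borel_measurable_inner)
  show "AE x in M. norm (f x \<bullet> g x) \<le> norm ((norm (f x))\<^sup>2 + (norm (g x))\<^sup>2)"
  proof (intro AE_I2)
    fix x
    have "norm (f x \<bullet> g x) \<le> norm (f x) * norm (g x)" using Cauchy_Schwarz_ineq2 by simp
    also have "\<dots> \<le> (norm (f x))\<^sup>2 + (norm (g x))\<^sup>2"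
      using sum_squares_bound[of "norm (f x)" "norm (g x)"] mult_nonneg_nonneg[OF norm_ge_zero norm_ge_zero, of "f x" "g x"] by linarith
    finally show "norm (f x \<bullet> g x) \<le> norm ((norm (f x))\<^sup>2 + (norm (g x))\<^sup>2)" by simp
  qed
qed

lemma L2_inner_commute: "L2_inner M f g = L2_inner M g f"
  by (simp add: L2_inner_def inner_commute)

lemma L2_inner_scale: "L2_inner M (\<lambda>x. c *\<^sub>R f x) g = c * L2_inner M f g"
    "L2_inner M f (\<lambda>x. c *\<^sub>R g x) = c * L2_inner M f g"
  by (simp_all add: L2_inner_def)

lemma L2_inner_sum_right:
  assumes "f \<in> L2 M" "finite I" "\<And>i. i \<in> I \<Longrightarrow> g i \<in> L2 M"
  shows "L2_inner M f (\<lambda>x. \<Sum>i\<in>I. c i *\<^sub>R g i x) = (\<Sum>i\<in>I. c i * L2_inner M f (g i))"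
proof -
  have "L2_inner M f (\<lambda>x. \<Sum>i\<in>I. c i *\<^sub>R g i x) = (LINT x|M. (\<Sum>i\<in>I. c i * (f x \<bullet> g i x)))"
    by (simp add: L2_inner_def inner_sum_right)
  also have "\<dots> = (\<Sum>i\<in>I. c i * L2_inner M f (g i))" unfolding L2_inner_def
    using assms L2_integrable_inner[OF assms(1)]
    by (subst Bochner_Integration.integral_sum) auto
  finally show ?thesis .
qed

lemma L2_inner_diff_right:
  "f \<in> L2 M \<Longrightarrow> g \<in> L2 M \<Longrightarrow> h \<in> L2 M \<Longrightarrow> L2_inner M f (\<lambda>x. g x - h x) = L2_inner M f g - L2_inner M f h"
  by (simp add: L2_inner_def inner_diff_right L2_integrable_inner)

lemma L2_inner_sum_left:
  assumes "f \<in> L2 M" "finite I" "\<And>i. i \<in> I \<Longrightarrow> g i \<in> L2 M"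
  shows "L2_inner M (\<lambda>x. \<Sum>i\<in>I. c i *\<^sub>R g i x) f = (\<Sum>i\<in>I. c i * L2_inner M (g i) f)"
  using L2_inner_sum_right[OF assms] by (simp add: L2_inner_commute[of M _ f])

lemma L2_inner_cong_AE:
  assumes "f \<in> L2 M" "f' \<in> L2 M" "g \<in> L2 M" "g' \<in> L2 M" "AE x in M. f x = f' x" "AE x in M. g x = g' x"
  shows "L2_inner M f g = L2_inner M f' g'"
  unfolding L2_inner_def
proof (rule integral_cong_AE)
  show "AE x in M. f x \<bullet> g x = f' x \<bullet> g' x" using assms(5,6) by eventually_elim simp
qed (use assms in \<open>auto simp: L2_def intro: borel_measurable_inner\<close>)

lemma L2_inner_self_nonneg: "0 \<le> L2_inner M f f"
  by (simp add: L2_inner_def)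

lemma L2_inner_self_eq_0:
  assumes "f \<in> L2 M"
  shows "L2_inner M f f = 0 \<longleftrightarrow> (AE x in M. f x = 0)"
proof -
  have "L2_inner M f f = 0 \<longleftrightarrow> (AE x in M. f x \<bullet> f x = 0)"
    unfolding L2_inner_def using L2_integrable_inner[OF assms assms] by (intro integral_nonneg_eq_0_iff_AE) auto
  then show ?thesis by simp
qed

lemma AE_combination_cong:
  assumes "finite I" "\<And>i. i \<in> I \<Longrightarrow> AE x in M. f i x = g i x"
  shows "AE x in M. (\<Sum>i\<in>I. c i *\<^sub>R f i x) = (\<Sum>i\<in>I. c i *\<^sub>R g i x)"
proof -
  have "AE x in M. \<forall>i\<in>I. f i x = g i x" using assms by (intro AE_finite_allI)
  then show ?thesis by eventually_elim (intro sum.cong, auto)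
qed

definition L2_orthonormal :: "'d::euclidean_space measure \<Rightarrow> nat \<Rightarrow> (nat \<Rightarrow> 'd \<Rightarrow> 'd) \<Rightarrow> bool" where
  "L2_orthonormal M n e \<longleftrightarrow> (\<forall>i<n. e i \<in> L2 M) \<and>
     (\<forall>i<n. \<forall>j<n. L2_inner M (e i) (e j) = (if i = j then 1 else 0))"

lemma L2_orthonormal_sum:
  assumes "L2_orthonormal M n e" "i < n"
  shows "L2_inner M (e i) (\<lambda>x. \<Sum>k<n. c k *\<^sub>R e k x) = c i"
proof -
  have "L2_inner M (e i) (\<lambda>x. \<Sum>k<n. c k *\<^sub>R e k x) = (\<Sum>k<n. c k * L2_inner M (e i) (e k))"
    using assms by (intro L2_inner_sum_right) (auto simp: L2_orthonormal_def)
  also have "\<dots> = (\<Sum>k<n. if k = i then c k else 0)"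
    using assms by (intro sum.cong) (auto simp: L2_orthonormal_def)
  finally show ?thesis using assms by simp
qed

lemma L2_orthonormal_coeff:
  assumes "L2_orthonormal M n e" "i < n" "f \<in> L2 M" "AE x in M. f x = (\<Sum>k<n. c k *\<^sub>R e k x)"
  shows "L2_inner M (e i) f = c i"
proof -
  have e: "\<And>k. k < n \<Longrightarrow> e k \<in> L2 M" using assms by (simp add: L2_orthonormal_def)
  have "L2_inner M (e i) f = L2_inner M (e i) (\<lambda>x. \<Sum>k<n. c k *\<^sub>R e k x)"
    using assms e by (intro L2_inner_cong_AE L2_combination) auto
  then show ?thesis using L2_orthonormal_sum[OF assms(1,2)] by simp
qed

lemma L2_orthonormal_independent:
  assumes "L2_orthonormal M n e"
  shows "L2_independent M n e"
  unfolding L2_independent_def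
proof (intro allI impI)
  fix c i assume z: "AE x in M. (\<Sum>i<n. c i *\<^sub>R e i x) = 0" and i: "i < n"
  from z have "AE x in M. (0::'a) = (\<Sum>i<n. c i *\<^sub>R e i x)" by eventually_elim simp
  from L2_orthonormal_coeff[OF assms i L2_zero this] show "c i = 0" by (simp add: L2_inner_def)
qed

text \<open>With more than \<open>card P\<close> functions, some nontrivial combination cancels the
  coefficient of every \<open>g j\<close>, and independence fails.\<close>

lemma L2_independent_le:
  assumes "L2_independent M m e" "finite P" "\<And>i. i < m \<Longrightarrow> AE x in M. e i x = (\<Sum>j\<in>P. a i j *\<^sub>R g j x)"
  shows "m \<le> card P"
proof (rule ccontr)
  assume "\<not> m \<le> card P"
  then have "card P < card {..<m}" by simp
  from homogeneous_system_nontrivial[OF assms(2) _ this, of "\<lambda>j k. a k j"]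
  obtain c where c: "\<exists>k<m. c k \<noteq> 0" "\<forall>j\<in>P. (\<Sum>k<m. c k * a k j) = 0" by auto
  have "AE x in M. \<forall>i\<in>{..<m}. e i x = (\<Sum>j\<in>P. a i j *\<^sub>R g j x)"
    using assms(3) by (intro AE_finite_allI) auto
  then have "AE x in M. (\<Sum>i<m. c i *\<^sub>R e i x) = 0"
  proof eventually_elim
    case (elim x)
    then have "(\<Sum>i<m. c i *\<^sub>R e i x) = (\<Sum>i<m. \<Sum>j\<in>P. (c i * a i j) *\<^sub>R g j x)"
      by (simp add: scaleR_sum_right)
    also have "\<dots> = (\<Sum>j\<in>P. (\<Sum>i<m. c i * a i j) *\<^sub>R g j x)"
      by (subst sum.swap) (simp add: scaleR_sum_left)
    finally show ?case using c by simp
  qed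
  then show False using assms(1) c unfolding L2_independent_def by blast
qed

lemma gram_schmidt_L2:
  assumes "finite H" "H \<subseteq> L2 M"
  shows "\<exists>r q. L2_orthonormal M r q \<and> (\<forall>h\<in>H. AE x in M. h x = (\<Sum>k<r. L2_inner M (q k) h *\<^sub>R q k x))"
  using assms
proof (induction H rule: finite_induct)
  case empty
  show ?case by (intro exI[of _ 0]) (auto simp: L2_orthonormal_def)
next
  case (insert h H)
  then obtain r q where q: "L2_orthonormal M r q"
    and H: "\<And>h. h \<in> H \<Longrightarrow> AE x in M. h x = (\<Sum>k<r. L2_inner M (q k) h *\<^sub>R q k x)" by auto
  have qL: "q k \<in> L2 M" if "k < r" for k using q that by (simp add: L2_orthonormal_def)
  have hL: "h \<in> L2 M" using insert by auto
  define p where "p = (\<lambda>x. \<Sum>k<r. L2_inner M (q k) h *\<^sub>R q k x)"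
  define w where "w = (\<lambda>x. h x - p x)"
  have pL: "p \<in> L2 M" unfolding p_def using qL by (intro L2_combination) auto
  have wL: "w \<in> L2 M" unfolding w_def by (rule L2_diff[OF hL pL])
  have qw: "L2_inner M (q k) w = 0" if "k < r" for k
  proof -
    have "L2_inner M (q k) p = L2_inner M (q k) h" unfolding p_def by (rule L2_orthonormal_sum[OF q that])
    then show ?thesis unfolding w_def using L2_inner_diff_right[OF qL[OF that] hL pL] by simp
  qed
  show ?case
  \<comment> \<open>A residue of norm zero is a null function, so \<open>h\<close> is already a
    combination almost everywhere and no new vector is added; otherwise the residue can be
    normalised.\<close>
  proof (cases "L2_inner M w w = 0")
    case True
    then have "AE x in M. w x = 0" using L2_inner_self_eq_0[OF wL] by simp
    then have "AE x in M. h x = (\<Sum>k<r. L2_inner M (q k) h *\<^sub>R q k x)"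
      by eventually_elim (simp add: w_def p_def)
    then show ?thesis using q H by (intro exI[of _ r] exI[of _ q]) auto
  next
    case False
    define s where "s = sqrt (L2_inner M w w)"
    have s0: "s > 0" "s\<^sup>2 = L2_inner M w w" using False L2_inner_self_nonneg[of M w] by (auto simp: s_def)
    define q' where "q' = q(r := (\<lambda>x. (1 / s) *\<^sub>R w x))"
    have q'r: "q' r = (\<lambda>x. (1 / s) *\<^sub>R w x)" by (simp add: q'_def)
    have q'k: "q' k = q k" if "k < r" for k using that by (simp add: q'_def)
    have rr: "L2_inner M (q' r) (q' r) = 1"
      unfolding q'r L2_inner_scale s0(2)[symmetric] using s0(1) by (simp add: power2_eq_square)
    have kr: "L2_inner M (q' k) (q' r) = 0" "L2_inner M (q' r) (q' k) = 0" if "k < r" for k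
      using qw[OF that] unfolding q'r q'k[OF that] by (simp_all add: L2_inner_scale L2_inner_commute[of M w])
    have q'L: "q' k \<in> L2 M" if "k < Suc r" for k
      using that qL wL by (auto simp: less_Suc_eq q'r q'k intro: L2_scale)
    have ort: "L2_orthonormal M (Suc r) q'"
      using q q'L rr kr by (auto simp: L2_orthonormal_def less_Suc_eq q'k)
    have "AE x in M. g x = (\<Sum>k<Suc r. L2_inner M (q' k) g *\<^sub>R q' k x)" if g: "g \<in> insert h H" for g
    proof (cases "g = h")
      case True
      have "L2_inner M w h = L2_inner M w w"
      proof -
        have "L2_inner M w p = 0" unfolding p_def using L2_inner_sum_right[OF wL, of "{..<r}" q] qL qw
          by (simp add: L2_inner_commute[of M w])
        then show ?thesis using L2_inner_diff_right[OF wL hL pL] by (simp add: w_def)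
      qed
      then have "L2_inner M (q' r) h = s\<^sup>2 / s" unfolding q'r L2_inner_scale s0(2) by simp
      then have "L2_inner M (q' r) h = s" by (simp add: power2_eq_square)
      then have "h x = (\<Sum>k<Suc r. L2_inner M (q' k) h *\<^sub>R q' k x)" for x
        using s0 by (simp add: q'k q'r w_def p_def)
      then show ?thesis using True by simp
    next
      case False
      then have gH: "g \<in> H" "g \<in> L2 M" using g insert by auto
      \<comment> \<open>\<open>g\<close> was fully expanded in the old vectors, to which the new one
        is orthogonal, so its expansion acquires only a zero coefficient.\<close>
      have "L2_inner M (q' r) g = L2_inner M (q' r) (\<lambda>x. \<Sum>k<r. L2_inner M (q k) g *\<^sub>R q k x)"
        using H[OF gH(1)] gH q'L[of r] qL by (intro L2_inner_cong_AE L2_combination) auto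
      also have "\<dots> = (\<Sum>k<r. L2_inner M (q k) g * L2_inner M (q' r) (q k))"
        using q'L[of r] qL by (intro L2_inner_sum_right) auto
      also have "\<dots> = 0" using kr(2) by (intro sum.neutral) (auto simp: q'k)
      finally have "L2_inner M (q' r) g = 0" .
      then show ?thesis using H[OF gH(1)] by (simp add: q'k)
    qed
    then show ?thesis using ort by blast
  qed
qed

section \<open>Empirical operators in coordinates\<close>

lemma empirical_operator_L2:
  "(\<And>i. i < N \<Longrightarrow> v i \<in> L2 M) \<Longrightarrow> empirical_operator M N v f \<in> L2 M"
  unfolding empirical_operator_def[abs_def] by (intro L2_scale L2_combination) auto

definition sample_operator :: "nat \<Rightarrow> (nat \<Rightarrow> 'a::real_inner) \<Rightarrow> 'a \<Rightarrow> 'a" where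
  "sample_operator N u x = (1 / real N) *\<^sub>R (\<Sum>i<N. (u i \<bullet> x) *\<^sub>R u i)"

lemma linear_sample_operator: "linear (sample_operator N u)"
  by (rule linearI) (simp_all add: sample_operator_def inner_add_right scaleR_add_left sum.distrib
      scaleR_add_right scaleR_sum_right mult_ac)

lemma sample_operator_symmetric: "sample_operator N u x \<bullet> y = x \<bullet> sample_operator N u y"
  by (simp add: sample_operator_def inner_sum_left inner_sum_right inner_commute mult_ac)

lemma sample_operator_nonneg: "0 \<le> sample_operator N u x \<bullet> x"
  by (simp add: sample_operator_def inner_sum_left sum_nonneg)

text \<open>Each rank-one difference splits as \<open>(u i \<bullet> x) *\<^sub>R (u i - w i) + ((u
  i - w i) \<bullet> x) *\<^sub>R w i\<close>, bounded by \<open>a * b\<close> and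
  \<open>b * (a + b)\<close> times \<open>norm x\<close>. The average of \<open>N\<close> such terms
  obeys the same bound, which is therefore free of \<open>N\<close>.\<close>

lemma norm_sample_operator_diff:
  assumes N: "1 \<le> N" and a: "\<And>i. i < N \<Longrightarrow> norm (u i) \<le> a" and b: "\<And>i. i < N \<Longrightarrow> norm (w i - u i) \<le> b"
  shows "norm (sample_operator N u x - sample_operator N w x) \<le> (2 * a + b) * b * norm x"
proof -
  have ab: "0 \<le> a" "0 \<le> b" using order_trans[OF norm_ge_zero a[of 0]] order_trans[OF norm_ge_zero b[of 0]] N by auto
  have eq: "sample_operator N u x - sample_operator N w x =
      (1 / real N) *\<^sub>R (\<Sum>i<N. (u i \<bullet> x) *\<^sub>R (u i - w i) + ((u i - w i) \<bullet> x) *\<^sub>R w i)"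
    unfolding sample_operator_def scaleR_diff_right[symmetric] sum_subtractf[symmetric]
    by (simp add: inner_diff_left algebra_simps)
  have bound: "norm ((u i \<bullet> x) *\<^sub>R (u i - w i) + ((u i - w i) \<bullet> x) *\<^sub>R w i) \<le> (2 * a + b) * b * norm x"
    if i: "i < N" for i
  proof -
    have d: "norm (u i - w i) \<le> b" using b[OF i] by (simp add: norm_minus_commute)
    have w: "norm (w i) \<le> a + b" using norm_triangle_ineq[of "u i" "w i - u i"] a[OF i] b[OF i] by simp
    have "norm ((u i \<bullet> x) *\<^sub>R (u i - w i)) \<le> (norm (u i) * norm x) * norm (u i - w i)"
      using Cauchy_Schwarz_ineq2[of "u i" x] by (simp add: mult_right_mono)
    also have "\<dots> \<le> (a * norm x) * b" using a[OF i] d ab by (intro mult_mono) auto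
    finally have 1: "norm ((u i \<bullet> x) *\<^sub>R (u i - w i)) \<le> a * norm x * b" .
    have "norm (((u i - w i) \<bullet> x) *\<^sub>R w i) \<le> (norm (u i - w i) * norm x) * norm (w i)"
      using Cauchy_Schwarz_ineq2[of "u i - w i" x] by (simp add: mult_right_mono)
    also have "\<dots> \<le> (b * norm x) * (a + b)" using w d ab by (intro mult_mono) auto
    finally have 2: "norm (((u i - w i) \<bullet> x) *\<^sub>R w i) \<le> b * norm x * (a + b)" .
    have "norm ((u i \<bullet> x) *\<^sub>R (u i - w i) + ((u i - w i) \<bullet> x) *\<^sub>R w i) \<le> a * norm x * b + b * norm x * (a + b)"
      by (rule norm_triangle_le) (use 1 2 in linarith)
    then show ?thesis by (simp add: algebra_simps)
  qed
  have "norm (\<Sum>i<N. (u i \<bullet> x) *\<^sub>R (u i - w i) + ((u i - w i) \<bullet> x) *\<^sub>R w i) \<le> (\<Sum>i<N. (2 * a + b) * b * norm x)"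
    using bound by (intro sum_norm_le) auto
  then have "norm (sample_operator N u x - sample_operator N w x) \<le> (1 / real N) * (\<Sum>i<N. (2 * a + b) * b * norm x)"
    unfolding eq norm_scaleR by (simp only: abs_of_nonneg mult_left_mono of_nat_0_le_iff zero_le_divide_1_iff)
  then show ?thesis using N by simp
qed

text \<open>The coordinates with respect to a finite orthonormal system of \<open>L\<^sup>2\<close> make linear algebra modulo null
  functions into linear algebra in an inner product space.\<close>

locale L2_frame =
  fixes M :: "'d::euclidean_space measure" and r :: nat and q :: "nat \<Rightarrow> 'd \<Rightarrow> 'd"
  assumes orth: "L2_orthonormal M r q"
begin

definition coords :: "('d \<Rightarrow> 'd) \<Rightarrow> fin_seq" where
  "coords h = (\<Sum>k<r. L2_inner M (q k) h *\<^sub>R unit_seq k)"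

definition of_coords :: "fin_seq \<Rightarrow> 'd \<Rightarrow> 'd" where
  "of_coords c = (\<lambda>x. \<Sum>k<r. (c \<bullet> unit_seq k) *\<^sub>R q k x)"

text \<open>Membership in the span of the frame up to null sets. \<open>coords\<close> makes sense
  for every function but loses the part orthogonal to the frame; on captured functions it is an
  isometry.\<close>

definition captured :: "('d \<Rightarrow> 'd) \<Rightarrow> bool" where
  "captured h \<longleftrightarrow> h \<in> L2 M \<and> (AE x in M. h x = of_coords (coords h) x)"

lemma q_L2: "k < r \<Longrightarrow> q k \<in> L2 M"
  using orth by (simp add: L2_orthonormal_def)

lemma of_coords_L2: "of_coords c \<in> L2 M"
  unfolding of_coords_def by (intro L2_combination) (auto simp: q_L2)

lemma capturedD: "captured h \<Longrightarrow> h \<in> L2 M" "captured h \<Longrightarrow> AE x in M. h x = of_coords (coords h) x"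
  by (simp_all add: captured_def)

lemma coords_unit: "k < r \<Longrightarrow> coords h \<bullet> unit_seq k = L2_inner M (q k) h"
  unfolding coords_def by (rule inner_orthonormal_sum[OF orthonormal_unit_seq])

lemma coords_in_span: "coords h \<in> span (unit_seq ` {..<r})"
  unfolding coords_def by (intro span_sum span_scale span_base) auto

lemma of_coords_coords: "of_coords (coords h) = (\<lambda>x. \<Sum>k<r. L2_inner M (q k) h *\<^sub>R q k x)"
  unfolding of_coords_def by (intro ext sum.cong) (auto simp: coords_unit)

lemma coords_of_coords: "c \<in> span (unit_seq ` {..<r}) \<Longrightarrow> coords (of_coords c) = c"
proof -
  assume c: "c \<in> span (unit_seq ` {..<r})"
  have "coords (of_coords c) = proj r unit_seq c" unfolding coords_def proj_def of_coords_def
    by (intro sum.cong) (auto simp: L2_orthonormal_sum[OF orth])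
  then show ?thesis using proj_span[OF orthonormal_unit_seq c] by simp
qed

lemma coords_cong: "f \<in> L2 M \<Longrightarrow> g \<in> L2 M \<Longrightarrow> AE x in M. f x = g x \<Longrightarrow> coords f = coords g"
  unfolding coords_def by (intro sum.cong arg_cong2[of _ _ _ _ scaleR] L2_inner_cong_AE) (auto simp: q_L2)

lemma coords_combination:
  assumes "finite I" "\<And>i. i \<in> I \<Longrightarrow> f i \<in> L2 M"
  shows "coords (\<lambda>x. \<Sum>i\<in>I. c i *\<^sub>R f i x) = (\<Sum>i\<in>I. c i *\<^sub>R coords (f i))"
proof -
  have "coords (\<lambda>x. \<Sum>i\<in>I. c i *\<^sub>R f i x) = (\<Sum>k<r. \<Sum>i\<in>I. (c i * L2_inner M (q k) (f i)) *\<^sub>R unit_seq k)"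
    unfolding coords_def using assms
    by (intro sum.cong refl) (simp add: L2_inner_sum_right[OF q_L2] scaleR_sum_left)
  also have "\<dots> = (\<Sum>i\<in>I. c i *\<^sub>R coords (f i))"
    unfolding coords_def by (subst sum.swap) (simp add: scaleR_sum_right)
  finally show ?thesis .
qed

lemma coords_diff: "f \<in> L2 M \<Longrightarrow> g \<in> L2 M \<Longrightarrow> coords (\<lambda>x. f x - g x) = coords f - coords g"
  unfolding coords_def sum_subtractf[symmetric] scaleR_diff_left[symmetric]
  by (intro sum.cong refl) (simp add: L2_inner_diff_right q_L2)

lemma of_coords_combination: "of_coords (\<Sum>i\<in>I. c i *\<^sub>R u i) = (\<lambda>x. \<Sum>i\<in>I. c i *\<^sub>R of_coords (u i) x)"
  unfolding of_coords_def by (rule ext) (simp add: inner_sum_left scaleR_sum_left scaleR_sum_right sum.swap[of _ I])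

lemma captured_of_coords: "captured (of_coords c)"
proof -
  have "coords (of_coords c) = proj r unit_seq c" unfolding coords_def proj_def of_coords_def
    by (intro sum.cong) (auto simp: L2_orthonormal_sum[OF orth])
  then have "of_coords (coords (of_coords c)) = of_coords c"
    unfolding of_coords_def by (intro ext sum.cong) (auto simp: inner_proj[OF orthonormal_unit_seq])
  then show ?thesis by (simp add: captured_def of_coords_L2)
qed

lemma captured_cong:
  assumes "captured f" "g \<in> L2 M" "AE x in M. g x = f x"
  shows "captured g"
proof -
  have "coords g = coords f" using assms by (intro coords_cong) (auto simp: captured_def)
  then show ?thesis using assms(2,3) capturedD(2)[OF assms(1)] unfolding captured_def by auto
qed

lemma captured_combination:
  assumes "finite I" "\<And>i. i \<in> I \<Longrightarrow> captured (f i)"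
  shows "captured (\<lambda>x. \<Sum>i\<in>I. c i *\<^sub>R f i x)"
proof (rule captured_cong[OF captured_of_coords])
  show "(\<lambda>x. \<Sum>i\<in>I. c i *\<^sub>R f i x) \<in> L2 M" using assms by (intro L2_combination) (auto simp: captured_def)
  show "AE x in M. (\<Sum>i\<in>I. c i *\<^sub>R f i x) = of_coords (\<Sum>i\<in>I. c i *\<^sub>R coords (f i)) x"
    unfolding of_coords_combination using assms by (intro AE_combination_cong) (auto simp: captured_def)
qed

lemma captured_diff: "captured f \<Longrightarrow> captured g \<Longrightarrow> captured (\<lambda>x. f x - g x)"
  using captured_combination[of "{..<2::nat}" "\<lambda>k. if k = 0 then f else g" "\<lambda>k. if k = 0 then 1 else -1"]
  by (simp add: numeral_2_eq_2)

text \<open>One captured argument suffices, since the part of \<open>g\<close> that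
  \<open>coords\<close> loses is orthogonal to \<open>h\<close>.\<close>

lemma inner_coords:
  assumes "captured h" "g \<in> L2 M"
  shows "L2_inner M h g = coords h \<bullet> coords g"
proof -
  have "L2_inner M h g = L2_inner M (of_coords (coords h)) g"
    using assms of_coords_L2 by (intro L2_inner_cong_AE) (auto simp: captured_def)
  also have "\<dots> = (\<Sum>k<r. L2_inner M (q k) h * L2_inner M (q k) g)"
    unfolding of_coords_coords using assms(2) q_L2 by (intro L2_inner_sum_left) auto
  also have "\<dots> = coords h \<bullet> coords g"
    unfolding coords_def[of g] inner_sum_right by (intro sum.cong) (auto simp: coords_unit)
  finally show ?thesis .
qed

lemma norm_coords: "captured h \<Longrightarrow> norm (coords h) = L2_norm M h"
  by (simp add: norm_eq_sqrt_inner L2_norm_def inner_coords[symmetric] captured_def)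

lemma captured_empirical:
  assumes "\<And>i. i < N \<Longrightarrow> captured (v i)"
  shows "captured (empirical_operator M N v f)"
proof -
  have "empirical_operator M N v f = (\<lambda>x. \<Sum>i<N. ((1 / real N) * L2_inner M (v i) f) *\<^sub>R v i x)"
    by (rule ext) (simp add: empirical_operator_def scaleR_sum_right)
  then show ?thesis using captured_combination[of "{..<N}" v] assms by simp
qed

lemma coords_empirical:
  assumes "\<And>i. i < N \<Longrightarrow> captured (v i)" "f \<in> L2 M"
  shows "coords (empirical_operator M N v f) = sample_operator N (\<lambda>i. coords (v i)) (coords f)"
proof -
  have eq: "empirical_operator M N v f = (\<lambda>x. \<Sum>i<N. ((1 / real N) * L2_inner M (v i) f) *\<^sub>R v i x)"
    by (rule ext) (simp add: empirical_operator_def scaleR_sum_right)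
  show ?thesis unfolding eq using assms capturedD(1)
    by (subst coords_combination) (auto simp: sample_operator_def scaleR_sum_right inner_coords[OF assms(1)])
qed

end

section \<open>Spectral decomposition of empirical operators\<close>

text \<open>The expansion holds for all of \<open>L2 M\<close>, so the operator annihilates the
  orthogonal complement of the \<open>e i\<close> and the \<open>\<mu> i\<close> exhaust the nonzero
  spectrum.\<close>

definition L2_spectral ::
  "'d::euclidean_space measure \<Rightarrow> nat \<Rightarrow> (nat \<Rightarrow> 'd \<Rightarrow> 'd) \<Rightarrow> (nat \<Rightarrow> real) \<Rightarrow> (('d \<Rightarrow> 'd) \<Rightarrow> 'd \<Rightarrow> 'd) \<Rightarrow> bool" where
  "L2_spectral M m e \<mu> F \<longleftrightarrow> L2_orthonormal M m e \<and> (\<forall>i<m. 0 < \<mu> i) \<and> (\<forall>i<m. \<forall>k<i. \<mu> i \<le> \<mu> k) \<and>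
     (\<forall>f\<in>L2 M. AE x in M. F f x = (\<Sum>i<m. (\<mu> i * L2_inner M (e i) f) *\<^sub>R e i x))"

text \<open>A frame capturing the samples turns the operator into \<open>sample_operator\<close> on
  \<open>fin_seq\<close>. The eigenvectors found there lie in the span of the first \<open>r\<close>
  unit sequences, where \<open>of_coords\<close> inverts \<open>coords\<close>, and so they carry
  back to functions.\<close>

theorem L2_spectral_exists:
  assumes v: "\<And>i. i < N \<Longrightarrow> v i \<in> L2 M"
  obtains m e \<mu> where "L2_spectral M m e \<mu> (empirical_operator M N v)"
proof -
  obtain r q where q: "L2_orthonormal M r q"
    and H: "\<forall>h\<in>v ` {..<N}. AE x in M. h x = (\<Sum>k<r. L2_inner M (q k) h *\<^sub>R q k x)"
    using gram_schmidt_L2[of "v ` {..<N}" M] v by auto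
  interpret L2_frame M r q by unfold_locales (rule q)
  have cap: "captured (v i)" if "i < N" for i
    using H v that by (auto simp: captured_def of_coords_coords)
  define S where "S = sample_operator N (\<lambda>i. coords (v i))"
  have rng: "S x \<in> span (unit_seq ` {..<r})" for x
    unfolding S_def sample_operator_def by (intro span_scale span_sum coords_in_span)
  obtain m e \<mu> where e: "spectral_form m e \<mu> S" "\<And>i. i < m \<Longrightarrow> e i \<in> span (unit_seq ` {..<r})"
    using spectral_theorem_finite_rank[where F = S and b = unit_seq and n = r, OF orthonormal_unit_seq _ _ _ rng]
    unfolding S_def by (metis linear_sample_operator sample_operator_symmetric sample_operator_nonneg)
  have ic: "L2_inner M (of_coords (e i)) f = e i \<bullet> coords f" if "i < m" "f \<in> L2 M" for i f
    using inner_coords[OF captured_of_coords that(2)] coords_of_coords[OF e(2)[OF that(1)]] by simp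
  have "L2_spectral M m (\<lambda>i. of_coords (e i)) \<mu> (empirical_operator M N v)" unfolding L2_spectral_def
  proof (intro conjI ballI)
    show "L2_orthonormal M m (\<lambda>i. of_coords (e i))"
      using e(1) by (auto simp: L2_orthonormal_def of_coords_L2 ic coords_of_coords e(2) spectral_form_def orthonormal_def)
    show "\<forall>i<m. 0 < \<mu> i" "\<forall>i<m. \<forall>k<i. \<mu> i \<le> \<mu> k" using e(1) by (auto simp: spectral_form_def)
    fix f assume f: "f \<in> L2 M"
    have "coords (empirical_operator M N v f) = (\<Sum>i<m. (\<mu> i * (e i \<bullet> coords f)) *\<^sub>R e i)"
      using coords_empirical[OF cap f] e(1) unfolding S_def spectral_form_def by auto
    also have "\<dots> = (\<Sum>i<m. (\<mu> i * L2_inner M (of_coords (e i)) f) *\<^sub>R e i)"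
      using ic f by (intro sum.cong) auto
    finally have eq: "coords (empirical_operator M N v f) = (\<Sum>i<m. (\<mu> i * L2_inner M (of_coords (e i)) f) *\<^sub>R e i)" .
    show "AE x in M. empirical_operator M N v f x = (\<Sum>i<m. (\<mu> i * L2_inner M (of_coords (e i)) f) *\<^sub>R of_coords (e i) x)"
      using capturedD(2)[OF captured_empirical[where N = N and v = v and f = f, OF cap]] unfolding eq of_coords_combination by auto
  qed
  then show ?thesis by (rule that)
qed

text \<open>Comparing coefficients along \<open>e i\<close> on both sides of the eigenvalue
  equation. Hence an eigenfunction for \<open>a\<close> has no component along \<open>e i\<close>
  unless \<open>\<mu> i = a\<close>.\<close>

lemma L2_spectral_eigenspace_coeff:
  assumes s: "L2_spectral M m e \<mu> F" and f: "f \<in> L2 M" and F: "AE x in M. F f x = a *\<^sub>R f x" and i: "i < m"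
  shows "a * L2_inner M (e i) f = \<mu> i * L2_inner M (e i) f"
proof -
  have "AE x in M. F f x = (\<Sum>i<m. (\<mu> i * L2_inner M (e i) f) *\<^sub>R e i x)" using s f by (simp add: L2_spectral_def)
  with F have "AE x in M. a *\<^sub>R f x = (\<Sum>i<m. (\<mu> i * L2_inner M (e i) f) *\<^sub>R e i x)"
    by eventually_elim simp
  from L2_orthonormal_coeff[OF _ i L2_scale[OF f] this] s
  show ?thesis by (simp add: L2_spectral_def L2_inner_scale)
qed

lemma L2_spectral_eigen:
  assumes s: "L2_spectral M m e \<mu> F" and i: "i < m"
  shows "e i \<in> eigenspace M F (\<mu> i)"
proof -
  have eL: "e i \<in> L2 M" using s i by (simp add: L2_spectral_def L2_orthonormal_def)
  have "(\<Sum>k<m. (\<mu> k * L2_inner M (e k) (e i)) *\<^sub>R e k x) = \<mu> i *\<^sub>R e i x" for x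
  proof -
    have "(\<Sum>k<m. (\<mu> k * L2_inner M (e k) (e i)) *\<^sub>R e k x) = (\<Sum>k<m. if k = i then \<mu> k *\<^sub>R e k x else 0)"
      using s i by (intro sum.cong) (auto simp: L2_spectral_def L2_orthonormal_def)
    then show ?thesis using i by simp
  qed
  then show ?thesis using s eL unfolding eigenspace_def L2_spectral_def by fastforce
qed

lemma L2_has_dim_orthonormal:
  assumes "L2_orthonormal M n b" "\<And>i. i < n \<Longrightarrow> b i \<in> X"
    "\<And>f. f \<in> X \<Longrightarrow> f \<in> L2 M \<and> (\<exists>c. AE x in M. f x = (\<Sum>i<n. c i *\<^sub>R b i x))"
  shows "L2_has_dim M X n"
  unfolding L2_has_dim_def using assms L2_orthonormal_independent[OF assms(1)]
  by (intro exI[of _ b]) (auto simp: L2_span_def)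

text \<open>The eigenspace of a nonzero \<open>a\<close> has as orthonormal basis the
  \<open>e i\<close> with \<open>\<mu> i = a\<close>; nothing outside the \<open>e i\<close> enters,
  because an eigenfunction is \<open>1 / a\<close> times its own image.\<close>

theorem nonzero_eigenvalues_spectral:
  assumes s: "L2_spectral M m e \<mu> F"
  shows "nonzero_eigenvalues M F (map \<mu> [0..<m])"
  unfolding nonzero_eigenvalues_def
proof (intro conjI allI impI)
  show "sorted_wrt (\<ge>) (map \<mu> [0..<m])" using s by (auto simp: sorted_wrt_iff_nth_less L2_spectral_def)
  show "0 \<notin> set (map \<mu> [0..<m])" using s by (fastforce simp: L2_spectral_def)
  fix a :: real assume a: "a \<noteq> 0"
  define A where "A = {i. i < m \<and> \<mu> i = a}"
  have A: "finite A" by (simp add: A_def)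
  have cnt: "count_list (map \<mu> [0..<m]) a = card A"
    unfolding A_def
  proof (induction m)
    case (Suc m)
    have "{i. i < Suc m \<and> \<mu> i = a} = (if \<mu> m = a then insert m {i. i < m \<and> \<mu> i = a} else {i. i < m \<and> \<mu> i = a})"
      by (auto simp: less_Suc_eq)
    then show ?case using Suc by simp
  qed simp
  \<comment> \<open>Bases in \<open>L2_has_dim\<close> are indexed by an initial segment of the
    naturals, so the index set \<open>A\<close> has to be enumerated.\<close>
  obtain idx where idx: "bij_betw idx {0..<card A} A" using ex_bij_betw_nat_finite[OF A] by blast
  have idxA: "idx k \<in> A" if "k < card A" for k using idx that by (auto simp: bij_betw_def)
  have idxeq: "idx i = idx j \<longleftrightarrow> i = j" if "i < card A" "j < card A" for i j
    using idx that by (auto simp: bij_betw_def inj_on_def)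
  have "L2_has_dim M (eigenspace M F a) (card A)"
  proof (rule L2_has_dim_orthonormal[of _ _ "\<lambda>k. e (idx k)"])
    show "L2_orthonormal M (card A) (\<lambda>k. e (idx k))"
      using s idxA idxeq by (auto simp: L2_orthonormal_def L2_spectral_def A_def)
    show "e (idx k) \<in> eigenspace M F a" if "k < card A" for k
      using L2_spectral_eigen[OF s, of "idx k"] idxA[OF that] by (auto simp: A_def)
    fix f assume "f \<in> eigenspace M F a"
    then have f: "f \<in> L2 M" "AE x in M. F f x = a *\<^sub>R f x" by (auto simp: eigenspace_def)
    have c0: "\<mu> i * L2_inner M (e i) f = 0" if "i < m" "i \<notin> A" for i
      using L2_spectral_eigenspace_coeff[OF s f that(1)] that by (auto simp: A_def)
    have "AE x in M. F f x = (\<Sum>i<m. (\<mu> i * L2_inner M (e i) f) *\<^sub>R e i x)" using s f by (simp add: L2_spectral_def)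
    with f(2) have "AE x in M. f x = (\<Sum>k<card A. L2_inner M (e (idx k)) f *\<^sub>R e (idx k) x)"
    proof eventually_elim
      case (elim x)
      have "(\<Sum>i<m. (\<mu> i * L2_inner M (e i) f) *\<^sub>R e i x) = (\<Sum>i\<in>A. (\<mu> i * L2_inner M (e i) f) *\<^sub>R e i x)"
        using c0 by (intro sum.mono_neutral_right) (auto simp: A_def)
      also have "\<dots> = a *\<^sub>R (\<Sum>i\<in>A. L2_inner M (e i) f *\<^sub>R e i x)"
        unfolding scaleR_sum_right by (intro sum.cong) (auto simp: A_def)
      also have "(\<Sum>i\<in>A. L2_inner M (e i) f *\<^sub>R e i x) = (\<Sum>k<card A. L2_inner M (e (idx k)) f *\<^sub>R e (idx k) x)"
        using sum.reindex_bij_betw[OF idx, of "\<lambda>i. L2_inner M (e i) f *\<^sub>R e i x"] by (simp add: atLeast0LessThan)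
      finally show ?case using elim a by simp
    qed
    with f(1) show "f \<in> L2 M \<and> (\<exists>c. AE x in M. f x = (\<Sum>k<card A. c k *\<^sub>R e (idx k) x))"
      by (intro conjI exI[of _ "\<lambda>k. L2_inner M (e (idx k)) f"])
  qed
  then show "L2_has_dim M (eigenspace M F a) (count_list (map \<mu> [0..<m]) a)" unfolding cnt .
qed

text \<open>An eigenvector for a positive eigenvalue is a multiple of its image, and every image is
  a combination of the samples.\<close>

lemma L2_spectral_in_span:
  assumes s: "L2_spectral M m e \<mu> (empirical_operator M N v)" and i: "i < m"
  shows "AE x in M. e i x = (\<Sum>j<N. (L2_inner M (v j) (e i) / (real N * \<mu> i)) *\<^sub>R v j x)"
proof -
  have \<mu>: "0 < \<mu> i" using s i by (simp add: L2_spectral_def)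
  have "AE x in M. empirical_operator M N v (e i) x = \<mu> i *\<^sub>R e i x"
    using L2_spectral_eigen[OF s i] by (simp add: eigenspace_def)
  then show ?thesis
  proof eventually_elim
    case (elim x)
    then have "e i x = (1 / \<mu> i) *\<^sub>R empirical_operator M N v (e i) x" using \<mu> by simp
    then show ?case by (simp add: empirical_operator_def scaleR_sum_right mult.commute)
  qed
qed

text \<open>The residue \<open>w\<close> of \<open>v j\<close> is orthogonal to all
  \<open>e i\<close>, so the operator sends it to zero. Pairing with \<open>w\<close> then gives
  zero for the mean of the squared inner products of \<open>w\<close> with the samples. So
  \<open>w\<close> is orthogonal to \<open>v j\<close> as well as to its projection, hence to
  itself.\<close>

lemma L2_spectral_expand:
  assumes s: "L2_spectral M m e \<mu> (empirical_operator M N v)" and v: "\<And>i. i < N \<Longrightarrow> v i \<in> L2 M" and j: "j < N"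
  shows "AE x in M. v j x = (\<Sum>i<m. L2_inner M (e i) (v j) *\<^sub>R e i x)"
proof -
  have eL: "e i \<in> L2 M" if "i < m" for i using s that by (simp add: L2_spectral_def L2_orthonormal_def)
  have oe: "L2_orthonormal M m e" using s by (simp add: L2_spectral_def)
  define p where "p = (\<lambda>x. \<Sum>i<m. L2_inner M (e i) (v j) *\<^sub>R e i x)"
  define w where "w = (\<lambda>x. v j x - p x)"
  have pL: "p \<in> L2 M" unfolding p_def using eL by (intro L2_combination) auto
  have wL: "w \<in> L2 M" unfolding w_def by (rule L2_diff[OF v[OF j] pL])
  have ew: "L2_inner M (e i) w = 0" if "i < m" for i
  proof -
    have "L2_inner M (e i) p = L2_inner M (e i) (v j)" unfolding p_def by (rule L2_orthonormal_sum[OF oe that])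
    then show ?thesis unfolding w_def using L2_inner_diff_right[OF eL[OF that] v[OF j] pL] by simp
  qed
  have wp: "L2_inner M w p = 0" unfolding p_def
    using L2_inner_sum_right[OF wL, of "{..<m}" e] eL ew by (simp add: L2_inner_commute[of M w])
  have "AE x in M. empirical_operator M N v w x = 0"
    using s wL ew unfolding L2_spectral_def by auto
  then have "L2_inner M w (empirical_operator M N v w) = L2_inner M w (\<lambda>x. 0)"
    using wL empirical_operator_L2[of N v M w] v L2_zero by (intro L2_inner_cong_AE) auto
  moreover have "L2_inner M w (empirical_operator M N v w) = (1 / real N) * (\<Sum>i<N. (L2_inner M (v i) w)\<^sup>2)"
  proof -
    have eq: "empirical_operator M N v w = (\<lambda>x. (1 / real N) *\<^sub>R (\<Sum>i<N. L2_inner M (v i) w *\<^sub>R v i x))"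
      by (rule ext) (simp add: empirical_operator_def)
    show ?thesis unfolding eq L2_inner_scale using v
      by (subst L2_inner_sum_right[OF wL]) (auto simp: power2_eq_square L2_inner_commute[of M w])
  qed
  ultimately have "(\<Sum>i<N. (L2_inner M (v i) w)\<^sup>2) = 0" using j by (auto simp: L2_inner_def)
  then have "L2_inner M (v j) w = 0" using j by (simp add: sum_nonneg_eq_0_iff)
  then have "L2_inner M w w = 0" using L2_inner_diff_right[OF wL v[OF j] pL] wp
    by (simp add: w_def[symmetric] L2_inner_commute[of M "v j"])
  then have "AE x in M. w x = 0" using L2_inner_self_eq_0[OF wL] by simp
  then show ?thesis by eventually_elim (simp add: w_def p_def)
qed

lemma L2_has_dim_span_spectral:
  assumes s: "L2_spectral M m e \<mu> (empirical_operator M N v)" and v: "\<And>i. i < N \<Longrightarrow> v i \<in> L2 M"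
  shows "L2_has_dim M (L2_span M N v) m"
proof (rule L2_has_dim_orthonormal)
  show oe: "L2_orthonormal M m e" using s by (simp add: L2_spectral_def)
  show "e i \<in> L2_span M N v" if "i < m" for i
    unfolding L2_span_def using L2_spectral_in_span[OF s that] oe that
    by (auto simp: L2_orthonormal_def intro!: exI[of _ "\<lambda>j. L2_inner M (v j) (e i) / (real N * \<mu> i)"])
  fix f assume "f \<in> L2_span M N v"
  then obtain c where c: "f \<in> L2 M" "AE x in M. f x = (\<Sum>j<N. c j *\<^sub>R v j x)" by (auto simp: L2_span_def)
  have "AE x in M. (\<Sum>j<N. c j *\<^sub>R v j x) = (\<Sum>j<N. c j *\<^sub>R (\<Sum>i<m. L2_inner M (e i) (v j) *\<^sub>R e i x))"
    using L2_spectral_expand[OF s v] by (intro AE_combination_cong) auto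
  with c(2) have "AE x in M. f x = (\<Sum>i<m. (\<Sum>j<N. c j * L2_inner M (e i) (v j)) *\<^sub>R e i x)"
    by eventually_elim (simp add: scaleR_sum_right scaleR_sum_left sum.swap[of _ "{..<N}"])
  with c(1) show "f \<in> L2 M \<and> (\<exists>c. AE x in M. f x = (\<Sum>i<m. c i *\<^sub>R e i x))"
    by (intro conjI exI[of _ "\<lambda>i. \<Sum>j<N. c j * L2_inner M (e i) (v j)"])
qed

text \<open>Serves two bounds: with the fields of a basis of the tangent space it gives
  \<open>m \<le> DIM('e)\<close>, with the samples themselves it gives
  \<open>m \<le> N\<close>.\<close>

lemma L2_spectral_rank_le:
  assumes s: "L2_spectral M m e \<mu> (empirical_operator M N v)" and P: "finite P"
    and g: "\<And>j x. j < N \<Longrightarrow> v j x = (\<Sum>b\<in>P. a j b *\<^sub>R g b x)"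
  shows "m \<le> card P"
proof (rule L2_independent_le[OF L2_orthonormal_independent P])
  show "L2_orthonormal M m e" using s by (simp add: L2_spectral_def)
  fix i assume i: "i < m"
  show "AE x in M. e i x = (\<Sum>b\<in>P. (\<Sum>j<N. L2_inner M (v j) (e i) / (real N * \<mu> i) * a j b) *\<^sub>R g b x)"
    using L2_spectral_in_span[OF s i]
    by eventually_elim (simp add: g scaleR_sum_right scaleR_sum_left sum.swap[of _ "{..<N}"])
qed

lemma L2_spectral_length_le:
  assumes s: "L2_spectral M m e \<mu> (empirical_operator M N v)"
  shows "m \<le> N"
proof -
  have "m \<le> card {..<N}"
    by (rule L2_spectral_rank_le[OF s, of _ "\<lambda>j b. if b = j then 1 else 0" v])
      (simp_all add: if_distrib[of "\<lambda>c. c *\<^sub>R _"] cong: if_cong)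
  then show ?thesis by simp
qed


lemma (in L2_frame) spectral_form_coords:
  assumes v: "\<And>i. i < N \<Longrightarrow> captured (v i)" and s: "L2_spectral M m e \<mu> (empirical_operator M N v)"
    and e: "\<And>i. i < m \<Longrightarrow> captured (e i)"
  shows "spectral_form m (\<lambda>i. coords (e i)) \<mu> (sample_operator N (\<lambda>i. coords (v i)))"
  unfolding spectral_form_def
proof (intro conjI)
  show "orthonormal m (\<lambda>i. coords (e i))"
    using s e by (simp add: orthonormal_def L2_spectral_def L2_orthonormal_def inner_coords[symmetric])
  show "\<forall>i<m. 0 < \<mu> i" "\<forall>i<m. \<forall>k<i. \<mu> i \<le> \<mu> k" using s by (auto simp: L2_spectral_def)
  show "\<forall>x. sample_operator N (\<lambda>i. coords (v i)) x = (\<Sum>i<m. (\<mu> i * (coords (e i) \<bullet> x)) *\<^sub>R coords (e i))"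
  proof
    fix x
    \<comment> \<open>\<open>x\<close> is an arbitrary finite sequence, while the frame sees only
      its first \<open>r\<close> entries. Cutting off the rest changes no inner product with a
      coordinate vector and makes \<open>x\<close> the coordinates of a function.\<close>
    define y where "y = proj r unit_seq x"
    have y: "y \<in> span (unit_seq ` {..<r})" unfolding y_def by (rule proj_in_span)
    have in_eq: "u \<bullet> x = u \<bullet> coords (of_coords y)" if "u \<in> span (unit_seq ` {..<r})" for u
      using proj_orthogonal[OF orthonormal_unit_seq that, of x] coords_of_coords[OF y]
      by (simp add: y_def inner_diff_left inner_commute[of u])
    have "sample_operator N (\<lambda>i. coords (v i)) x = sample_operator N (\<lambda>i. coords (v i)) (coords (of_coords y))"
      unfolding sample_operator_def by (simp add: in_eq[OF coords_in_span])
    also have "\<dots> = coords (empirical_operator M N v (of_coords y))" using coords_empirical[OF v of_coords_L2] by simp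
    also have "\<dots> = coords (\<lambda>x. \<Sum>i<m. (\<mu> i * L2_inner M (e i) (of_coords y)) *\<^sub>R e i x)"
      using s e captured_empirical[where N = N and v = v, OF v]
      by (intro coords_cong L2_combination) (auto simp: L2_spectral_def of_coords_L2 captured_def)
    also have "\<dots> = (\<Sum>i<m. (\<mu> i * L2_inner M (e i) (of_coords y)) *\<^sub>R coords (e i))"
      using e by (intro coords_combination) (auto simp: captured_def)
    also have "\<dots> = (\<Sum>i<m. (\<mu> i * (coords (e i) \<bullet> x)) *\<^sub>R coords (e i))"
      using e in_eq[OF coords_in_span] by (intro sum.cong) (auto simp: inner_coords of_coords_L2)
    finally show "sample_operator N (\<lambda>i. coords (v i)) x = (\<Sum>i<m. (\<mu> i * (coords (e i) \<bullet> x)) *\<^sub>R coords (e i))" .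
  qed
qed

section \<open>Principal angles in coordinates\<close>

context L2_frame
begin

abbreviation coord_span :: "nat \<Rightarrow> (nat \<Rightarrow> 'd \<Rightarrow> 'd) \<Rightarrow> fin_seq set" where
  "coord_span m f \<equiv> span ((\<lambda>i. coords (f i)) ` {..<m})"

lemma span_coords:
  assumes f: "\<And>i. i < m \<Longrightarrow> captured (f i)" and h: "h \<in> L2_span M m f"
  shows "captured h" "coords h \<in> coord_span m f"
proof -
  obtain c where c: "h \<in> L2 M" "AE x in M. h x = (\<Sum>i<m. c i *\<^sub>R f i x)" using h by (auto simp: L2_span_def)
  have cap: "captured (\<lambda>x. \<Sum>i<m. c i *\<^sub>R f i x)" using f by (intro captured_combination) auto
  show "captured h" by (rule captured_cong[OF cap c])
  have "coords h = coords (\<lambda>x. \<Sum>i<m. c i *\<^sub>R f i x)"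
    using c cap by (intro coords_cong) (auto simp: captured_def)
  also have "\<dots> = (\<Sum>i<m. c i *\<^sub>R coords (f i))" using f by (intro coords_combination) (auto simp: captured_def)
  also have "\<dots> \<in> coord_span m f" by (intro span_sum span_scale span_base) auto
  finally show "coords h \<in> coord_span m f" .
qed

lemma span_coords_units: "span ((\<lambda>i. coords (f i)) ` I) \<subseteq> span (unit_seq ` {..<r})"
  by (rule span_minimal) (auto simp: coords_in_span)

lemma of_coords_in_span:
  assumes f: "\<And>i. i < m \<Longrightarrow> captured (f i)" and o: "orthonormal m (\<lambda>i. coords (f i))"
    and y: "y \<in> coord_span m f"
  shows "of_coords y \<in> L2_span M m f"
proof -
  have "of_coords y = of_coords (\<Sum>i<m. (y \<bullet> coords (f i)) *\<^sub>R coords (f i))"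
    using proj_span[OF o y] by (simp add: proj_def)
  also have "\<dots> = (\<lambda>x. \<Sum>i<m. (y \<bullet> coords (f i)) *\<^sub>R of_coords (coords (f i)) x)" by (rule of_coords_combination)
  finally have eq: "of_coords y = (\<lambda>x. \<Sum>i<m. (y \<bullet> coords (f i)) *\<^sub>R of_coords (coords (f i)) x)" .
  have "AE x in M. (\<Sum>i<m. (y \<bullet> coords (f i)) *\<^sub>R f i x) = (\<Sum>i<m. (y \<bullet> coords (f i)) *\<^sub>R of_coords (coords (f i)) x)"
    using f by (intro AE_combination_cong) (auto simp: captured_def)
  then have "AE x in M. of_coords y x = (\<Sum>i<m. (y \<bullet> coords (f i)) *\<^sub>R f i x)"
    unfolding eq by eventually_elim simp
  then show ?thesis unfolding L2_span_def by (auto simp: of_coords_L2)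
qed

lemma unit_orth_coords:
  assumes f: "\<And>i. i < m \<Longrightarrow> captured (f i)" and x: "\<And>i. i < j \<Longrightarrow> x i \<in> L2 M"
    and u: "u \<in> unit_orth M (L2_span M m f) x j"
  shows "coords u \<in> unit_complement (coord_span m f) (\<lambda>i. coords (x i)) j"
proof -
  have "u \<in> L2_span M m f" using u by (simp add: unit_orth_def)
  note uc = span_coords[where f = f, OF f this]
  show ?thesis using u uc x by (simp add: unit_orth_def unit_complement_def norm_coords inner_coords[symmetric])
qed

lemma unit_complement_of_coords:
  assumes f: "\<And>i. i < m \<Longrightarrow> captured (f i)" and o: "orthonormal m (\<lambda>i. coords (f i))"
    and x: "\<And>i. i < j \<Longrightarrow> x i \<in> L2 M"
    and y: "y \<in> unit_complement (coord_span m f) (\<lambda>i. coords (x i)) j"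
  shows "of_coords y \<in> unit_orth M (L2_span M m f) x j" "coords (of_coords y) = y"
proof -
  have ys: "y \<in> coord_span m f" using y by (simp add: unit_complement_def)
  show cf: "coords (of_coords y) = y" using ys span_coords_units by (intro coords_of_coords) blast
  show "of_coords y \<in> unit_orth M (L2_span M m f) x j"
    using of_coords_in_span[where f = f, OF f o ys] y x norm_coords[OF captured_of_coords, of y]
    by (simp add: unit_orth_def unit_complement_def inner_coords[OF captured_of_coords] cf)
qed

lemma principal_vectors_coords:
  assumes f: "\<And>i. i < m \<Longrightarrow> captured (f i)" and of: "orthonormal m (\<lambda>i. coords (f i))"
    and e: "\<And>i. i < m \<Longrightarrow> captured (e i)" and oe: "orthonormal m (\<lambda>i. coords (e i))"
    and pv: "principal_vectors M m (L2_span M m f) (L2_span M m e) (x, y)"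
  shows "principal_pair m (coord_span m f) (coord_span m e)
      (\<lambda>i. coords (x i)) (\<lambda>i. coords (y i))"
    and "j < m \<Longrightarrow> L2_inner M (x j) (y j) = coords (x j) \<bullet> coords (y j)"
proof -
  have xs: "x j \<in> L2_span M m f" "y j \<in> L2_span M m e" if "j < m" for j
    using pv that by (auto simp: principal_vectors_def unit_orth_def)
  then have xc: "captured (x j)" "captured (y j)" if "j < m" for j
    using that span_coords(1)[where f = f, OF f] span_coords(1)[where f = e, OF e] by auto
  show ic: "L2_inner M (x j) (y j) = coords (x j) \<bullet> coords (y j)" if "j < m" for j
    using xc[OF that] by (simp add: inner_coords captured_def)
  show "principal_pair m (coord_span m f) (coord_span m e)
      (\<lambda>i. coords (x i)) (\<lambda>i. coords (y i))"
    unfolding principal_pair_def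
  proof (intro allI impI conjI ballI)
    fix j assume j: "j < m"
    have xL: "x i \<in> L2 M" "y i \<in> L2 M" if "i < j" for i using xc[of i] that j by (auto simp: captured_def)
    show "coords (x j) \<in> unit_complement (coord_span m f) (\<lambda>i. coords (x i)) j"
      using pv j xL by (intro unit_orth_coords f) (auto simp: principal_vectors_def)
    show "coords (y j) \<in> unit_complement (coord_span m e) (\<lambda>i. coords (y i)) j"
      using pv j xL by (intro unit_orth_coords e) (auto simp: principal_vectors_def)
    fix u w assume u: "u \<in> unit_complement (coord_span m f) (\<lambda>i. coords (x i)) j"
      and w: "w \<in> unit_complement (coord_span m e) (\<lambda>i. coords (y i)) j"
    \<comment> \<open>Every competitor in the coordinate space comes from an admissible function, so
      the maximality of \<open>x j\<close> and \<open>y j\<close> among functions transfers.\<close>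
    note u' = unit_complement_of_coords[where f = f, OF f of xL(1) u]
    note w' = unit_complement_of_coords[where f = e, OF e oe xL(2) w]
    have "\<bar>L2_inner M (of_coords u) (of_coords w)\<bar> \<le> \<bar>L2_inner M (x j) (y j)\<bar>"
      using pv j u'(1) w'(1) by (auto simp: principal_vectors_def)
    then show "\<bar>u \<bullet> w\<bar> \<le> \<bar>coords (x j) \<bullet> coords (y j)\<bar>"
      by (simp add: ic[OF j] inner_coords[OF captured_of_coords of_coords_L2] u'(2) w'(2))
  qed
qed

text \<open>\<open>subspace_dist\<close> selects principal vectors with \<open>SOME\<close>, so
  their existence is what gives its value a meaning.\<close>

lemma principal_vectors_exist:
  assumes f: "\<And>i. i < m \<Longrightarrow> captured (f i)" and of: "orthonormal m (\<lambda>i. coords (f i))"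
    and e: "\<And>i. i < m \<Longrightarrow> captured (e i)" and oe: "orthonormal m (\<lambda>i. coords (e i))"
  shows "\<exists>xy. principal_vectors M m (L2_span M m f) (L2_span M m e) xy"
proof -
  let ?X = "coord_span m f" and ?Y = "coord_span m e"
  obtain x y where xy: "principal_pair m ?X ?Y x y" using principal_pair_exists[OF of oe] by auto
  have c: "coords (of_coords (x i)) = x i" "coords (of_coords (y i)) = y i" if "i < m" for i
  proof -
    have "x i \<in> ?X" "y i \<in> ?Y" using xy that by (auto simp: principal_pair_def unit_complement_def)
    then show "coords (of_coords (x i)) = x i" "coords (of_coords (y i)) = y i"
      using span_coords_units by (auto intro!: coords_of_coords)
  qed
  have cx: "unit_complement ?X (\<lambda>i. coords (of_coords (x i))) j = unit_complement ?X x j"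
    "unit_complement ?Y (\<lambda>i. coords (of_coords (y i))) j = unit_complement ?Y y j" if "j < m" for j
    using that c by (auto intro!: unit_complement_cong)
  have "principal_vectors M m (L2_span M m f) (L2_span M m e) (\<lambda>i. of_coords (x i), \<lambda>i. of_coords (y i))"
    unfolding principal_vectors_def prod.case
  proof (intro allI impI conjI ballI)
    fix j assume j: "j < m"
    show "of_coords (x j) \<in> unit_orth M (L2_span M m f) (\<lambda>i. of_coords (x i)) j"
      using xy j cx[OF j] by (intro unit_complement_of_coords[where f = f, OF f of of_coords_L2]) (auto simp: principal_pair_def)
    show "of_coords (y j) \<in> unit_orth M (L2_span M m e) (\<lambda>i. of_coords (y i)) j"
      using xy j cx[OF j] by (intro unit_complement_of_coords[where f = e, OF e oe of_coords_L2]) (auto simp: principal_pair_def)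
    fix u w assume u: "u \<in> unit_orth M (L2_span M m f) (\<lambda>i. of_coords (x i)) j"
      and w: "w \<in> unit_orth M (L2_span M m e) (\<lambda>i. of_coords (y i)) j"
    have uw: "u \<in> L2_span M m f" "w \<in> L2_span M m e" using u w by (auto simp: unit_orth_def)
    have "coords u \<in> unit_complement ?X x j" "coords w \<in> unit_complement ?Y y j"
      using unit_orth_coords[where f = f, OF f of_coords_L2 u] unit_orth_coords[where f = e, OF e of_coords_L2 w] cx[OF j] by auto
    then have "\<bar>coords u \<bullet> coords w\<bar> \<le> \<bar>x j \<bullet> y j\<bar>" using xy j by (auto simp: principal_pair_def)
    moreover have "L2_inner M u w = coords u \<bullet> coords w"
      using span_coords(1)[where f = f, OF f uw(1)] uw(2) by (intro inner_coords) (auto simp: L2_span_def)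
    ultimately show "\<bar>L2_inner M u w\<bar> \<le> \<bar>L2_inner M (of_coords (x j)) (of_coords (y j))\<bar>"
      using c[OF j] inner_coords[OF captured_of_coords of_coords_L2] by simp
  qed
  then show ?thesis by blast
qed

end

text \<open>\<open>e\<close> and \<open>f\<close> only certify the full nonzero spectra; the
  eigenvectors \<open>e'\<close> and \<open>f'\<close> of the angle estimate are arbitrary and
  unrelated to them, apart from belonging to the same eigenvalue lists.\<close>

theorem empirical_operator_perturbation:
  fixes v w :: "nat \<Rightarrow> 'd::euclidean_space \<Rightarrow> 'd"
  assumes N: "1 \<le> N" and v: "\<And>i. i < N \<Longrightarrow> v i \<in> L2 M" and w: "\<And>i. i < N \<Longrightarrow> w i \<in> L2 M"
    and a: "\<And>i. i < N \<Longrightarrow> L2_norm M (v i) \<le> a" and b: "\<And>i. i < N \<Longrightarrow> L2_norm M (\<lambda>x. w i x - v i x) \<le> b"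
    and sv: "L2_spectral M m e \<mu> (empirical_operator M N v)"
    and sw: "L2_spectral M n f \<nu> (empirical_operator M N w)"
  defines "\<delta> \<equiv> (2 * a + b) * b"
  shows "\<bar>(if i < m then \<mu> i else 0) - (if i < n then \<nu> i else 0)\<bar> \<le> \<delta>"
    and "1 \<le> m \<Longrightarrow> top_eigenvectors M (empirical_operator M N v) (map \<mu> [0..<m]) m e' \<Longrightarrow>
      top_eigenvectors M (empirical_operator M N w) (map \<nu> [0..<n]) m f' \<Longrightarrow>
      subspace_dist M m (L2_span M m f') (L2_span M m e') \<le> 2 ^ m * (2 * \<delta> / \<mu> (m - 1))"
proof -
  have eL: "e i \<in> L2 M" if "i < m" for i using sv that by (simp add: L2_spectral_def L2_orthonormal_def)
  have fL: "f i \<in> L2 M" if "i < n" for i using sw that by (simp add: L2_spectral_def L2_orthonormal_def)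
  have ab: "0 \<le> a" "0 \<le> b"
    using a[of 0] b[of 0] N L2_inner_self_nonneg unfolding L2_norm_def
    by (meson less_le_trans order_trans real_sqrt_ge_zero zero_less_one)+
  then have d0: "0 \<le> \<delta>" by (simp add: \<delta>_def)
  \<comment> \<open>The extra set \<open>H\<close> makes room for \<open>e'\<close> and
    \<open>f'\<close>, which are given only in the second claim; the eigenvalue bound takes it
    empty.\<close>
  have frame: "\<exists>r q. L2_orthonormal M r q \<and>
      (\<forall>h\<in>v ` {..<N} \<union> w ` {..<N} \<union> e ` {..<m} \<union> f ` {..<n} \<union> H.
        AE x in M. h x = (\<Sum>k<r. L2_inner M (q k) h *\<^sub>R q k x))" if "finite H" "H \<subseteq> L2 M" for H
    using that v w eL fL by (intro gram_schmidt_L2) auto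
  have weyl: "\<bar>(if i < m then \<mu> i else 0) - (if i < n then \<nu> i else 0)\<bar> \<le> \<delta>" for i
  proof -
    obtain r q where q: "L2_orthonormal M r q"
      and H: "\<forall>h\<in>v ` {..<N} \<union> w ` {..<N} \<union> e ` {..<m} \<union> f ` {..<n} \<union> {}.
        AE x in M. h x = (\<Sum>k<r. L2_inner M (q k) h *\<^sub>R q k x)" using frame[of "{}"] by auto
    interpret L2_frame M r q by unfold_locales (rule q)
    have cap: "\<And>i. i < N \<Longrightarrow> captured (v i)" "\<And>i. i < N \<Longrightarrow> captured (w i)"
      "\<And>i. i < m \<Longrightarrow> captured (e i)" "\<And>i. i < n \<Longrightarrow> captured (f i)"
      using H v w eL fL by (auto simp: captured_def of_coords_coords)
    have cb: "norm (coords (w i) - coords (v i)) \<le> b" if "i < N" for i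
      using norm_coords[OF captured_diff[OF cap(2)[OF that] cap(1)[OF that]]] b[OF that] coords_diff[OF w[OF that] v[OF that]] by simp
    show ?thesis
    proof (rule weyl_inequality[OF spectral_form_coords[where v = v, OF cap(1) sv cap(3)] spectral_form_coords[where v = w, OF cap(2) sw cap(4)] _ d0])
      show "norm (sample_operator N (\<lambda>i. coords (v i)) x - sample_operator N (\<lambda>i. coords (w i)) x) \<le> \<delta> * norm x" for x
        unfolding \<delta>_def using a cb cap(1) by (intro norm_sample_operator_diff N) (auto simp: norm_coords)
    qed
  qed
  then show "\<bar>(if i < m then \<mu> i else 0) - (if i < n then \<nu> i else 0)\<bar> \<le> \<delta>" .
  assume m: "1 \<le> m" and te: "top_eigenvectors M (empirical_operator M N v) (map \<mu> [0..<m]) m e'"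
    and tf: "top_eigenvectors M (empirical_operator M N w) (map \<nu> [0..<n]) m f'"
  \<comment> \<open>If \<open>n < m\<close>, the top \<open>m\<close> eigenvectors of the second
    operator include elements of its kernel, which belong to the padding zeros.\<close>
  define \<nu>' where "\<nu>' i = (if i < n then \<nu> i else 0)" for i
  have e': "e' i \<in> L2 M" "AE x in M. empirical_operator M N v (e' i) x = \<mu> i *\<^sub>R e' i x" if "i < m" for i
    using te that by (auto simp: top_eigenvectors_def eigenspace_def nth_default_def)
  have f': "f' i \<in> L2 M" "AE x in M. empirical_operator M N w (f' i) x = \<nu>' i *\<^sub>R f' i x" if "i < m" for i
    using tf that by (auto simp: top_eigenvectors_def eigenspace_def nth_default_def \<nu>'_def)
  have "finite (e' ` {..<m} \<union> f' ` {..<m})" "e' ` {..<m} \<union> f' ` {..<m} \<subseteq> L2 M" using e' f' by auto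
  from frame[OF this] obtain r q where q: "L2_orthonormal M r q"
    and H: "\<forall>h\<in>v ` {..<N} \<union> w ` {..<N} \<union> e ` {..<m} \<union> f ` {..<n} \<union> (e' ` {..<m} \<union> f' ` {..<m}).
      AE x in M. h x = (\<Sum>k<r. L2_inner M (q k) h *\<^sub>R q k x)" by blast
  interpret L2_frame M r q by unfold_locales (rule q)
  have cap: "\<And>i. i < N \<Longrightarrow> captured (v i)" "\<And>i. i < N \<Longrightarrow> captured (w i)"
    "\<And>i. i < m \<Longrightarrow> captured (e i)" "\<And>i. i < n \<Longrightarrow> captured (f i)"
    "\<And>i. i < m \<Longrightarrow> captured (e' i)" "\<And>i. i < m \<Longrightarrow> captured (f' i)"
    using H v w eL fL e'(1) f'(1) by (auto simp: captured_def of_coords_coords)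
  have cb: "norm (coords (w i) - coords (v i)) \<le> b" if "i < N" for i
    using norm_coords[OF captured_diff[OF cap(2)[OF that] cap(1)[OF that]]] b[OF that] coords_diff[OF w[OF that] v[OF that]] by simp
  have oe: "orthonormal m (\<lambda>i. coords (e' i))"
    using te cap(5) e'(1) by (simp add: orthonormal_def top_eigenvectors_def inner_coords[symmetric])
  have of: "orthonormal m (\<lambda>i. coords (f' i))"
    using tf cap(6) f'(1) by (simp add: orthonormal_def top_eigenvectors_def inner_coords[symmetric])
  let ?SV = "sample_operator N (\<lambda>i. coords (v i))" and ?SW = "sample_operator N (\<lambda>i. coords (w i))"
  have ce: "?SV (coords (e' i)) = \<mu> i *\<^sub>R coords (e' i)" if "i < m" for i
  proof -
    have "?SV (coords (e' i)) = coords (empirical_operator M N v (e' i))"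
      using coords_empirical[where v = v, OF cap(1) e'(1)[OF that]] by simp
    also have "\<dots> = coords (\<lambda>x. \<mu> i *\<^sub>R e' i x)"
      using that e' by (intro coords_cong empirical_operator_L2 L2_scale v) auto
    also have "\<dots> = \<mu> i *\<^sub>R coords (e' i)" by (simp add: coords_def L2_inner_scale scaleR_sum_right)
    finally show ?thesis .
  qed
  have cf: "?SW (coords (f' i)) = \<nu>' i *\<^sub>R coords (f' i)" if "i < m" for i
  proof -
    have "?SW (coords (f' i)) = coords (empirical_operator M N w (f' i))"
      using coords_empirical[where v = w, OF cap(2) f'(1)[OF that]] by simp
    also have "\<dots> = coords (\<lambda>x. \<nu>' i *\<^sub>R f' i x)"
      using that f' by (intro coords_cong empirical_operator_L2 L2_scale w) auto
    also have "\<dots> = \<nu>' i *\<^sub>R coords (f' i)" by (simp add: coords_def L2_inner_scale scaleR_sum_right)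
    finally show ?thesis .
  qed
  define \<epsilon> where "\<epsilon> = 2 * \<delta> / \<mu> (m - 1)"
  have \<mu>m: "0 < \<mu> (m - 1)" using sv m by (simp add: L2_spectral_def)
  have eps0: "0 \<le> \<epsilon>" unfolding \<epsilon>_def using \<mu>m d0 by simp
  have gap: "norm (u - proj m (\<lambda>i. coords (e' i)) u) \<le> \<epsilon> * norm u"
    if u: "u \<in> coord_span m f'" for u
    unfolding \<epsilon>_def
  proof (rule davis_kahan[OF spectral_form_coords[where v = v, OF cap(1) sv cap(3)] oe ce linear_sample_operator of cf _ d0 _ u m])
    show "norm (?SV x - ?SW x) \<le> \<delta> * norm x" for x
      unfolding \<delta>_def using a cb cap(1) by (intro norm_sample_operator_diff N) (auto simp: norm_coords)
    show "\<bar>\<mu> i - \<nu>' i\<bar> \<le> \<delta>" if "i < m" for i using weyl[of i] that by (simp add: \<nu>'_def)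
  qed
  let ?X = "L2_span M m f'" and ?Y = "L2_span M m e'"
  obtain x y where xy: "(SOME xy. principal_vectors M m ?X ?Y xy) = (x, y)" by fastforce
  have pv: "principal_vectors M m ?X ?Y (x, y)"
    unfolding xy[symmetric] by (rule someI_ex[OF principal_vectors_exist[where f = f' and e = e', OF cap(6) of cap(5) oe]])
  have pp1: "principal_pair m (coord_span m f') (coord_span m e')
      (\<lambda>i. coords (x i)) (\<lambda>i. coords (y i))"
    by (rule principal_vectors_coords(1)[OF _ of _ oe pv]) (use cap in auto)
  have pp2: "L2_inner M (x j) (y j) = coords (x j) \<bullet> coords (y j)" if "j < m" for j
    by (rule principal_vectors_coords(2)[OF _ of _ oe pv]) (use cap that in auto)
  have sin2: "(sin (arccos \<bar>L2_inner M (x j) (y j)\<bar>))\<^sup>2 \<le> 2 ^ j * \<epsilon>\<^sup>2" if j: "j < m" for j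
  proof -
    have "norm (coords (x j)) = 1" "norm (coords (y j)) = 1"
      using pp1 j by (auto simp: principal_pair_def unit_complement_def)
    then have le1: "\<bar>L2_inner M (x j) (y j)\<bar> \<le> 1"
      using Cauchy_Schwarz_ineq2[of "coords (x j)" "coords (y j)"] pp2[OF j] by simp
    then have "(sin (arccos \<bar>L2_inner M (x j) (y j)\<bar>))\<^sup>2 = 1 - (coords (x j) \<bullet> coords (y j))\<^sup>2"
      unfolding sin_squared_eq by (simp add: cos_arccos pp2[OF j])
    also have "\<dots> \<le> 2 ^ j * \<epsilon>\<^sup>2" by (rule principal_pair_sine_bound[OF oe refl pp1 gap eps0 j])
    finally show ?thesis .
  qed
  have "(\<Sum>j<m. (sin (arccos \<bar>L2_inner M (x j) (y j)\<bar>))\<^sup>2) \<le> (\<Sum>j<m. 2 ^ j * \<epsilon>\<^sup>2)"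
    using sin2 by (intro sum_mono) auto
  also have "\<dots> = 2 ^ m * \<epsilon>\<^sup>2 - \<epsilon>\<^sup>2" by (induction m) (simp_all add: algebra_simps)
  also have "\<dots> \<le> 2 ^ m * \<epsilon>\<^sup>2" by simp
  \<comment> \<open>A deliberate loss that makes the right-hand side a perfect square.\<close>
  also have "\<dots> \<le> (2 ^ m)\<^sup>2 * \<epsilon>\<^sup>2" by (intro mult_right_mono self_le_power) auto
  finally have "sqrt (\<Sum>j<m. (sin (arccos \<bar>L2_inner M (x j) (y j)\<bar>))\<^sup>2) \<le> 2 ^ m * \<epsilon>"
    using eps0 by (intro real_le_lsqrt) (auto simp: power_mult_distrib)
  then show "subspace_dist M m ?X ?Y \<le> 2 ^ m * (2 * \<delta> / \<mu> (m - 1))"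
    unfolding subspace_dist_def xy \<epsilon>_def by (simp add: Let_def)
qed

section \<open>Peano's existence theorem\<close>

text \<open>Method of steps: with a delay \<open>h\<close>, the right-hand side up to time
  \<open>(k + 1) * h\<close> involves only values up to time \<open>k * h\<close>, so one
  integration prolongs the solution by \<open>h\<close>.\<close>

lemma delayed_solution_exists:
  fixes u :: "real \<Rightarrow> 'a::euclidean_space \<Rightarrow> 'a"
  assumes u: "continuous_on ({0..1} \<times> UNIV) (\<lambda>(s, x). u s x)" and h: "0 < h"
  shows "\<exists>Y. continuous_on {0..1} Y \<and>
    (\<forall>t\<in>{0..1}. Y t = x + integral {0..t} (\<lambda>s. u s (Y (max 0 (s - h)))))"
proof -
  have cont: "continuous_on {0..1} (\<lambda>s. u s (Y (max 0 (s - h))))" if Y: "continuous_on {0..1} Y" for Y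
  proof -
    have "continuous_on {0..1} (\<lambda>s. Y (max 0 (s - h)))"
      by (rule continuous_on_compose2[OF Y]) (use h in \<open>auto intro!: continuous_intros\<close>)
    then have "continuous_on {0..1} (\<lambda>s. (s, Y (max 0 (s - h))))" by (intro continuous_intros)
    from continuous_on_compose2[OF u this] show ?thesis by auto
  qed
  have "\<exists>Y. continuous_on {0..1} Y \<and>
    (\<forall>t\<in>{0..1}. t \<le> real k * h \<longrightarrow> Y t = x + integral {0..t} (\<lambda>s. u s (Y (max 0 (s - h)))))" for k
  proof (induction k)
    case 0
    then show ?case by (intro exI[of _ "\<lambda>_. x"]) auto
  next
    case (Suc k)
    then obtain Y where Y: "continuous_on {0..1} Y"
      "\<And>t. t \<in> {0..1} \<Longrightarrow> t \<le> real k * h \<Longrightarrow> Y t = x + integral {0..t} (\<lambda>s. u s (Y (max 0 (s - h))))"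
      by auto
    define Z where "Z t = x + integral {0..t} (\<lambda>s. u s (Y (max 0 (s - h))))" for t
    have ZY: "Z t = Y t" if "t \<in> {0..1}" "t \<le> real k * h" for t using Y(2)[OF that] by (simp add: Z_def)
    have "continuous_on {0..1} Z" unfolding Z_def
      by (intro continuous_intros indefinite_integral_continuous_1 integrable_continuous_real cont Y)
    moreover have "Z t = x + integral {0..t} (\<lambda>s. u s (Z (max 0 (s - h))))"
      if t: "t \<in> {0..1}" "t \<le> real (Suc k) * h" for t
    proof -
      have "integral {0..t} (\<lambda>s. u s (Z (max 0 (s - h)))) = integral {0..t} (\<lambda>s. u s (Y (max 0 (s - h))))"
      proof (intro Henstock_Kurzweil_Integration.integral_cong)
        fix s assume s: "s \<in> {0..t}"
        \<comment> \<open>The delayed time falls into the range where \<open>Z\<close> and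
          \<open>Y\<close> agree, so \<open>Z\<close> solves its own delayed equation and not merely
          the one driven by \<open>Y\<close>.\<close>
        have "s - h \<le> real k * h" "0 \<le> real k * h" using s t h by (auto simp: algebra_simps)
        then have "Z (max 0 (s - h)) = Y (max 0 (s - h))" using s t h by (intro ZY) auto
        then show "u s (Z (max 0 (s - h))) = u s (Y (max 0 (s - h)))" by simp
      qed
      then show ?thesis by (simp add: Z_def[of t])
    qed
    ultimately show ?case by blast
  qed
  moreover obtain k :: nat where "1 < real k * h" using reals_Archimedean3[OF h] by blast
  ultimately show ?thesis by (meson atLeastAtMost_iff less_imp_le order_trans)
qed

text \<open>Tonelli's approximation: the solutions with delay \<open>1 / (n + 1)\<close> are
  uniformly bounded and share the Lipschitz constant \<open>M\<close>, so Arzela-Ascoli yields a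
  limit. The global bound on \<open>u\<close> prevents escape before time 1. The Lipschitz bound is
  part of the conclusion because absolute continuity and the second-order expansion of the flow rely
  on it.\<close>

theorem peano_existence:
  fixes u :: "real \<Rightarrow> 'a::euclidean_space \<Rightarrow> 'a"
  assumes u: "continuous_on ({0..1} \<times> UNIV) (\<lambda>(s, x). u s x)"
    and M: "\<And>s x. s \<in> {0..1} \<Longrightarrow> norm (u s x) \<le> M"
  obtains Y where "Y 0 = x" "\<And>t. t \<in> {0..1} \<Longrightarrow> (Y has_vector_derivative u t (Y t)) (at t within {0..1})"
    "\<And>s t. s \<in> {0..1} \<Longrightarrow> t \<in> {0..1} \<Longrightarrow> norm (Y t - Y s) \<le> M * \<bar>t - s\<bar>"
proof -
  have M0: "0 \<le> M" using order_trans[OF norm_ge_zero M[of 0 0]] by simp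
  define h where "h n = 1 / real (Suc n)" for n
  have "\<exists>Y. continuous_on {0..1} Y \<and>
    (\<forall>t\<in>{0..1}. Y t = x + integral {0..t} (\<lambda>s. u s (Y (max 0 (s - h n)))))" for n
    by (rule delayed_solution_exists[OF u]) (simp add: h_def)
  then obtain Y where Yc: "\<And>n. continuous_on {0..1} (Y n)"
    and Y: "\<And>n t. t \<in> {0..1} \<Longrightarrow> Y n t = x + integral {0..t} (\<lambda>s. u s (Y n (max 0 (s - h n))))" by metis
  have uc: "continuous_on {0..1} (\<lambda>s. u s (Z s))" if "continuous_on {0..1} Z" for Z
  proof -
    have "continuous_on {0..1} (\<lambda>s. (s, Z s))" using that by (intro continuous_intros)
    from continuous_on_compose2[OF u this] show ?thesis by auto
  qed
  have hpos: "0 < h n" for n by (simp add: h_def)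
  have Ydc: "continuous_on {0..1} (\<lambda>s. Y n (max 0 (s - h n)))" for n
    by (rule continuous_on_compose2[OF Yc]) (use hpos[of n] in \<open>auto intro!: continuous_intros\<close>)
  have int: "(\<lambda>s. u s (Y n (max 0 (s - h n)))) integrable_on {a..b}" if "0 \<le> a" "b \<le> 1" for n a b
    using that by (intro integrable_continuous_real continuous_on_subset[OF uc[OF Ydc]]) auto
  have lip1: "norm (Y n t - Y n s) \<le> M * (t - s)" if st: "0 \<le> s" "s \<le> t" "t \<le> 1" for n s t
  proof -
    have "integral {0..s} (\<lambda>s. u s (Y n (max 0 (s - h n)))) + integral {s..t} (\<lambda>s. u s (Y n (max 0 (s - h n))))
      = integral {0..t} (\<lambda>s. u s (Y n (max 0 (s - h n))))"
      using st by (intro Henstock_Kurzweil_Integration.integral_combine int) auto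
    then have "Y n t - Y n s = integral {s..t} (\<lambda>s. u s (Y n (max 0 (s - h n))))"
      using Y[of t n] Y[of s n] st by (simp add: algebra_simps)
    also have "norm \<dots> \<le> M * (t - s)"
      using st by (intro integral_bound) (auto intro!: continuous_on_subset[OF uc[OF Ydc]] M)
    finally show ?thesis .
  qed
  have lip: "norm (Y n t - Y n s) \<le> M * \<bar>t - s\<bar>" if "s \<in> {0..1}" "t \<in> {0..1}" for n s t
    using lip1[of s t n] lip1[of t s n] that by (cases "s \<le> t") (auto simp: norm_minus_commute)
  have Y0: "Y n 0 = x" for n using Y[of 0 n] by simp
  have bnd: "norm (Y n t) \<le> norm x + M" if t: "t \<in> {0..1}" for n t
  proof -
    have "norm (Y n t - Y n 0) \<le> M * \<bar>t - 0\<bar>" using t by (intro lip) auto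
    also have "\<dots> \<le> M" using t M0 by (simp add: mult_left_le)
    finally show ?thesis unfolding Y0 using norm_triangle_sub[of "Y n t" x] by linarith
  qed
  have equi: "\<exists>d. 0 < d \<and> (\<forall>n t. t \<in> {0..1} \<and> norm (s - t) < d \<longrightarrow> norm (Y n s - Y n t) < e)"
    if s: "s \<in> {0..1}" and e: "0 < e" for s e :: real
  proof (intro exI[of _ "e / (M + 1)"] conjI allI impI)
    show "0 < e / (M + 1)" using M0 e by simp
    fix n t assume t: "t \<in> {0..1} \<and> norm (s - t) < e / (M + 1)"
    have "norm (Y n s - Y n t) \<le> M * \<bar>s - t\<bar>" using lip[of t s n] s t by auto
    also have "\<dots> \<le> (M + 1) * \<bar>s - t\<bar>" by (intro mult_right_mono) auto
    also have "\<dots> < e" using t M0 by (simp add: field_simps)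
    finally show "norm (Y n s - Y n t) < e" .
  qed
  obtain Z k where Zc: "continuous_on {0..1} Z" and k: "strict_mono (k :: nat \<Rightarrow> nat)"
    and conv: "\<And>e. 0 < e \<Longrightarrow> \<exists>N. \<forall>n t. n \<ge> N \<and> t \<in> {0..1} \<longrightarrow> norm (Y (k n) t - Z t) < e"
    using Arzela_Ascoli[of "{0..1::real}" Y "norm x + M", OF compact_Icc bnd equi] by metis
  have lim: "(\<lambda>n. Y (k n) t) \<longlonglongrightarrow> Z t" if "t \<in> {0..1}" for t
  proof (rule LIMSEQ_I)
    fix e :: real assume "0 < e"
    then show "\<exists>N. \<forall>n\<ge>N. norm (Y (k n) t - Z t) < e" using conv that by meson
  qed
  have hk: "(\<lambda>n. h (k n)) \<longlonglongrightarrow> 0"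
    using LIMSEQ_subseq_LIMSEQ[OF LIMSEQ_inverse_real_of_nat k] by (simp add: h_def o_def inverse_eq_divide)
  \<comment> \<open>The common Lipschitz constant bounds the effect of the delay by
    \<open>M * h (k n)\<close>, which vanishes in the limit.\<close>
  have limd: "(\<lambda>n. Y (k n) (max 0 (t - h (k n)))) \<longlonglongrightarrow> Z t" if t: "t \<in> {0..1}" for t
  proof -
    have "(\<lambda>n. Y (k n) (max 0 (t - h (k n))) - Y (k n) t) \<longlonglongrightarrow> 0"
    proof (rule Lim_null_comparison)
      show "\<forall>\<^sub>F n in sequentially. norm (Y (k n) (max 0 (t - h (k n))) - Y (k n) t) \<le> M * h (k n)"
      proof (intro always_eventually allI)
        fix n
        have "norm (Y (k n) (max 0 (t - h (k n))) - Y (k n) t) \<le> M * \<bar>max 0 (t - h (k n)) - t\<bar>"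
          using t hpos[of "k n"] by (intro lip) auto
        also have "\<dots> \<le> M * h (k n)" using t hpos[of "k n"] M0 by (intro mult_left_mono) auto
        finally show "norm (Y (k n) (max 0 (t - h (k n))) - Y (k n) t) \<le> M * h (k n)" .
      qed
      show "(\<lambda>n. M * h (k n)) \<longlonglongrightarrow> 0" using tendsto_mult_left[OF hk, of M] by simp
    qed
    from tendsto_add[OF this lim[OF t]] show ?thesis by simp
  qed
  have Zeq: "Z t = x + integral {0..t} (\<lambda>s. u s (Z s))" if t: "t \<in> {0..1}" for t
  proof -
    have "(\<lambda>n. integral {0..t} (\<lambda>s. u s (Y (k n) (max 0 (s - h (k n)))))) \<longlonglongrightarrow> integral {0..t} (\<lambda>s. u s (Z s))"
    proof (rule dominated_convergence(2))
      show "(\<lambda>s. u s (Y (k n) (max 0 (s - h (k n))))) integrable_on {0..t}" for n using t by (intro int) auto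
      show "(\<lambda>_. M) integrable_on {0..t}" by (rule integrable_const_ivl)
      show "norm (u s (Y (k n) (max 0 (s - h (k n))))) \<le> M" if "s \<in> {0..t}" for n s using M that t by auto
      show "(\<lambda>n. u s (Y (k n) (max 0 (s - h (k n))))) \<longlonglongrightarrow> u s (Z s)" if s: "s \<in> {0..t}" for s
      proof -
        have s1: "s \<in> {0..1}" using s t by auto
        then have "range (Pair s) \<subseteq> {0..1} \<times> (UNIV :: 'a set)" by auto
        then have "continuous_on UNIV (u s)"
          using continuous_on_compose2[OF u continuous_on_Pair[OF continuous_on_const continuous_on_id], of s UNIV]
          by auto
        then have "isCont (u s) (Z s)" by (simp add: continuous_on_eq_continuous_at)
        from isCont_tendsto_compose[OF this limd[OF s1]] show ?thesis .
      qed
    qed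
    then have "(\<lambda>n. Y (k n) t) \<longlonglongrightarrow> x + integral {0..t} (\<lambda>s. u s (Z s))"
      unfolding Y[OF t] by (intro tendsto_intros)
    from LIMSEQ_unique[OF lim[OF t] this] show ?thesis .
  qed
  show ?thesis
  proof (rule that[of Z])
    show "Z 0 = x" using Zeq[of 0] by simp
    show "(Z has_vector_derivative u t (Z t)) (at t within {0..1})" if t: "t \<in> {0..1}" for t
    proof -
      have "((\<lambda>t. x + integral {0..t} (\<lambda>s. u s (Z s))) has_vector_derivative u t (Z t)) (at t within {0..1})"
        using has_vector_derivative_add[OF has_vector_derivative_const integral_has_vector_derivative[OF uc[OF Zc] t]]
        by simp
      then show ?thesis by (rule has_vector_derivative_transform[OF t, rotated]) (simp add: Zeq)
    qed
    show "norm (Z t - Z s) \<le> M * \<bar>t - s\<bar>" if "s \<in> {0..1}" "t \<in> {0..1}" for s t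
    proof -
      have "(\<lambda>n. norm (Y (k n) t - Y (k n) s)) \<longlonglongrightarrow> norm (Z t - Z s)" using that by (intro tendsto_intros lim)
      then show ?thesis by (rule LIMSEQ_le_const2) (use lip that in auto)
    qed
  qed
qed

section \<open>Stability of optimal maps\<close>

text \<open>Mean value inequality for \<open>\<psi> y - v x \<bullet> y\<close> on the segment from
  \<open>x\<close> to \<open>z\<close>: its gradient \<open>v y - v x\<close> is at most
  \<open>K * norm (z - x)\<close> there.\<close>

lemma gradient_lipschitz_quadratic_bound:
  fixes v :: "'a::euclidean_space \<Rightarrow> 'a"
  assumes g: "\<And>x. gderiv \<psi> x (v x)" and K: "\<And>x y. norm (v x - v y) \<le> K * norm (x - y)" "0 \<le> K"
  shows "\<bar>\<psi> z - \<psi> x - v x \<bullet> (z - x)\<bar> \<le> K * (norm (z - x))\<^sup>2"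
proof -
  have K0: "0 \<le> K * norm (z - x)" using K(2) by simp
  have "norm ((\<psi> z - v x \<bullet> z) - (\<psi> x - v x \<bullet> x)) \<le> (K * norm (z - x)) * norm (z - x)"
  proof (rule differentiable_bound[OF convex_closed_segment[of x z]])
    show "((\<lambda>y. \<psi> y - v x \<bullet> y) has_derivative (\<lambda>h. h \<bullet> v y - v x \<bullet> h)) (at y within closed_segment x z)" for y
    proof -
      have "(\<psi> has_derivative (\<lambda>h. h \<bullet> v y)) (at y within closed_segment x z)"
        using g[of y] unfolding gderiv_def by (rule has_derivative_at_withinI)
      then show ?thesis
        by (rule has_derivative_diff[OF _ bounded_linear_imp_has_derivative[OF bounded_linear_inner_right]])
    qed
    show "onorm (\<lambda>h. h \<bullet> v y - v x \<bullet> h) \<le> K * norm (z - x)" if y: "y \<in> closed_segment x z" for y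
    proof (rule onorm_bound[OF K0])
      fix h
      have "norm (h \<bullet> v y - v x \<bullet> h) = \<bar>(v y - v x) \<bullet> h\<bar>" by (simp add: inner_diff_left inner_commute[of h])
      also have "\<dots> \<le> norm (v y - v x) * norm h" by (rule Cauchy_Schwarz_ineq2)
      also have "\<dots> \<le> (K * norm (z - x)) * norm h"
      proof (rule mult_right_mono)
        have "norm (y - x) \<le> norm (z - x)"
          using dist_in_closed_segment[OF y] by (simp add: dist_norm norm_minus_commute)
        then show "norm (v y - v x) \<le> K * norm (z - x)" using K(1)[of y x] mult_left_mono[OF _ K(2)] by (meson order_trans)
      qed simp
      finally show "norm (h \<bullet> v y - v x \<bullet> h) \<le> (K * norm (z - x)) * norm h" .
    qed
  qed auto
  then show ?thesis by (simp add: inner_diff_right power2_eq_square algebra_simps)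
qed

text \<open>\<open>f\<close> is uniformly convex with gradient \<open>x + t v x\<close>, and \<open>h\<close> is its Legendre transform.\<close>

lemma legendre_sandwich:
  fixes v :: "'a::euclidean_space \<Rightarrow> 'a"
  assumes g: "\<And>x. gderiv \<psi> x (v x)" and K: "\<And>x y. norm (v x - v y) \<le> K * norm (x - y)" "0 \<le> K"
    and t: "0 \<le> t" "t * K \<le> 1 / 4"
    and f_def: "f = (\<lambda>x. (norm x)\<^sup>2 / 2 + t * \<psi> x)" and h_def: "h = (\<lambda>y. SUP z. y \<bullet> z - f z)"
  shows "(norm (y - x - t *\<^sub>R v x))\<^sup>2 / 4 \<le> f x + h y - x \<bullet> y"
    and "f x + h y - x \<bullet> y \<le> (norm (y - x - t *\<^sub>R v x))\<^sup>2"
    and "bdd_above (range (\<lambda>z. y \<bullet> z - f z))"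
proof -
  \<comment> \<open>The condition \<open>t * K \<le> 1 / 4\<close> keeps the second-order remainder
    of \<open>f\<close> between \<open>1/4\<close> and \<open>3/4\<close> of
    \<open>(norm (z - x))\<^sup>2\<close>.\<close>
  have taylor: "\<bar>f z - f x - (x + t *\<^sub>R v x) \<bullet> (z - x) - (norm (z - x))\<^sup>2 / 2\<bar> \<le> (norm (z - x))\<^sup>2 / 4" for z x
  proof -
    have "f z - f x - (x + t *\<^sub>R v x) \<bullet> (z - x) - (norm (z - x))\<^sup>2 / 2 = t * (\<psi> z - \<psi> x - v x \<bullet> (z - x))"
      unfolding f_def power2_norm_eq_inner
      by (simp add: inner_diff_left inner_diff_right inner_add_left inner_commute algebra_simps add_divide_distrib diff_divide_distrib)
    then have "\<bar>f z - f x - (x + t *\<^sub>R v x) \<bullet> (z - x) - (norm (z - x))\<^sup>2 / 2\<bar> \<le> t * (K * (norm (z - x))\<^sup>2)"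
      using mult_left_mono[OF gradient_lipschitz_quadratic_bound[OF g K, of z x] t(1)] t(1) by (simp add: abs_mult)
    also have "\<dots> \<le> 1 / 4 * (norm (z - x))\<^sup>2"
      using mult_right_mono[OF t(2), of "(norm (z - x))\<^sup>2"] by (simp add: mult.assoc)
    finally show ?thesis by simp
  qed
  have up: "y \<bullet> z - f z \<le> y \<bullet> x - f x + (norm (y - x - t *\<^sub>R v x))\<^sup>2" for x y z
  proof -
    let ?d = "y - x - t *\<^sub>R v x"
    \<comment> \<open>Young's inequality by completing the square; its term
      \<open>(norm (z - x))\<^sup>2 / 4\<close> is absorbed by the convexity of
      \<open>f\<close>.\<close>
    have "0 \<le> (norm (?d - (1/2) *\<^sub>R (z - x)))\<^sup>2" by simp
    then have "?d \<bullet> (z - x) \<le> (norm ?d)\<^sup>2 + (norm (z - x))\<^sup>2 / 4"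
      unfolding power2_norm_eq_inner[of "?d - _"]
      by (simp add: inner_diff_left[of ?d] inner_diff_right[of _ ?d] power2_norm_eq_inner inner_commute[of "z - x" ?d])
    moreover have "y \<bullet> z - f z - (y \<bullet> x - f x) = ?d \<bullet> (z - x) - (f z - f x - (x + t *\<^sub>R v x) \<bullet> (z - x))"
      by (simp add: inner_diff_left inner_diff_right inner_add_left)
    ultimately show ?thesis using taylor[of z x] unfolding abs_le_iff by linarith
  qed
  show bdd: "bdd_above (range (\<lambda>z. y \<bullet> z - f z))" for y using up[of y _ 0] by (auto simp: bdd_above_def)
  have "h y \<le> y \<bullet> x - f x + (norm (y - x - t *\<^sub>R v x))\<^sup>2" unfolding h_def by (rule cSUP_least) (auto intro: up)
  then show "f x + h y - x \<bullet> y \<le> (norm (y - x - t *\<^sub>R v x))\<^sup>2" by (simp add: inner_commute)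
  \<comment> \<open>Test point for the supremum: stepping from \<open>x\<close> by the defect
    \<open>y - x - t *\<^sub>R v x\<close> gains its full square and loses at most three quarters of
    it.\<close>
  define z where "z = x + (y - x - t *\<^sub>R v x)"
  have "y \<bullet> z - f z \<le> h y" unfolding h_def by (rule cSUP_upper[OF _ bdd]) simp
  moreover have "y \<bullet> z - f z - (y \<bullet> x - f x) = (z - x) \<bullet> (z - x) - (f z - f x - (x + t *\<^sub>R v x) \<bullet> (z - x))"
    by (simp add: z_def inner_diff_left inner_diff_right inner_add_left inner_add_right inner_commute)
  moreover have "(norm (z - x))\<^sup>2 = (z - x) \<bullet> (z - x)" by (rule power2_norm_eq_inner)
  moreover have "z - x = y - x - t *\<^sub>R v x" by (simp add: z_def)
  ultimately have "(norm (z - x))\<^sup>2 / 4 \<le> f x + h y - x \<bullet> y"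
    using taylor[of z x] unfolding abs_le_iff inner_commute[of x y] by linarith
  then show "(norm (y - x - t *\<^sub>R v x))\<^sup>2 / 4 \<le> f x + h y - x \<bullet> y"
    unfolding \<open>z - x = y - x - t *\<^sub>R v x\<close> .
qed

text \<open>On the compact set \<open>\<Omega> \<times> \<Omega>\<close> the integrand is bounded,
  and the pair stays there almost surely.\<close>

lemma integrable_continuous_pair:
  fixes q :: "'d::euclidean_space \<times> 'd \<Rightarrow> real"
  assumes M: "prob_space M" "sets M = sets borel" and \<Omega>: "compact \<Omega>" and x: "AE x in M. x \<in> \<Omega>"
    and T: "T \<in> borel_measurable borel" "AE x in M. T x \<in> \<Omega>" and q: "continuous_on UNIV q"
  shows "integrable M (\<lambda>x. q (x, T x))"
proof -
  interpret prob_space M by fact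
  have T': "T \<in> borel_measurable M" using T(1) M(2) by (simp cong: measurable_cong_sets)
  have id: "(\<lambda>x. x) \<in> borel_measurable M" using M(2) by (simp add: measurable_ident_sets)
  have "compact (q ` (\<Omega> \<times> \<Omega>))"
    by (intro compact_continuous_image compact_Times \<Omega> continuous_on_subset[OF q]) auto
  then obtain B where "\<forall>r\<in>q ` (\<Omega> \<times> \<Omega>). norm r \<le> B"
    using compact_imp_bounded bounded_iff by metis
  then have B: "norm (q p) \<le> B" if "p \<in> \<Omega> \<times> \<Omega>" for p using that by blast
  show ?thesis
  proof (rule integrable_const_bound[of _ B])
    show "AE x in M. norm (q (x, T x)) \<le> B" using x T(2) by eventually_elim (rule B, simp)
    have "(\<lambda>x. (x, T x)) \<in> borel_measurable M" by (rule borel_measurable_Pair[OF id T'])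
    moreover have "q \<in> borel_measurable borel" by (rule borel_measurable_continuous_onI[OF q])
    ultimately show "(\<lambda>x. q (x, T x)) \<in> borel_measurable M" by (rule measurable_compose)
  qed
qed

text \<open>Let \<open>gap G\<close> be the integral of
  \<open>f x + h (G x) - x \<bullet> G x\<close>. Since \<open>T\<close> and \<open>F\<close> have
  the same push-forward, the two gaps differ only through the integral of
  \<open>x \<bullet> G x\<close>, which is larger for the cheaper map; so
  \<open>gap T \<le> gap F\<close>. The sandwich bounds, with constants \<open>1/4\<close> and 1,
  turn this into the claim with factor 4.\<close>

lemma transport_stability:
  fixes v T F :: "'d::euclidean_space \<Rightarrow> 'd"
  assumes M: "prob_space M" "sets M = sets borel" and \<Omega>: "compact \<Omega>" and x: "AE x in M. x \<in> \<Omega>"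
    and T: "T \<in> borel_measurable borel" "AE x in M. T x \<in> \<Omega>"
    and F: "F \<in> borel_measurable borel" "AE x in M. F x \<in> \<Omega>"
    and push: "distr M borel T = distr M borel F"
    and cost: "(LINT x|M. (norm (x - T x))\<^sup>2) \<le> (LINT x|M. (norm (x - F x))\<^sup>2)"
    and g: "\<And>x. gderiv \<psi> x (v x)" and K: "\<And>x y. norm (v x - v y) \<le> K * norm (x - y)" "0 \<le> K"
    and t: "0 \<le> t" "t * K \<le> 1 / 4"
  shows "(LINT x|M. (norm (T x - x - t *\<^sub>R v x))\<^sup>2) \<le> 4 * (LINT x|M. (norm (F x - x - t *\<^sub>R v x))\<^sup>2)"
proof -
  interpret prob_space M by fact
  define f where "f = (\<lambda>x. (norm x)\<^sup>2 / 2 + t * \<psi> x)"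
  define h where "h = (\<lambda>y. SUP z. y \<bullet> z - f z)"
  note leg = legendre_sandwich[OF g K t f_def h_def]
  have \<psi>c: "continuous_on UNIV \<psi>"
    using g unfolding gderiv_def by (intro continuous_at_imp_continuous_on ballI) (auto intro: has_derivative_continuous)
  have "K-lipschitz_on UNIV v" using K by (intro lipschitz_onI) (auto simp: dist_norm)
  then have vc: "continuous_on UNIV v" by (rule lipschitz_on_continuous_on)
  have fc: "continuous_on UNIV f" unfolding f_def by (intro continuous_intros \<psi>c) simp
  \<comment> \<open>\<open>h\<close> is an uncountable supremum, but of functions continuous in
    \<open>y\<close>; its strict superlevel sets are therefore open.\<close>
  have hm: "h \<in> borel_measurable borel"
  proof (rule borel_measurableI_greater)
    fix a
    have "{y \<in> space borel. a < h y} = (\<Union>z. {y. a < y \<bullet> z - f z})"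
      unfolding h_def using less_cSUP_iff[OF _ leg(3)] by auto
    moreover have "open \<dots>" by (intro open_UN ballI open_Collect_less continuous_intros)
    ultimately show "{y \<in> space borel. a < h y} \<in> sets borel" by simp
  qed
  have int: "integrable M (\<lambda>x. q (x, G x))"
    if "G = T \<or> G = F" "continuous_on UNIV q" for q :: "'d \<times> 'd \<Rightarrow> real" and G
    using that integrable_continuous_pair[OF M \<Omega> x] T F by auto
  \<comment> \<open>The sandwich taken at \<open>x = 0\<close> bounds \<open>\<bar>h y\<bar>\<close>
    by a continuous function of \<open>y\<close>.\<close>
  have inth: "integrable M (\<lambda>x. h (G x))" if G: "G = T \<or> G = F" for G
  proof (rule Bochner_Integration.integrable_bound)
    show "integrable M (\<lambda>x. (\<lambda>(x, y). (norm (y - 0 - t *\<^sub>R v 0))\<^sup>2 + \<bar>f 0\<bar>) (x, G x))"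
      by (rule int[OF G]) (auto simp: case_prod_unfold intro!: continuous_intros)
    have "G \<in> borel_measurable M" using G T F M(2) by (auto cong: measurable_cong_sets)
    then show "(\<lambda>x. h (G x)) \<in> borel_measurable M" using hm by (rule measurable_compose)
    show "AE x in M. norm (h (G x)) \<le> norm ((\<lambda>(x, y). (norm (y - 0 - t *\<^sub>R v 0))\<^sup>2 + \<bar>f 0\<bar>) (x, G x))"
    proof (intro AE_I2)
      fix x
      show "norm (h (G x)) \<le> norm ((\<lambda>(x, y). (norm (y - 0 - t *\<^sub>R v 0))\<^sup>2 + \<bar>f 0\<bar>) (x, G x))"
        using leg(1)[of "G x" 0] leg(2)[of 0 "G x"] zero_le_power2[of "norm (G x - 0 - t *\<^sub>R v 0)"]
        by (simp del: zero_le_power2)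
    qed
  qed
  have "continuous_on UNIV (\<lambda>p :: 'd \<times> 'd. f (fst p))" "continuous_on UNIV (\<lambda>p :: 'd \<times> 'd. v (fst p))"
    using continuous_on_compose2[OF fc continuous_on_fst[OF continuous_on_id]]
      continuous_on_compose2[OF vc continuous_on_fst[OF continuous_on_id]] by auto
  note cfst = this
  have fint: "integrable M f" using int[of T, OF _ cfst(1)] by simp
  have xyint: "integrable M (\<lambda>x. x \<bullet> G x)" if G: "G = T \<or> G = F" for G
    by (rule int[OF G, of "\<lambda>p. fst p \<bullet> snd p", simplified]) (intro continuous_intros)
  have sint: "integrable M (\<lambda>x. (norm (G x - x - t *\<^sub>R v x))\<^sup>2)" if G: "G = T \<or> G = F" for G
    by (rule int[OF G, of "\<lambda>p. (norm (snd p - fst p - t *\<^sub>R v (fst p)))\<^sup>2", simplified])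
      (intro continuous_intros cfst)
  have Nint: "integrable M (\<lambda>x. (norm (G x))\<^sup>2)" if G: "G = T \<or> G = F" for G
    by (rule int[OF G, of "\<lambda>p. (norm (snd p))\<^sup>2", simplified]) (intro continuous_intros)
  have X2int: "integrable M (\<lambda>x. (norm x)\<^sup>2)"
    by (rule int[of T "\<lambda>p. (norm (fst p))\<^sup>2", simplified]) (intro continuous_intros)
  have push_int: "(LINT x|M. q (T x)) = (LINT x|M. q (F x))" if "q \<in> borel_measurable borel" for q :: "'d \<Rightarrow> real"
  proof -
    have "(LINT x|M. q (T x)) = (LINT y|distr M borel T. q y)"
      using T M(2) that by (intro integral_distr[symmetric]) (auto cong: measurable_cong_sets)
    also have "\<dots> = (LINT x|M. q (F x))"
      unfolding push using F M(2) that by (intro integral_distr) (auto cong: measurable_cong_sets)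
    finally show ?thesis .
  qed
  have expand: "(LINT x|M. (norm (x - G x))\<^sup>2) =
      (LINT x|M. (norm x)\<^sup>2) + (LINT x|M. (norm (G x))\<^sup>2) - 2 * (LINT x|M. x \<bullet> G x)" if G: "G = T \<or> G = F" for G
  proof -
    have "(LINT x|M. (norm (x - G x))\<^sup>2) = (LINT x|M. (norm x)\<^sup>2 + (norm (G x))\<^sup>2 - 2 * (x \<bullet> G x))"
      by (intro Bochner_Integration.integral_cong) (auto simp: power2_norm_eq_inner inner_diff_left inner_diff_right inner_commute)
    then show ?thesis using X2int Nint[OF G] xyint[OF G] by simp
  qed
  have dual: "(LINT x|M. f x + h (G x) - x \<bullet> G x) = (LINT x|M. f x) + (LINT x|M. h (G x)) - (LINT x|M. x \<bullet> G x)"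
    if G: "G = T \<or> G = F" for G
    using fint inth[OF G] xyint[OF G] by simp
  have "(LINT x|M. (norm (T x - x - t *\<^sub>R v x))\<^sup>2 / 4) \<le> (LINT x|M. f x + h (T x) - x \<bullet> T x)"
    using leg(1) fint inth xyint sint by (intro integral_mono) auto
  moreover have "(LINT x|M. f x + h (F x) - x \<bullet> F x) \<le> (LINT x|M. (norm (F x - x - t *\<^sub>R v x))\<^sup>2)"
    using leg(2) fint inth xyint sint by (intro integral_mono) auto
  \<comment> \<open>Expanding the squares: the second moments of \<open>T\<close> and
    \<open>F\<close> agree because the push-forwards do, so a smaller cost means a larger
    correlation with \<open>x\<close>.\<close>
  moreover have "(LINT x|M. x \<bullet> F x) \<le> (LINT x|M. x \<bullet> T x)"
    using cost expand[of T] expand[of F] push_int[of "\<lambda>y. (norm y)\<^sup>2"] by simp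
  ultimately show ?thesis using dual[of T] dual[of F] push_int[OF hm] by simp
qed

lemma optimal_map_cost_le:
  assumes opt: "optimal_map M N T" and M: "sets M = sets borel"
    and F: "F \<in> borel_measurable borel" "distr M borel F = N"
    and int: "integrable M (\<lambda>x. (norm (x - T x))\<^sup>2)" "integrable M (\<lambda>x. (norm (x - F x))\<^sup>2)"
  shows "(LINT x|M. (norm (x - T x))\<^sup>2) \<le> (LINT x|M. (norm (x - F x))\<^sup>2)"
proof -
  have id: "(\<lambda>x. x) \<in> M \<rightarrow>\<^sub>M borel" using M by (simp add: measurable_ident_sets)
  have T: "T \<in> borel_measurable borel" using opt by (simp add: optimal_map_def)
  have pm: "(\<lambda>x. (x, G x)) \<in> M \<rightarrow>\<^sub>M borel" if "G \<in> borel_measurable borel" for G :: "'a \<Rightarrow> 'a"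
  proof -
    have "G \<in> borel_measurable M" using that M by (simp cong: measurable_cong_sets)
    then show ?thesis by (rule borel_measurable_Pair[OF id])
  qed
  have fs: "fst \<in> borel_measurable (borel :: ('a \<times> 'a) measure)" "snd \<in> borel_measurable (borel :: ('a \<times> 'a) measure)"
    by (auto intro!: borel_measurable_continuous_onI continuous_intros)
  have cost: "transport_cost (distr M borel (\<lambda>x. (x, G x))) = ennreal (LINT x|M. (norm (x - G x))\<^sup>2)"
    if "G \<in> borel_measurable borel" "integrable M (\<lambda>x. (norm (x - G x))\<^sup>2)" for G
  proof -
    have "transport_cost (distr M borel (\<lambda>x. (x, G x))) = (\<integral>\<^sup>+ x. ennreal ((norm (x - G x))\<^sup>2) \<partial>M)"
      unfolding transport_cost_def using fs by (subst nn_integral_distr[OF pm[OF that(1)]]) auto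
    then show ?thesis using nn_integral_eq_integral[OF that(2)] by simp
  qed
  have "distr M borel (\<lambda>x. (x, F x)) \<in> couplings M N"
    using F M by (auto simp: couplings_def distr_distr[OF fs(1) pm] distr_distr[OF fs(2) pm] o_def distr_id2)
  then have "transport_cost (distr M borel (\<lambda>x. (x, T x))) \<le> transport_cost (distr M borel (\<lambda>x. (x, F x)))"
    using opt by (auto simp: optimal_map_def optimal_coupling_def)
  then show ?thesis unfolding cost[OF T int(1)] cost[OF F(1) int(2)] by (simp add: ennreal_le_iff)
qed

lemma optimal_map_push:
  assumes opt: "optimal_map M N T" and M: "sets M = sets borel"
  shows "distr M borel T = N" "T \<in> borel_measurable borel"
proof -
  show T: "T \<in> borel_measurable borel" using opt by (simp add: optimal_map_def)
  have id: "(\<lambda>x. x) \<in> M \<rightarrow>\<^sub>M borel" using M by (simp add: measurable_ident_sets)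
  have "T \<in> borel_measurable M" using T M by (simp cong: measurable_cong_sets)
  then have pm: "(\<lambda>x. (x, T x)) \<in> M \<rightarrow>\<^sub>M borel" by (rule borel_measurable_Pair[OF id])
  have sn: "snd \<in> borel_measurable (borel :: ('a \<times> 'a) measure)"
    by (auto intro!: borel_measurable_continuous_onI continuous_intros)
  have "distr (distr M borel (\<lambda>x. (x, T x))) borel snd = N"
    using opt by (auto simp: optimal_map_def optimal_coupling_def couplings_def)
  then show "distr M borel T = N" by (simp add: distr_distr[OF sn pm] o_def)
qed

text \<open>For a function \<open>f\<close> that is not measurable, a preimage \<open>f -` A\<close> and its complement are both
  non-measurable and count as null sets, so \<open>distr\<close> cannot have total mass 1.\<close>

lemma measurable_of_prob_space_distr:
  assumes "prob_space (distr M N f)" "f \<in> space M \<rightarrow> space N"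
  shows "f \<in> measurable M N"
proof (rule ccontr)
  assume "f \<notin> measurable M N"
  then obtain A where A: "A \<in> sets N" "f -` A \<inter> space M \<notin> sets M" using assms(2) by (auto simp: measurable_def)
  interpret D: prob_space "distr M N f" by fact
  \<comment> \<open>Only an inequality holds without measurability: if the set function fails to be
    a measure, \<open>distr\<close> assigns zero to every set.\<close>
  have le: "emeasure (distr M N f) X \<le> emeasure M (f -` X \<inter> space M)" for X
    unfolding distr_def by (auto simp: emeasure_measure_of_conv)
  have eq: "f -` (space N - A) \<inter> space M = space M - (f -` A \<inter> space M)" using assms(2) by auto
  have nm: "f -` (space N - A) \<inter> space M \<notin> sets M"
  proof
    assume "f -` (space N - A) \<inter> space M \<in> sets M"
    then have "space M - (space M - (f -` A \<inter> space M)) \<in> sets M" unfolding eq by (rule sets.compl_sets)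
    moreover have "space M - (space M - (f -` A \<inter> space M)) = f -` A \<inter> space M" by auto
    ultimately show False using A by simp
  qed
  have "emeasure (distr M N f) A = 0" using le[of A] emeasure_notin_sets[OF A(2)] by simp
  moreover have "emeasure (distr M N f) (space N - A) = 0" using le[of "space N - A"] emeasure_notin_sets[OF nm] by simp
  moreover have "emeasure (distr M N f) A + emeasure (distr M N f) (space N - A) = emeasure (distr M N f) (A \<union> (space N - A))"
    using A by (intro plus_emeasure) auto
  moreover have "A \<union> (space N - A) = space N" using sets.sets_into_space[OF A(1)] by auto
  ultimately show False using D.emeasure_space_1 by simp
qed

text \<open>The flow is solved separately from each starting point, so measurability in the starting
  point is not known beforehand. It is recovered from the push-forward being a probability measure;
  the extension by the identity outside \<open>\<Omega>\<close> changes the map only on a null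
  set.\<close>

lemma distr_restrict_space_extend:
  fixes \<phi> :: "'d::euclidean_space \<Rightarrow> 'd"
  assumes M: "prob_space M" "sets M = sets borel" and \<Omega>: "\<Omega> \<in> sets borel" "AE x in M. x \<in> \<Omega>"
    and D: "prob_space (distr (restrict_space M \<Omega>) borel \<phi>)"
  defines "F \<equiv> \<lambda>x. if x \<in> \<Omega> then \<phi> x else x"
  shows "F \<in> borel_measurable borel" "distr (restrict_space M \<Omega>) borel \<phi> = distr M borel F"
proof -
  have \<phi>: "\<phi> \<in> borel_measurable (restrict_space M \<Omega>)"
    by (rule measurable_of_prob_space_distr[OF D]) auto
  then have "\<phi> \<in> borel_measurable (restrict_space borel \<Omega>)"
    using sets_restrict_space_cong[OF M(2)] by (simp cong: measurable_cong_sets)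
  then show F: "F \<in> borel_measurable borel" unfolding F_def using \<Omega>
    by (intro measurable_If_restrict_space_iff[THEN iffD2]) (auto intro!: measurable_restrict_space1)
  have F': "F \<in> borel_measurable M" using F M(2) by (simp cong: measurable_cong_sets)
  have sp: "space M = UNIV" using sets_eq_imp_space_eq[OF M(2)] by simp
  show "distr (restrict_space M \<Omega>) borel \<phi> = distr M borel F"
  proof (rule measure_eqI)
    fix A assume "A \<in> sets (distr (restrict_space M \<Omega>) borel \<phi>)"
    then have A: "A \<in> sets borel" by simp
    have "emeasure (distr (restrict_space M \<Omega>) borel \<phi>) A = emeasure (restrict_space M \<Omega>) (\<phi> -` A \<inter> \<Omega>)"
      using \<phi> A sp by (simp add: emeasure_distr space_restrict_space)
    also have "\<dots> = emeasure M (\<phi> -` A \<inter> \<Omega>)" using \<Omega> M sp by (intro emeasure_restrict_space) auto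
    also have "\<phi> -` A \<inter> \<Omega> = (F -` A \<inter> space M) \<inter> \<Omega>" using sp by (auto simp: F_def)
    also have "emeasure M \<dots> = emeasure M (F -` A \<inter> space M)"
      using \<Omega> M measurable_sets[OF F' A] by (intro emeasure_eq_AE) auto
    finally show "emeasure (distr (restrict_space M \<Omega>) borel \<phi>) A = emeasure (distr M borel F) A"
      using F' A by (simp add: emeasure_distr)
  qed simp
qed

section \<open>Geodesics and flows\<close>

lemma chart_at_props:
  assumes "smooth_atlas A"
  shows "chart_at A p \<in> A" "p \<in> fst (chart_at A p)"
proof -
  have "\<exists>c. c \<in> A \<and> p \<in> fst c" using assms unfolding smooth_atlas_def by blast
  from someI_ex[OF this] show "chart_at A p \<in> A" "p \<in> fst (chart_at A p)" by (simp_all add: chart_at_def)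
qed

lemma tangent_norm_scale:
  assumes "bilinear (g p)"
  shows "tangent_norm g p (k *\<^sub>R u) = \<bar>k\<bar> * tangent_norm g p u"
  using assms by (simp add: tangent_norm_def bilinear_lmul bilinear_rmul real_sqrt_mult flip: mult.assoc)

lemma tangent_norm_nonneg:
  assumes "riemannian_manifold A g"
  shows "0 \<le> tangent_norm g p u"
proof -
  have "bilinear (g p)" "u \<noteq> 0 \<longrightarrow> 0 < g p u u" using assms by (auto simp: riemannian_manifold_def)
  then have "0 \<le> g p u u" by (cases "u = 0") (auto simp: bilinear_lzero)
  then show ?thesis by (simp add: tangent_norm_def)
qed

lemma riem_dist_le_curve_length:
  assumes "riemannian_manifold A g" "C1_curve A \<gamma>" "\<gamma> ` {0..1} \<subseteq> S" "\<gamma> 0 = p" "\<gamma> 1 = q"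
  shows "riem_dist A g S p q \<le> curve_length A g \<gamma>"
  unfolding riem_dist_def
proof (rule cInf_lower)
  have "0 \<le> curve_length A g \<gamma>" for \<gamma>
  proof (cases "(\<lambda>t. tangent_norm g (\<gamma> t) (velocity A \<gamma> t)) integrable_on {0..1}")
    case True
    then show ?thesis unfolding curve_length_def
      by (rule Henstock_Kurzweil_Integration.integral_nonneg) (rule tangent_norm_nonneg[OF assms(1)])
  qed (simp add: curve_length_def not_integrable_integral)
  then show "bdd_below {curve_length A g \<gamma> | \<gamma>. C1_curve A \<gamma> \<and> \<gamma> ` {0..1} \<subseteq> S \<and> \<gamma> 0 = p \<and> \<gamma> 1 = q}"
    by (intro bdd_belowI[of _ 0]) auto
qed (use assms in auto)

text \<open>Provides the Lipschitz curve required by \<open>flow_compatible\<close>: the piece of a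
  constant speed geodesic between two times, affinely reparametrised, is an admissible curve of
  length \<open>c * \<bar>s - t\<bar>\<close>.\<close>

lemma geodesic_segment_dist:
  assumes rm: "riemannian_manifold A g" and geo: "geodesic A g \<gamma>" and S: "\<gamma> ` {0..1} \<subseteq> S"
    and speed: "\<And>r. r \<in> {0..1} \<Longrightarrow> tangent_norm g (\<gamma> r) (velocity A \<gamma> r) = c"
    and s: "s \<in> {0..1}" and t: "t \<in> {0..1}"
  shows "riem_dist A g S (\<gamma> s) (\<gamma> t) \<le> c * \<bar>s - t\<bar>"
proof -
  have atl: "smooth_atlas A" using rm by (simp add: riemannian_manifold_def)
  \<comment> \<open>Affine, so both orders of \<open>s\<close> and \<open>t\<close>, and also
    \<open>s = t\<close>, are covered at once.\<close>
  define h where "h \<tau> = s + \<tau> * (t - s)" for \<tau> :: real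
  define \<sigma> where "\<sigma> \<tau> = \<gamma> (h \<tau>)" for \<tau>
  have h01: "h \<tau> \<in> {0..1}" if "\<tau> \<in> {0..1}" for \<tau>
  proof -
    have "h \<tau> = (1 - \<tau>) * s + \<tau> * t" by (simp add: h_def algebra_simps)
    moreover have "(1 - \<tau>) * s + \<tau> * t \<le> (1 - \<tau>) * 1 + \<tau> * 1"
      using s t that by (intro add_mono mult_left_mono) auto
    ultimately show ?thesis using s t that by auto
  qed
  have him: "h ` {0..1} \<subseteq> {0..1}" using h01 by blast
  have hc: "continuous_on X h" for X unfolding h_def by (intro continuous_intros)
  have vel: "((snd c \<circ> \<sigma>) has_vector_derivative (t - s) *\<^sub>R chart_velocity c \<gamma> (h \<tau>)) (at \<tau> within {0..1})"
    if c: "c \<in> A" "\<tau> \<in> {0..1}" "\<sigma> \<tau> \<in> fst c" for c \<tau>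
  proof -
    have "(snd c \<circ> \<gamma>) differentiable (at (h \<tau>) within {0..1})"
      using geo c h01[OF c(2)] by (auto simp: geodesic_def \<sigma>_def)
    then have "((snd c \<circ> \<gamma>) has_vector_derivative chart_velocity c \<gamma> (h \<tau>)) (at (h \<tau>) within {0..1})"
      by (simp add: chart_velocity_def vector_derivative_works)
    then have "((snd c \<circ> \<gamma>) has_vector_derivative chart_velocity c \<gamma> (h \<tau>)) (at (h \<tau>) within h ` {0..1})"
      by (rule has_vector_derivative_within_subset[OF _ him])
    moreover have "(h has_vector_derivative (t - s)) (at \<tau> within {0..1})"
      unfolding h_def by (auto intro!: derivative_eq_intros simp: has_real_derivative_iff_has_vector_derivative[symmetric])
    ultimately have "((snd c \<circ> \<gamma>) \<circ> h has_vector_derivative (t - s) *\<^sub>R chart_velocity c \<gamma> (h \<tau>)) (at \<tau> within {0..1})"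
      by (intro vector_diff_chain_within)
    moreover have "(snd c \<circ> \<gamma>) \<circ> h = snd c \<circ> \<sigma>" by (auto simp: \<sigma>_def)
    ultimately show ?thesis by simp
  qed
  have cv: "chart_velocity c \<sigma> \<tau> = (t - s) *\<^sub>R chart_velocity c \<gamma> (h \<tau>)"
    if c: "c \<in> A" "\<tau> \<in> {0..1}" "\<sigma> \<tau> \<in> fst c" for c \<tau>
    using vector_derivative_within_cbox[OF _ _ vel[OF c, folded box_real(2)]] c(2)
    by (simp add: chart_velocity_def)
  have "C1_curve A \<sigma>" unfolding C1_curve_def
  proof (intro conjI ballI impI)
    show "continuous_on {0..1} \<sigma>" unfolding \<sigma>_def
      using geo h01 by (intro continuous_on_compose2[OF _ hc]) (auto simp: geodesic_def)
    fix c assume c: "c \<in> A"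
    show "(snd c \<circ> \<sigma>) differentiable (at \<tau> within {0..1})" if "\<tau> \<in> {0..1}" "\<sigma> \<tau> \<in> fst c" for \<tau>
      using vel[OF c that] by (rule differentiableI_vector)
    have "continuous_on {r\<in>{0..1}. \<gamma> r \<in> fst c} (chart_velocity c \<gamma>)"
      unfolding continuous_on_eq_continuous_within
    proof
      fix r assume r: "r \<in> {r\<in>{0..1}. \<gamma> r \<in> fst c}"
      then obtain a where "(chart_velocity c \<gamma> has_vector_derivative a) (at r within {0..1})"
        using geo c unfolding geodesic_def by blast
      then have "continuous (at r within {0..1}) (chart_velocity c \<gamma>)" by (rule has_vector_derivative_continuous)
      then show "continuous (at r within {r\<in>{0..1}. \<gamma> r \<in> fst c}) (chart_velocity c \<gamma>)"
        by (rule continuous_within_subset) auto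
    qed
    then have "continuous_on {\<tau>\<in>{0..1}. \<sigma> \<tau> \<in> fst c} (\<lambda>\<tau>. chart_velocity c \<gamma> (h \<tau>))"
      by (rule continuous_on_compose2[OF _ hc]) (use h01 in \<open>auto simp: \<sigma>_def\<close>)
    then have "continuous_on {\<tau>\<in>{0..1}. \<sigma> \<tau> \<in> fst c} (\<lambda>\<tau>. (t - s) *\<^sub>R chart_velocity c \<gamma> (h \<tau>))"
      by (intro continuous_intros)
    then show "continuous_on {\<tau>\<in>{0..1}. \<sigma> \<tau> \<in> fst c} (chart_velocity c \<sigma>)"
      using cv[OF c] by (subst continuous_on_cong[OF refl]) auto
  qed
  moreover have "\<sigma> ` {0..1} \<subseteq> S" using S h01 by (auto simp: \<sigma>_def)
  moreover have "\<sigma> 0 = \<gamma> s" "\<sigma> 1 = \<gamma> t" by (simp_all add: \<sigma>_def h_def)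
  ultimately have "riem_dist A g S (\<gamma> s) (\<gamma> t) \<le> curve_length A g \<sigma>" by (rule riem_dist_le_curve_length[OF rm])
  also have "curve_length A g \<sigma> = integral {0..1} (\<lambda>\<tau>::real. \<bar>t - s\<bar> * c)" unfolding curve_length_def
  proof (rule Henstock_Kurzweil_Integration.integral_cong)
    fix \<tau> :: real assume \<tau>: "\<tau> \<in> {0..1}"
    have "velocity A \<sigma> \<tau> = (t - s) *\<^sub>R velocity A \<gamma> (h \<tau>)"
      unfolding velocity_def using cv[OF chart_at_props(1)[OF atl] \<tau> chart_at_props(2)[OF atl]] by (simp add: \<sigma>_def)
    moreover have "bilinear (g (\<sigma> \<tau>))" using rm by (simp add: riemannian_manifold_def)
    ultimately show "tangent_norm g (\<sigma> \<tau>) (velocity A \<sigma> \<tau>) = \<bar>t - s\<bar> * c"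
      using speed[OF h01[OF \<tau>]] by (simp add: tangent_norm_scale) (simp add: \<sigma>_def)
  qed
  also have "\<dots> = c * \<bar>s - t\<bar>" by (simp add: abs_minus_commute)
  finally show ?thesis .
qed

lemma parameter_manifold_geodesic:
  assumes "parameter_manifold A g S D" "(p, u) \<in> D" and \<gamma>_def: "\<gamma> = (\<lambda>t. riem_exp A g p (t *\<^sub>R u))"
  shows "p \<in> S" "geodesic A g \<gamma>" "\<gamma> 0 = p" "velocity A \<gamma> 0 = u" "\<And>t. t \<in> {0..1} \<Longrightarrow> \<gamma> t \<in> S"
    "\<And>t. t \<in> {0..1} \<Longrightarrow> tangent_norm g (\<gamma> t) (velocity A \<gamma> t) = tangent_norm g p u"
    "tangent_norm g p u = riem_dist A g S p (\<gamma> 1)"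
proof -
  have "p \<in> S \<and> geodesic_from A g p u \<gamma> \<and>
    (\<forall>t\<in>{0..1}. \<gamma> t \<in> S \<and> tangent_norm g (\<gamma> t) (velocity A \<gamma> t) = tangent_norm g p u) \<and>
    tangent_norm g p u = riem_dist A g S p (\<gamma> 1)"
    using assms(1,2) unfolding parameter_manifold_def Let_def \<gamma>_def by fastforce
  then show "p \<in> S" "geodesic A g \<gamma>" "\<gamma> 0 = p" "velocity A \<gamma> 0 = u" "\<And>t. t \<in> {0..1} \<Longrightarrow> \<gamma> t \<in> S"
    "\<And>t. t \<in> {0..1} \<Longrightarrow> tangent_norm g (\<gamma> t) (velocity A \<gamma> t) = tangent_norm g p u"
    "tangent_norm g p u = riem_dist A g S p (\<gamma> 1)"
    by (auto simp: geodesic_from_def)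
qed

lemma prob_on_AE:
  assumes "\<mu> \<in> prob_on \<Omega>" "compact \<Omega>"
  shows "prob_space \<mu>" "sets \<mu> = sets borel" "AE x in \<mu>. x \<in> \<Omega>"
proof -
  show P: "prob_space \<mu>" and b: "sets \<mu> = sets borel" using assms by (auto simp: prob_on_def)
  interpret prob_space \<mu> by fact
  have "\<Omega> \<in> sets \<mu>" using b borel_closed[OF compact_imp_closed[OF assms(2)]] by simp
  then show "AE x in \<mu>. x \<in> \<Omega>"
    using assms by (intro AE_in_set_eq_1[THEN iffD2]) (auto simp: prob_on_def measure_def)
qed

text \<open>Tested with the independent coupling. Together with the bi-Lipschitz bound this controls
  the length of every tangent vector in \<open>D\<close>.\<close>

lemma wasserstein_le_diameter:
  assumes \<mu>: "\<mu> \<in> prob_on \<Omega>" and \<nu>: "\<nu> \<in> prob_on \<Omega>" and \<Omega>: "compact \<Omega>"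
    and R: "\<And>x. x \<in> \<Omega> \<Longrightarrow> norm x \<le> R" "0 \<le> R"
  shows "wasserstein \<mu> \<nu> \<le> 2 * R"
proof -
  note M = prob_on_AE[OF \<mu> \<Omega>] and N = prob_on_AE[OF \<nu> \<Omega>]
  interpret M: prob_space \<mu> by (rule M(1))
  interpret N: prob_space \<nu> by (rule N(1))
  interpret pair_prob_space \<mu> \<nu> ..
  let ?\<pi> = "\<mu> \<Otimes>\<^sub>M \<nu>"
  have sb: "sets ?\<pi> = sets borel" using sets_pair_measure_cong[OF M(2) N(2)] unfolding borel_prod .
  have fst: "distr ?\<pi> borel fst = \<mu>"
  proof -
    have "distr ?\<pi> borel fst = distr ?\<pi> \<mu> fst" using M(2) by (intro distr_cong) auto
    then show ?thesis using N.distr_pair_fst by simp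
  qed
  have snd: "distr ?\<pi> borel snd = \<nu>"
  proof -
    have "distr ?\<pi> borel snd = distr ?\<pi> \<nu> snd" using N(2) by (intro distr_cong) auto
    moreover have "distr ?\<pi> \<nu> snd = \<nu>"
    proof (rule measure_eqI)
      fix X assume "X \<in> sets (distr ?\<pi> \<nu> snd)"
      then have X: "X \<in> sets \<nu>" by simp
      have "emeasure (distr ?\<pi> \<nu> snd) X = emeasure ?\<pi> (space \<mu> \<times> X)"
        using X sets.sets_into_space[OF X] by (subst emeasure_distr) (auto intro!: arg_cong2[of _ _ _ _ emeasure] simp: space_pair_measure)
      also have "\<dots> = emeasure \<nu> X" using X by (simp add: N.emeasure_pair_measure_Times M.emeasure_space_1)
      finally show "emeasure (distr ?\<pi> \<nu> snd) X = emeasure \<nu> X" .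
    qed simp
    ultimately show ?thesis by simp
  qed
  have "?\<pi> \<in> couplings \<mu> \<nu>" using sb fst snd by (simp add: couplings_def)
  then have "(INF \<pi>\<in>couplings \<mu> \<nu>. transport_cost \<pi>) \<le> transport_cost ?\<pi>" by (rule INF_lower)
  also have "transport_cost ?\<pi> \<le> (\<integral>\<^sup>+ z. ennreal ((2 * R)\<^sup>2) \<partial>?\<pi>)" unfolding transport_cost_def
  proof (rule nn_integral_mono_AE)
    have m: "fst \<in> ?\<pi> \<rightarrow>\<^sub>M borel" "snd \<in> ?\<pi> \<rightarrow>\<^sub>M borel"
      unfolding measurable_cong_sets[OF sb refl] by (auto intro!: borel_measurable_continuous_onI continuous_intros)
    have "AE z in ?\<pi>. fst z \<in> \<Omega>" by (rule AE_distrD[OF m(1)]) (unfold fst, rule M(3))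
    moreover have "AE z in ?\<pi>. snd z \<in> \<Omega>" by (rule AE_distrD[OF m(2)]) (unfold snd, rule N(3))
    ultimately show "AE z in ?\<pi>. ennreal ((norm (fst z - snd z))\<^sup>2) \<le> ennreal ((2 * R)\<^sup>2)"
    proof eventually_elim
      case (elim z)
      have "norm (fst z - snd z) \<le> 2 * R" using norm_triangle_ineq4[of "fst z" "snd z"] R(1)[OF elim(1)] R(1)[OF elim(2)] by linarith
      then show ?case by (intro ennreal_leI power_mono) auto
    qed
  qed
  also have "\<dots> = ennreal ((2 * R)\<^sup>2)" by (simp add: emeasure_space_1)
  finally have "enn2real (INF \<pi>\<in>couplings \<mu> \<nu>. transport_cost \<pi>) \<le> (2 * R)\<^sup>2"
    by (intro enn2real_leI) auto
  then show ?thesis unfolding wasserstein_def using R(2) by (intro real_le_lsqrt) auto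
qed

lemma C1_norm_bounds:
  assumes "C1_norm f \<le> ennreal K" "0 \<le> K" "Ck_on 1 f UNIV"
  shows "norm (f x) \<le> K" "norm (f x - f y) \<le> K * norm (x - y)"
proof -
  have d: "f differentiable (at x)" for x using assms(3) by simp
  have "ennreal (norm (f x)) \<le> C1_norm f" for x unfolding C1_norm_def by (intro max.coboundedI1 SUP_upper) simp
  from order_trans[OF this assms(1)] show "norm (f x) \<le> K" using assms(2) by (simp add: ennreal_le_iff)
  have "ennreal (onorm (frechet_derivative f (at x))) \<le> C1_norm f" for x
    unfolding C1_norm_def by (intro max.coboundedI2 SUP_upper) simp
  from order_trans[OF this assms(1)] have on: "onorm (frechet_derivative f (at x)) \<le> K" for x
    using assms(2) by (simp add: ennreal_le_iff)
  show "norm (f x - f y) \<le> K * norm (x - y)"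
  proof (rule differentiable_bound[where f' = "\<lambda>x. frechet_derivative f (at x)", OF convex_UNIV _ on])
    show "(f has_derivative frechet_derivative f (at x)) (at x)" for x
      using d[of x] by (simp add: frechet_derivative_works)
  qed auto
qed

lemma vector_derivative_lipschitz:
  fixes f :: "real \<Rightarrow> 'a::real_normed_vector"
  assumes "\<And>s. s \<in> {0..b} \<Longrightarrow> \<exists>a. (f has_vector_derivative a) (at s within {0..b}) \<and> norm a \<le> K"
    and "s \<in> {0..b}" "t \<in> {0..b}"
  shows "norm (f s - f t) \<le> K * \<bar>s - t\<bar>"
proof -
  obtain a where a: "\<And>s. s \<in> {0..b} \<Longrightarrow> (f has_vector_derivative a s) (at s within {0..b})"
    "\<And>s. s \<in> {0..b} \<Longrightarrow> norm (a s) \<le> K" using assms(1) by metis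
  have "norm (f s - f t) \<le> K * norm (s - t)"
  proof (rule differentiable_bound[OF convex_real_interval(5)])
    show "(f has_derivative (\<lambda>h. h *\<^sub>R a s)) (at s within {0..b})" if "s \<in> {0..b}" for s
      using a(1)[OF that] by (simp add: has_vector_derivative_def)
    show "onorm (\<lambda>h. h *\<^sub>R a s) \<le> K" if "s \<in> {0..b}" for s
      using a(2)[OF that] order_trans[OF norm_ge_zero a(2)[OF that]]
      by (intro onorm_bound) (auto simp: mult.commute[of K] intro: mult_left_mono)
  qed fact+
  then show ?thesis by simp
qed

text \<open>Only continuity of \<open>B (\<gamma> s) (velocity A \<gamma> s)\<close> in space is available for \<open>s > 0\<close>, because the
  \<open>C\<^sup>1\<close> bound is assumed on \<open>D\<close> alone. Hence the flow is obtained from Peano's theorem; it need not be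
  unique, but every solution pushes the measures forward correctly.\<close>

lemma flow_expansion:
  fixes A :: "('p::{t2_space, second_countable_topology}, 'e::euclidean_space) chart set"
    and B :: "'p \<Rightarrow> 'e \<Rightarrow> 'd::euclidean_space \<Rightarrow> 'd"
  assumes pm: "parameter_manifold A g S D" and fc: "flow_compatible A g S \<Omega> E B"
    and B: "\<And>p u. p \<in> S \<Longrightarrow> Ck_on 1 (B p u) UNIV" and D: "(\<theta>, \<eta>) \<in> D"
    and C0: "0 \<le> C\<^sub>0" and c: "c = tangent_norm g \<theta> \<eta>"
    and C1: "C1_norm (B \<theta> \<eta>) \<le> ennreal (C\<^sub>0 * c)"
    and Bt: "\<And>x s. s \<in> {0..1} \<Longrightarrow> \<exists>a. ((\<lambda>s. B (riem_exp A g \<theta> (s *\<^sub>R \<eta>)) (velocity A (\<lambda>t. riem_exp A g \<theta> (t *\<^sub>R \<eta>)) s) x)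
        has_vector_derivative a) (at s within {0..1}) \<and> norm a \<le> C\<^sub>0 * c\<^sup>2"
  defines "K \<equiv> C\<^sub>0 * c\<^sup>2 + C\<^sub>0 * c * (C\<^sub>0 * c + C\<^sub>0 * c\<^sup>2)"
  obtains \<phi> where "\<And>t. t \<in> {0..1} \<Longrightarrow> E (riem_exp A g \<theta> (t *\<^sub>R \<eta>)) = distr (restrict_space (E \<theta>) \<Omega>) borel (\<phi> t)"
    "\<And>t x. t \<in> {0..1} \<Longrightarrow> norm (\<phi> t x - x - t *\<^sub>R B \<theta> \<eta> x) \<le> K * t\<^sup>2"
proof -
  define \<gamma> where "\<gamma> = (\<lambda>t. riem_exp A g \<theta> (t *\<^sub>R \<eta>))"
  define u where "u s x = B (\<gamma> s) (velocity A \<gamma> s) x" for s x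
  note geo = parameter_manifold_geodesic[OF pm D \<gamma>_def]
  have rm: "riemannian_manifold A g" using pm by (simp add: parameter_manifold_def)
  have atl: "smooth_atlas A" using rm by (simp add: riemannian_manifold_def)
  have c0: "0 \<le> c" unfolding c by (rule tangent_norm_nonneg[OF rm])
  have u0: "u 0 = B \<theta> \<eta>" using geo(3,4) by (simp add: u_def[abs_def])
  note b0 = C1_norm_bounds[OF C1 mult_nonneg_nonneg[OF C0 c0] B[OF geo(1)], folded u0]
  have ut: "norm (u s x - u s' x) \<le> C\<^sub>0 * c\<^sup>2 * \<bar>s - s'\<bar>" if "s \<in> {0..1}" "s' \<in> {0..1}" for s s' x
    by (rule vector_derivative_lipschitz[OF _ that]) (use Bt in \<open>auto simp: u_def \<gamma>_def\<close>)
  define M where "M = C\<^sub>0 * c + C\<^sub>0 * c\<^sup>2"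
  have uM: "norm (u s x) \<le> M" if s: "s \<in> {0..1}" for s x
  proof -
    have "norm (u s x) \<le> norm (u 0 x) + norm (u s x - u 0 x)" by (rule norm_triangle_sub)
    also have "\<dots> \<le> C\<^sub>0 * c + C\<^sub>0 * c\<^sup>2 * \<bar>s - 0\<bar>" using s by (intro add_mono b0 ut) auto
    also have "\<dots> \<le> C\<^sub>0 * c + C\<^sub>0 * c\<^sup>2 * 1" using s C0 by (intro add_left_mono mult_left_mono) auto
    finally show ?thesis by (simp add: M_def)
  qed
  have M0: "0 \<le> M" using C0 c0 by (simp add: M_def)
  \<comment> \<open>Joint continuity from two separate facts: Lipschitz continuity in time with a
    constant independent of \<open>x\<close>, and continuity in \<open>x\<close> at the fixed time
    \<open>s\<close>.\<close>
  have uc: "continuous_on ({0..1} \<times> UNIV) (\<lambda>(s, x). u s x)" unfolding continuous_on_def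
  proof clarify
    fix s x assume s: "s \<in> {0..1::real}"
    have "isCont (u s) x" using B[OF geo(5)[OF s], of "velocity A \<gamma> s"]
      by (auto simp: u_def[abs_def] differentiable_imp_continuous_within)
    then have lim: "((\<lambda>p. u s (snd p)) \<longlongrightarrow> u s x) (at (s, x) within {0..1} \<times> UNIV)"
      by (rule isCont_tendsto_compose) (use tendsto_snd[OF tendsto_ident_at, of "(s, x)"] in simp)
    have "((\<lambda>p. u (fst p) (snd p) - u s (snd p)) \<longlongrightarrow> 0) (at (s, x) within {0..1} \<times> UNIV)"
    proof (rule Lim_null_comparison)
      show "\<forall>\<^sub>F p in at (s, x) within {0..1} \<times> UNIV. norm (u (fst p) (snd p) - u s (snd p)) \<le> C\<^sub>0 * c\<^sup>2 * \<bar>fst p - s\<bar>"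
        unfolding eventually_at_filter using ut s by (auto intro!: always_eventually)
      have "((\<lambda>p. C\<^sub>0 * c\<^sup>2 * \<bar>fst p - s\<bar>) \<longlongrightarrow> C\<^sub>0 * c\<^sup>2 * \<bar>fst (s, x) - s\<bar>) (at (s, x) within {0..1} \<times> UNIV)"
        by (intro tendsto_intros)
      then show "((\<lambda>p. C\<^sub>0 * c\<^sup>2 * \<bar>fst p - s\<bar>) \<longlongrightarrow> 0) (at (s, x) within {0..1} \<times> UNIV)" by simp
    qed
    from tendsto_add[OF this lim] show "((\<lambda>(s, x). u s x) \<longlongrightarrow> u s x) (at (s, x) within {0..1} \<times> UNIV)"
      by (simp add: case_prod_unfold)
  qed
  have "\<exists>Y. Y 0 = x \<and> (\<forall>t\<in>{0..1}. (Y has_vector_derivative u t (Y t)) (at t within {0..1})) \<and>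
    (\<forall>s\<in>{0..1}. \<forall>t\<in>{0..1}. norm (Y t - Y s) \<le> M * \<bar>t - s\<bar>)" for x
    using peano_existence[OF uc uM, of x] by metis
  then obtain Y where Y: "\<And>x. Y x 0 = x"
    "\<And>x t. t \<in> {0..1} \<Longrightarrow> (Y x has_vector_derivative u t (Y x t)) (at t within {0..1})"
    "\<And>x s t. s \<in> {0..1} \<Longrightarrow> t \<in> {0..1} \<Longrightarrow> norm (Y x t - Y x s) \<le> M * \<bar>t - s\<bar>" by metis
  have ac: "abs_continuous_on_01 (Y x)" for x unfolding abs_continuous_on_01_def
  proof (intro allI impI)
    fix \<epsilon> :: real assume e: "0 < \<epsilon>"
    show "\<exists>\<delta>>0. \<forall>n::nat. \<forall>a b. (\<forall>i<n. 0 \<le> a i \<and> a i \<le> b i \<and> b i \<le> 1) \<and>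
      disjoint_family_on (\<lambda>i. {a i<..<b i}) {..<n} \<and> (\<Sum>i<n. b i - a i) < \<delta> \<longrightarrow>
      (\<Sum>i<n. norm (Y x (b i) - Y x (a i))) < \<epsilon>"
    \<comment> \<open>\<open>M + 1\<close> instead of \<open>M\<close> avoids dividing by zero when
      the field vanishes.\<close>
    proof (intro exI[of _ "\<epsilon> / (M + 1)"] conjI allI impI)
      show "0 < \<epsilon> / (M + 1)" using e M0 by simp
      fix n :: nat and a b :: "nat \<Rightarrow> real"
      assume ab: "(\<forall>i<n. 0 \<le> a i \<and> a i \<le> b i \<and> b i \<le> 1) \<and>
        disjoint_family_on (\<lambda>i. {a i<..<b i}) {..<n} \<and> (\<Sum>i<n. b i - a i) < \<epsilon> / (M + 1)"
      have "(\<Sum>i<n. norm (Y x (b i) - Y x (a i))) \<le> (\<Sum>i<n. (M + 1) * (b i - a i))"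
      proof (rule sum_mono)
        fix i assume "i \<in> {..<n}"
        then have i: "0 \<le> a i" "a i \<le> b i" "b i \<le> 1" using ab by auto
        have "norm (Y x (b i) - Y x (a i)) \<le> M * \<bar>b i - a i\<bar>" using i by (intro Y(3)) auto
        also have "\<dots> \<le> (M + 1) * (b i - a i)" using i by (simp add: mult_right_mono)
        finally show "norm (Y x (b i) - Y x (a i)) \<le> (M + 1) * (b i - a i)" .
      qed
      also have "\<dots> = (M + 1) * (\<Sum>i<n. b i - a i)" by (simp add: sum_distrib_left)
      also have "\<dots> < \<epsilon>" using ab M0 by (simp add: field_simps)
      finally show "(\<Sum>i<n. norm (Y x (b i) - Y x (a i))) < \<epsilon>" .
    qed
  qed
  have "flow_along A \<Omega> B \<gamma> (\<lambda>t x. Y x t)" unfolding flow_along_def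
  proof (intro conjI ballI AE_I2 impI)
    show "Y x 0 = x" for x by (rule Y)
    show "abs_continuous_on_01 (\<lambda>t. Y x t)" for x by (rule ac)
    show "curve_differentiable A \<gamma> t" if "t \<in> {0..1}" for t
      using geo(2) that chart_at_props[OF atl, of "\<gamma> t"] unfolding curve_differentiable_def geodesic_def by blast
    show "((\<lambda>s. Y x s) has_vector_derivative B (\<gamma> t) (velocity A \<gamma> t) (Y x t)) (at t within {0..1})" if "t \<in> {0..1}" for t x
      using Y(2)[OF that, of x] by (simp add: u_def)
  qed
  moreover have "\<gamma> ` {0..1} \<subseteq> S" using geo(5) by auto
  moreover have "\<exists>L. \<forall>s\<in>{0..1}. \<forall>t\<in>{0..1}. riem_dist A g S (\<gamma> s) (\<gamma> t) \<le> L * \<bar>s - t\<bar>"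
    using geodesic_segment_dist[OF rm geo(2) \<open>\<gamma> ` {0..1} \<subseteq> S\<close> geo(6)] by blast
  ultimately have E: "E (\<gamma> t) = distr (restrict_space (E (\<gamma> 0)) \<Omega>) borel (\<lambda>x. Y x t)" if "t \<in> {0..1}" for t
    using fc that unfolding flow_compatible_def by blast
  show ?thesis
  proof (rule that[of "\<lambda>t x. Y x t"])
    fix t :: real assume t: "t \<in> {0..1}"
    show "E (riem_exp A g \<theta> (t *\<^sub>R \<eta>)) = distr (restrict_space (E \<theta>) \<Omega>) borel (\<lambda>x. Y x t)"
      using E[OF t] geo(3) by (simp add: \<gamma>_def)
    fix x
    \<comment> \<open>The derivative of \<open>Y x s - s *\<^sub>R u 0 x\<close> is
      \<open>u s (Y x s) - u 0 x\<close>. Changing the time costs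
      \<open>C\<^sub>0 * c\<^sup>2 * t\<close>, changing the position costs
      \<open>C\<^sub>0 * c * (M * t)\<close>; the sum is \<open>K * t\<close>, and integrating over
      \<open>[0,t]\<close> gives the second power.\<close>
    have "norm ((Y x t - t *\<^sub>R u 0 x) - (Y x 0 - 0 *\<^sub>R u 0 x)) \<le> (K * t) * \<bar>t - 0\<bar>"
    proof (rule vector_derivative_lipschitz[where b = t])
      fix s assume s: "s \<in> {0..t}"
      then have s1: "s \<in> {0..1}" using t by auto
      have "((\<lambda>s. Y x s - s *\<^sub>R u 0 x) has_vector_derivative u s (Y x s) - 1 *\<^sub>R u 0 x) (at s within {0..1})"
        by (intro has_vector_derivative_diff Y(2)[OF s1] has_vector_derivative_scaleR) 
           (auto intro!: derivative_eq_intros)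
      then have "((\<lambda>s. Y x s - s *\<^sub>R u 0 x) has_vector_derivative u s (Y x s) - u 0 x) (at s within {0..t})"
        using t by (auto elim!: has_vector_derivative_within_subset)
      moreover have "norm (u s (Y x s) - u 0 x) \<le> K * t"
      proof -
        have "norm (u s (Y x s) - u 0 x) \<le> norm (u s (Y x s) - u 0 (Y x s)) + norm (u 0 (Y x s) - u 0 x)"
          using norm_triangle_ineq[of "u s (Y x s) - u 0 (Y x s)" "u 0 (Y x s) - u 0 x"] by simp
        also have "norm (u s (Y x s) - u 0 (Y x s)) \<le> C\<^sub>0 * c\<^sup>2 * t"
        proof -
          have "norm (u s (Y x s) - u 0 (Y x s)) \<le> C\<^sub>0 * c\<^sup>2 * \<bar>s - 0\<bar>" by (rule ut[OF s1]) simp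
          also have "\<dots> \<le> C\<^sub>0 * c\<^sup>2 * t" using s C0 by (intro mult_left_mono) auto
          finally show ?thesis .
        qed
        also have "norm (u 0 (Y x s) - u 0 x) \<le> C\<^sub>0 * c * (M * t)"
        proof -
          have "norm (Y x s - x) \<le> M * \<bar>s - 0\<bar>" using Y(3)[of 0 s x] s1 Y(1)[of x] by simp
          also have "\<dots> \<le> M * t" using s M0 by (intro mult_left_mono) auto
          finally show ?thesis using order_trans[OF b0(2)] C0 c0 by (meson mult_left_mono mult_nonneg_nonneg)
        qed
        finally show ?thesis by (simp add: K_def M_def algebra_simps)
      qed
      ultimately show "\<exists>a. ((\<lambda>s. Y x s - s *\<^sub>R u 0 x) has_vector_derivative a) (at s within {0..t}) \<and> norm a \<le> K * t" by blast
    qed (use t in auto)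
    then show "norm (Y x t - x - t *\<^sub>R B \<theta> \<eta> x) \<le> K * t\<^sup>2"
      using t Y(1)[of x] by (simp add: u0[symmetric] power2_eq_square algebra_simps)
  qed
qed

section \<open>Perturbation of the spectrum\<close>

lemma continuous_in_L2:
  fixes f :: "'d::euclidean_space \<Rightarrow> 'd"
  assumes "\<mu> \<in> prob_on \<Omega>" "compact \<Omega>" "continuous_on UNIV f"
  shows "f \<in> L2 \<mu>"
proof -
  note M = prob_on_AE[OF assms(1,2)]
  have "f \<in> borel_measurable \<mu>" using borel_measurable_continuous_onI[OF assms(3)] M(2) by (simp cong: measurable_cong_sets)
  moreover have "continuous_on UNIV (\<lambda>p::'d \<times> 'd. (norm (f (fst p)))\<^sup>2)"
    by (intro continuous_intros continuous_on_compose2[OF assms(3)]) auto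
  then have "integrable \<mu> (\<lambda>x. (norm (f x))\<^sup>2)"
    using integrable_continuous_pair[OF M(1,2) assms(2) M(3) _ M(3), of "\<lambda>p. (norm (f (fst p)))\<^sup>2"] by simp
  ultimately show ?thesis by (simp add: L2_def)
qed

lemma optimal_map_AE:
  assumes "optimal_map \<mu> \<nu> T" "\<mu> \<in> prob_on \<Omega>" "\<nu> \<in> prob_on \<Omega>" "compact \<Omega>"
  shows "AE x in \<mu>. T x \<in> \<Omega>"
proof -
  note M = prob_on_AE[OF assms(2,4)] and N = prob_on_AE[OF assms(3,4)]
  have T: "T \<in> \<mu> \<rightarrow>\<^sub>M borel" using optimal_map_push(2)[OF assms(1) M(2)] M(2) by (simp cong: measurable_cong_sets)
  show ?thesis by (rule AE_distrD[OF T]) (unfold optimal_map_push(1)[OF assms(1) M(2)], rule N(3))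
qed

lemma displacement_in_L2:
  assumes "optimal_map \<mu> \<nu> T" "\<mu> \<in> prob_on \<Omega>" "\<nu> \<in> prob_on \<Omega>" "compact \<Omega>"
  shows "(\<lambda>x. c *\<^sub>R (T x - x)) \<in> L2 \<mu>"
proof (rule L2_scale)
  note M = prob_on_AE[OF assms(2,4)]
  have T: "T \<in> borel_measurable borel" by (rule optimal_map_push(2)[OF assms(1) M(2)])
  have "(\<lambda>x. T x - x) \<in> borel_measurable borel" using T by measurable
  then have "(\<lambda>x. T x - x) \<in> borel_measurable \<mu>" using M(2) by (simp cong: measurable_cong_sets)
  moreover have "integrable \<mu> (\<lambda>x. (norm (T x - x))\<^sup>2)"
    by (rule integrable_continuous_pair[OF M(1,2) assms(4) M(3) T optimal_map_AE[OF assms],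
          of "\<lambda>p. (norm (snd p - fst p))\<^sup>2", simplified]) (intro continuous_intros)
  ultimately show "(\<lambda>x. T x - x) \<in> L2 \<mu>" by (simp add: L2_def)
qed

text \<open>Both \<open>T\<close> and the flow map \<open>\<phi>\<close> push \<open>\<mu>\<close> to \<open>\<nu>\<close>, and \<open>\<phi>\<close> is second-order close to the optimal map
  \<open>x + t v x\<close>; stability transfers this to \<open>T\<close>.\<close>

lemma displacement_estimate:
  fixes v T \<phi> :: "'d::euclidean_space \<Rightarrow> 'd"
  assumes \<mu>: "\<mu> \<in> prob_on \<Omega>" and \<nu>: "\<nu> \<in> prob_on \<Omega>" and \<Omega>: "compact \<Omega>"
    and opt: "optimal_map \<mu> \<nu> T" and push: "\<nu> = distr (restrict_space \<mu> \<Omega>) borel \<phi>"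
    and \<phi>: "\<And>x. norm (\<phi> x - x - t *\<^sub>R v x) \<le> K * t\<^sup>2"
    and g: "\<And>x. gderiv \<psi> x (v x)" and L: "\<And>x y. norm (v x - v y) \<le> L * norm (x - y)" "0 \<le> L"
    and t: "0 < t" "t * L \<le> 1 / 4" and K: "0 \<le> K"
  shows "L2_norm \<mu> (\<lambda>x. (1 / t) *\<^sub>R (T x - x) - v x) \<le> 2 * K * t"
proof -
  note M = prob_on_AE[OF \<mu> \<Omega>] and N = prob_on_AE[OF \<nu> \<Omega>]
  interpret prob_space \<mu> by (rule M(1))
  have \<Omega>b: "\<Omega> \<in> sets borel" by (rule borel_closed[OF compact_imp_closed[OF \<Omega>]])
  define F where "F = (\<lambda>x. if x \<in> \<Omega> then \<phi> x else x)"
  note F = distr_restrict_space_extend[OF M(1,2) \<Omega>b M(3) N(1)[unfolded push], folded F_def push]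
  have T: "T \<in> borel_measurable borel" "distr \<mu> borel T = \<nu>"
    using optimal_map_push[OF opt M(2)] by auto
  have TA: "AE x in \<mu>. T x \<in> \<Omega>" by (rule optimal_map_AE[OF opt \<mu> \<nu> \<Omega>])
  have F': "F \<in> \<mu> \<rightarrow>\<^sub>M borel" using F(1) M(2) by (simp cong: measurable_cong_sets)
  have FA: "AE x in \<mu>. F x \<in> \<Omega>" by (rule AE_distrD[OF F']) (unfold F(2)[symmetric], rule N(3))
  have int: "integrable \<mu> (\<lambda>x. (norm (x - G x))\<^sup>2)"
    if "G \<in> borel_measurable borel" "AE x in \<mu>. G x \<in> \<Omega>" for G
    by (rule integrable_continuous_pair[OF M(1,2) \<Omega> M(3) that, of "\<lambda>p. (norm (fst p - snd p))\<^sup>2", simplified])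
      (intro continuous_intros)
  have "(LINT x|\<mu>. (norm (T x - x - t *\<^sub>R v x))\<^sup>2) \<le> 4 * (LINT x|\<mu>. (norm (F x - x - t *\<^sub>R v x))\<^sup>2)"
  proof (rule transport_stability[OF M(1,2) \<Omega> M(3) T(1) TA F(1) FA _ _ g L])
    show "distr \<mu> borel T = distr \<mu> borel F" using T F by simp
    show "(LINT x|\<mu>. (norm (x - T x))\<^sup>2) \<le> (LINT x|\<mu>. (norm (x - F x))\<^sup>2)"
      by (rule optimal_map_cost_le[OF opt M(2) F(1) F(2)[symmetric] int[OF T(1) TA] int[OF F(1) FA]])
  qed (use t in auto)
  also have "(LINT x|\<mu>. (norm (F x - x - t *\<^sub>R v x))\<^sup>2) \<le> (LINT x|\<mu>. (K * t\<^sup>2)\<^sup>2)"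
  proof (rule integral_mono_AE')
    show "integrable \<mu> (\<lambda>x. (K * t\<^sup>2)\<^sup>2)" by simp
    show "AE x in \<mu>. (norm (F x - x - t *\<^sub>R v x))\<^sup>2 \<le> (K * t\<^sup>2)\<^sup>2"
      using M(3) by eventually_elim (auto simp: F_def intro!: power_mono \<phi>)
  qed auto
  finally have main: "(LINT x|\<mu>. (norm (T x - x - t *\<^sub>R v x))\<^sup>2) \<le> 4 * (K * t\<^sup>2)\<^sup>2" by (simp add: prob_space)
  have "L2_inner \<mu> (\<lambda>x. (1 / t) *\<^sub>R (T x - x) - v x) (\<lambda>x. (1 / t) *\<^sub>R (T x - x) - v x)
    = (LINT x|\<mu>. (1 / t)\<^sup>2 * (norm (T x - x - t *\<^sub>R v x))\<^sup>2)"
    unfolding L2_inner_def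
  proof (rule Bochner_Integration.integral_cong[OF refl])
    fix x
    have "(1 / t) *\<^sub>R (T x - x) - v x = (1 / t) *\<^sub>R (T x - x - t *\<^sub>R v x)" using t by (simp add: algebra_simps)
    then show "((1 / t) *\<^sub>R (T x - x) - v x) \<bullet> ((1 / t) *\<^sub>R (T x - x) - v x) = (1 / t)\<^sup>2 * (norm (T x - x - t *\<^sub>R v x))\<^sup>2"
      by (simp only: power2_norm_eq_inner[symmetric] norm_scaleR power_mult_distrib power2_abs)
  qed
  \<comment> \<open>Division by \<open>t\<close> costs one order, and the factor 2 is the square
    root of the 4 in \<open>transport_stability\<close>.\<close>
  also have "\<dots> \<le> (1 / t)\<^sup>2 * (4 * (K * t\<^sup>2)\<^sup>2)" using main by (simp add: mult_left_mono)
  also have "\<dots> = (2 * K * t)\<^sup>2" using t by (simp add: power2_eq_square field_simps)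
  finally show ?thesis unfolding L2_norm_def using K t by (intro real_le_lsqrt) auto
qed

theorem theorem4p9:
  fixes A :: "('p::{t2_space, second_countable_topology}, 'e::euclidean_space) chart set"
    and g :: "'p \<Rightarrow> 'e \<Rightarrow> 'e \<Rightarrow> real"
    and S :: "'p set"
    and D :: "('p \<times> 'e) set"
    and \<Omega> :: "'d::euclidean_space set"
    and E :: "'p \<Rightarrow> 'd measure"
    and B :: "'p \<Rightarrow> 'e \<Rightarrow> 'd \<Rightarrow> 'd"
  assumes "compact \<Omega>" and "convex \<Omega>"
    and "parameter_manifold A g S D"
    and "bi_lipschitz_embedding \<Omega> S (riem_dist A g S) E"
    and "tangent_fields A g S D E B"
    and "flow_compatible A g S \<Omega> E B"
  shows "\<exists>C::real. 0 < C \<and>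
    (\<forall>\<theta>\<in>S. \<forall>N\<ge>1. \<forall>\<eta>::nat \<Rightarrow> 'e. (\<forall>i<N. (\<theta>, \<eta> i) \<in> D) \<longrightarrow>
      (let v = (\<lambda>i. B \<theta> (\<eta> i));
           FV = empirical_operator (E \<theta>) N v
       in \<exists>\<mu>. nonzero_eigenvalues (E \<theta>) FV \<mu> \<and>
          (let m = length \<mu> in
           L2_has_dim (E \<theta>) (L2_span (E \<theta>) N v) m \<and> m \<le> DIM('e) \<and>
           (\<forall>t\<in>{0<..1}. \<forall>T::nat \<Rightarrow> 'd \<Rightarrow> 'd.
              (\<forall>i<N. optimal_map (E \<theta>) (E (riem_exp A g \<theta> (t *\<^sub>R \<eta> i))) (T i)) \<longrightarrow>
              (let w = (\<lambda>i x. (1 / t) *\<^sub>R (T i x - x));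
                   FW = empirical_operator (E \<theta>) N w
               in \<exists>\<nu>. nonzero_eigenvalues (E \<theta>) FW \<nu> \<and> length \<nu> \<le> N \<and>
                  (t < 1 / C \<longrightarrow>
                    (\<forall>i<m. \<bar>\<mu> ! i - nth_default 0 \<nu> i\<bar> \<le> C * sqrt t) \<and>
                    (\<forall>i. m \<le> i \<and> i < length \<nu> \<longrightarrow> 0 \<le> \<nu> ! i \<and> \<nu> ! i \<le> C * sqrt t) \<and>
                    (m \<ge> 1 \<longrightarrow>
                      (let L = \<mu> ! (m - 1) - 2 * C * sqrt t in
                       L > 0 \<longrightarrow> nth_default 0 \<nu> (m - 1) - nth_default 0 \<nu> m \<ge> L) \<and>
                      (\<forall>e f. top_eigenvectors (E \<theta>) FV \<mu> m e \<and>
                             top_eigenvectors (E \<theta>) FW \<nu> m f \<longrightarrow>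
                        subspace_dist (E \<theta>) m (L2_span (E \<theta>) m f) (L2_span (E \<theta>) m e)
                          \<le> 2 * C * sqrt t / \<mu> ! (m - 1)))))))))"
proof -
  let "\<exists>C. _ C \<and> (\<forall>\<theta>\<in>S. \<forall>N\<ge>1. \<forall>\<eta>. _ \<theta> N \<eta> \<longrightarrow> ?Q C \<theta> N \<eta>)" = ?thesis
  note \<Omega> = assms(1) and pm = assms(3) and fc = assms(6)
  have rm: "riemannian_manifold A g" using pm by (simp add: parameter_manifold_def)
  have Eprob: "\<And>p. p \<in> S \<Longrightarrow> E p \<in> prob_on \<Omega>" using assms(4) by (auto simp: bi_lipschitz_embedding_def)
  obtain l where l: "0 < l" "\<And>p q. p \<in> S \<Longrightarrow> q \<in> S \<Longrightarrow> riem_dist A g S p q / l \<le> wasserstein (E p) (E q)"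
    using assms(4) unfolding bi_lipschitz_embedding_def by blast
  have Blin: "\<And>p x. p \<in> S \<Longrightarrow> linear (\<lambda>u. B p u x)" and BC1: "\<And>p u. p \<in> S \<Longrightarrow> Ck_on 1 (B p u) UNIV"
    and Bgrad: "\<And>p u. p \<in> S \<Longrightarrow> \<exists>\<psi>. \<forall>x. gderiv \<psi> x (B p u x)"
    using assms(5) by (auto simp: tangent_fields_def)
  obtain C0 where C0: "0 < C0" and
    BD: "\<And>p u. (p, u) \<in> D \<Longrightarrow> L2_norm (E p) (B p u) \<le> C0 * tangent_norm g p u"
      "\<And>p u. (p, u) \<in> D \<Longrightarrow> C1_norm (B p u) \<le> ennreal (C0 * tangent_norm g p u)"
      "\<And>p u x s. (p, u) \<in> D \<Longrightarrow> s \<in> {0..1} \<Longrightarrow> \<exists>a.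
         ((\<lambda>s. B (riem_exp A g p (s *\<^sub>R u)) (velocity A (\<lambda>t. riem_exp A g p (t *\<^sub>R u)) s) x)
            has_vector_derivative a) (at s within {0..1}) \<and> norm a \<le> C0 * (tangent_norm g p u)\<^sup>2"
    using assms(5) unfolding tangent_fields_def Let_def by blast
  obtain b where "\<forall>x\<in>\<Omega>. norm x \<le> b" using compact_imp_bounded[OF \<Omega>] bounded_iff by metis
  then have b: "\<And>x. x \<in> \<Omega> \<Longrightarrow> norm x \<le> max b 0" by fastforce
  \<comment> \<open>A tangent vector in \<open>D\<close> is as long as the distance it covers, which
    is at most \<open>l\<close> times the Wasserstein distance of the end points. The maximum with 0
    guards against a negative \<open>b\<close>.\<close>
  define R where "R = 2 * max b 0 * l"
  have R0: "0 \<le> R" using l by (simp add: R_def)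
  have cR: "tangent_norm g p u \<le> R" if D: "(p, u) \<in> D" for p u
  proof -
    note geo = parameter_manifold_geodesic[OF pm D refl]
    have "riem_exp A g p (1 *\<^sub>R u) \<in> S" using geo(5)[of 1] by simp
    then have "tangent_norm g p u / l \<le> 2 * max b 0"
      using order_trans[OF l(2)[OF geo(1)] wasserstein_le_diameter[OF Eprob Eprob \<Omega> b]] geo(1) geo(7) by simp
    then show ?thesis using l(1) by (simp add: R_def field_simps)
  qed
  define a where "a = C0 * R"
  define K where "K = C0 * R\<^sup>2 + C0 * R * (C0 * R + C0 * R\<^sup>2)"
  \<comment> \<open>The perturbation bound \<open>(2 * a + b) * b\<close> for samples of norm at
    most \<open>a\<close> and displacement errors at most \<open>b = 2 * K\<close>, that is, at
    \<open>t = 1\<close>.\<close>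
  define \<delta> where "\<delta> = (2 * a + 2 * K) * (2 * K)"
  have a0: "0 \<le> a" and K0: "0 \<le> K" using C0 R0 by (auto simp: a_def K_def)
  then have d0: "0 \<le> \<delta>" by (simp add: \<delta>_def)
  \<comment> \<open>\<open>4 * a\<close> makes \<open>t < 1 / C\<close> imply the smallness
    condition \<open>t * a \<le> 1 / 4\<close>; the second summand serves the eigenvalue and the
    angle bound alike, so that one \<open>C\<close> fits both; the 1 ensures positivity.\<close>
  define C where "C = 4 * a + 2 ^ DIM('e) * \<delta> + 1"
  have C0': "0 < C" using a0 d0 by (simp add: C_def add_nonneg_pos)
  have "1 * \<delta> \<le> 2 ^ DIM('e) * \<delta>" using d0 by (intro mult_right_mono) auto
  then have dC: "\<delta> \<le> C" using a0 by (simp add: C_def)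
  show ?thesis
  proof (intro exI[of _ C] conjI ballI allI impI)
    show "0 < C" by (rule C0')
    fix \<theta> N and \<eta> :: "nat \<Rightarrow> 'e"
    assume \<theta>: "\<theta> \<in> S" and N: "1 \<le> (N::nat)" and "\<forall>i<N. (\<theta>, \<eta> i) \<in> D"
    then have D: "\<And>i. i < N \<Longrightarrow> (\<theta>, \<eta> i) \<in> D" by blast
    define v where "v = (\<lambda>i. B \<theta> (\<eta> i))"
    define FV where "FV = empirical_operator (E \<theta>) N v"
    have vL: "v i \<in> L2 (E \<theta>)" if "i < N" for i
      unfolding v_def using BC1[OF \<theta>]
      by (intro continuous_in_L2[OF Eprob[OF \<theta>] \<Omega>]) (auto intro!: continuous_at_imp_continuous_on differentiable_imp_continuous_within)
    obtain m e0 \<mu>' where sv: "L2_spectral (E \<theta>) m e0 \<mu>' FV"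
      using L2_spectral_exists[of N v "E \<theta>", OF vL] unfolding FV_def by blast
    define \<mu> where "\<mu> = map \<mu>' [0..<m]"
    have lm: "length \<mu> = m" by (simp add: \<mu>_def)
    \<comment> \<open>By linearity of \<open>B \<theta>\<close> all samples are combinations of the
      fields of the standard basis of the tangent space.\<close>
    have mdim: "m \<le> DIM('e)"
    proof (rule L2_spectral_rank_le[OF sv[unfolded FV_def] finite_Basis])
      fix j x
      have "B \<theta> (\<eta> j) x = B \<theta> (\<Sum>b\<in>Basis. (\<eta> j \<bullet> b) *\<^sub>R b) x" by (simp add: euclidean_representation)
      also have "\<dots> = (\<Sum>b\<in>Basis. (\<eta> j \<bullet> b) *\<^sub>R B \<theta> b x)"
        using linear_sum[OF Blin[OF \<theta>, of x], of "\<lambda>b. (\<eta> j \<bullet> b) *\<^sub>R b" Basis] linear_scale[OF Blin[OF \<theta>, of x]] by simp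
      finally show "v j x = (\<Sum>b\<in>Basis. (\<eta> j \<bullet> b) *\<^sub>R B \<theta> b x)" by (simp add: v_def)
    qed
    have main: "\<exists>\<nu>. nonzero_eigenvalues (E \<theta>) (empirical_operator (E \<theta>) N w) \<nu> \<and> length \<nu> \<le> N \<and>
        (t < 1 / C \<longrightarrow>
          (\<forall>i<m. \<bar>\<mu> ! i - nth_default 0 \<nu> i\<bar> \<le> C * sqrt t) \<and>
          (\<forall>i. m \<le> i \<and> i < length \<nu> \<longrightarrow> 0 \<le> \<nu> ! i \<and> \<nu> ! i \<le> C * sqrt t) \<and>
          (m \<ge> 1 \<longrightarrow>
            (\<mu> ! (m - 1) - 2 * C * sqrt t > 0 \<longrightarrow>
              nth_default 0 \<nu> (m - 1) - nth_default 0 \<nu> m \<ge> \<mu> ! (m - 1) - 2 * C * sqrt t) \<and>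
            (\<forall>e f. top_eigenvectors (E \<theta>) FV \<mu> m e \<and>
                   top_eigenvectors (E \<theta>) (empirical_operator (E \<theta>) N w) \<nu> m f \<longrightarrow>
              subspace_dist (E \<theta>) m (L2_span (E \<theta>) m f) (L2_span (E \<theta>) m e) \<le> 2 * C * sqrt t / \<mu> ! (m - 1))))"
      if t: "t \<in> {0<..1}" and T: "\<And>i. i < N \<Longrightarrow> optimal_map (E \<theta>) (E (riem_exp A g \<theta> (t *\<^sub>R \<eta> i))) (T i)"
        and w: "w = (\<lambda>i x. (1 / t) *\<^sub>R (T i x - x))"
      for t T w
    proof -
      have target: "E (riem_exp A g \<theta> (t *\<^sub>R \<eta> i)) \<in> prob_on \<Omega>" if "i < N" for i
        using t by (intro Eprob parameter_manifold_geodesic(5)[OF pm D[OF that] refl]) auto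
      have wL: "w i \<in> L2 (E \<theta>)" if "i < N" for i
        unfolding w by (rule displacement_in_L2[OF T[OF that] Eprob[OF \<theta>] target[OF that] \<Omega>])
      obtain n f0 \<nu>' where sw: "L2_spectral (E \<theta>) n f0 \<nu>' (empirical_operator (E \<theta>) N w)"
        using L2_spectral_exists[of N w "E \<theta>", OF wL] by blast
      define \<nu> where "\<nu> = map \<nu>' [0..<n]"
      show ?thesis
      proof (intro exI[of _ \<nu>] conjI impI)
        show "nonzero_eigenvalues (E \<theta>) (empirical_operator (E \<theta>) N w) \<nu>"
          unfolding \<nu>_def by (rule nonzero_eigenvalues_spectral[OF sw])
        show "length \<nu> \<le> N" unfolding \<nu>_def using L2_spectral_length_le[OF sw] by simp
        assume tC: "t < 1 / C"
        have ta: "t * a \<le> 1 / 4"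
        proof -
          have "t * (4 * a) \<le> t * C" using t d0 by (intro mult_left_mono) (auto simp: C_def)
          also have "\<dots> \<le> 1" using tC C0' by (simp add: field_simps)
          finally show ?thesis by simp
        qed
        have va: "L2_norm (E \<theta>) (v i) \<le> a" if "i < N" for i
          unfolding v_def a_def using order_trans[OF BD(1)[OF D[OF that]]] cR[OF D[OF that]] C0 by simp
        have wv: "L2_norm (E \<theta>) (\<lambda>x. w i x - v i x) \<le> 2 * K * t" if i: "i < N" for i
        proof -
          let ?c = "tangent_norm g \<theta> (\<eta> i)"
          have c: "0 \<le> ?c" "?c \<le> R" using tangent_norm_nonneg[OF rm] cR[OF D[OF i]] by auto
          have cle: "C0 * ?c \<le> a" unfolding a_def using c C0 by simp
          have "C0 * ?c\<^sup>2 + C0 * ?c * (C0 * ?c + C0 * ?c\<^sup>2) \<le> K" unfolding K_def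
            using c C0 by (intro add_mono mult_mono power_mono) auto
          then have Kle: "(C0 * ?c\<^sup>2 + C0 * ?c * (C0 * ?c + C0 * ?c\<^sup>2)) * t\<^sup>2 \<le> K * t\<^sup>2" by (rule mult_right_mono) simp
          obtain \<phi> where \<phi>: "E (riem_exp A g \<theta> (t *\<^sub>R \<eta> i)) = distr (restrict_space (E \<theta>) \<Omega>) borel (\<phi> t)"
            "\<And>x. norm (\<phi> t x - x - t *\<^sub>R v i x) \<le> (C0 * ?c\<^sup>2 + C0 * ?c * (C0 * ?c + C0 * ?c\<^sup>2)) * t\<^sup>2"
            using flow_expansion[OF pm fc BC1 D[OF i] less_imp_le[OF C0] refl BD(2)[OF D[OF i]] BD(3)[OF D[OF i]]] t
            unfolding v_def by (metis greaterThanAtMost_iff atLeastAtMost_iff less_imp_le)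
          obtain \<psi> where \<psi>: "\<And>x. gderiv \<psi> x (v i x)" using Bgrad[OF \<theta>, of "\<eta> i"] unfolding v_def by blast
          have lip: "norm (v i x - v i y) \<le> a * norm (x - y)" for x y
            using C1_norm_bounds(2)[OF BD(2)[OF D[OF i]] _ BC1[OF \<theta>], of x y] C0 c mult_right_mono[OF cle norm_ge_zero[of "x - y"]]
            unfolding v_def by simp
          show ?thesis unfolding w
            by (rule displacement_estimate[OF Eprob[OF \<theta>] target[OF i] \<Omega> T[OF i] \<phi>(1) order_trans[OF \<phi>(2) Kle] \<psi> lip a0 _ ta K0])
              (use t in simp)
        qed
        define \<delta>' where "\<delta>' = (2 * a + 2 * K * t) * (2 * K * t)"
        have pert1: "\<bar>(if i < m then \<mu>' i else 0) - (if i < n then \<nu>' i else 0)\<bar> \<le> \<delta>'" for i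
          unfolding \<delta>'_def by (rule empirical_operator_perturbation(1)[OF N vL wL va wv sv[unfolded FV_def] sw])
        have pert2: "subspace_dist (E \<theta>) m (L2_span (E \<theta>) m f) (L2_span (E \<theta>) m e) \<le> 2 ^ m * (2 * \<delta>' / \<mu>' (m - 1))"
          if "1 \<le> m" "top_eigenvectors (E \<theta>) FV \<mu> m e" "top_eigenvectors (E \<theta>) (empirical_operator (E \<theta>) N w) \<nu> m f"
          for e f
          unfolding \<delta>'_def using that unfolding \<mu>_def \<nu>_def FV_def
          by (intro empirical_operator_perturbation(2)[OF N vL wL va wv sv[unfolded FV_def] sw])
        have st: "t \<le> sqrt t" using t by (intro real_le_rsqrt) (auto simp: power2_eq_square mult_left_le)
        \<comment> \<open>The true rate is linear: one factor \<open>t\<close> of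
          \<open>\<delta>'\<close> is kept, the other is bounded by 1, and finally
          \<open>t \<le> sqrt t\<close>.\<close>
        have dt: "\<delta>' \<le> \<delta> * sqrt t"
        proof -
          have "\<delta>' = ((2 * a + 2 * K * t) * (2 * K)) * t" by (simp add: \<delta>'_def)
          also have "\<dots> \<le> \<delta> * t" unfolding \<delta>_def
            using t a0 K0 by (intro mult_right_mono add_left_mono) (auto simp: mult_left_le)
          also have "\<dots> \<le> \<delta> * sqrt t" by (intro mult_left_mono st d0)
          finally show ?thesis .
        qed
        also have "\<dots> \<le> C * sqrt t" using dC t by (intro mult_right_mono) auto
        finally have dCt: "\<delta>' \<le> C * sqrt t" .
        have nd\<mu>: "nth_default 0 \<mu> i = (if i < m then \<mu>' i else 0)" and nd\<nu>: "nth_default 0 \<nu> i = (if i < n then \<nu>' i else 0)" for i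
          by (auto simp: \<mu>_def \<nu>_def nth_default_def)
        have weyl: "\<bar>nth_default 0 \<mu> i - nth_default 0 \<nu> i\<bar> \<le> C * sqrt t" for i
          unfolding nd\<mu> nd\<nu> using pert1[of i] dCt by linarith
        have \<mu>i: "\<mu> ! i = nth_default 0 \<mu> i" if "i < m" for i using that lm by (simp add: nth_default_def)
        have \<nu>i: "\<nu> ! i = nth_default 0 \<nu> i" if "i < length \<nu>" for i using that by (simp add: nth_default_def)
        have small: "nth_default 0 \<nu> i \<le> C * sqrt t" if "m \<le> i" for i
          using weyl[of i] that by (simp add: nd\<mu>)
        show "\<forall>i<m. \<bar>\<mu> ! i - nth_default 0 \<nu> i\<bar> \<le> C * sqrt t" using weyl \<mu>i by simp
        show "\<forall>i. m \<le> i \<and> i < length \<nu> \<longrightarrow> 0 \<le> \<nu> ! i \<and> \<nu> ! i \<le> C * sqrt t"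
          using small \<nu>i sw by (auto simp: L2_spectral_def \<nu>_def less_imp_le)
        \<comment> \<open>The eigenvalue bound is used twice, at \<open>m - 1\<close> and at
          \<open>m\<close>, where the padded \<open>\<mu>\<close> is zero; this explains the factor
          2.\<close>
        show "nth_default 0 \<nu> (m - 1) - nth_default 0 \<nu> m \<ge> \<mu> ! (m - 1) - 2 * C * sqrt t" if "m \<ge> 1"
          using weyl[of "m - 1"] small[of m] \<mu>i[of "m - 1"] that by (simp add: abs_le_iff)
        assume m1: "m \<ge> 1"
        show "\<forall>e f. top_eigenvectors (E \<theta>) FV \<mu> m e \<and> top_eigenvectors (E \<theta>) (empirical_operator (E \<theta>) N w) \<nu> m f \<longrightarrow>
          subspace_dist (E \<theta>) m (L2_span (E \<theta>) m f) (L2_span (E \<theta>) m e) \<le> 2 * C * sqrt t / \<mu> ! (m - 1)"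
        proof (intro allI impI)
          fix e f
          assume "top_eigenvectors (E \<theta>) FV \<mu> m e \<and> top_eigenvectors (E \<theta>) (empirical_operator (E \<theta>) N w) \<nu> m f"
          then have "subspace_dist (E \<theta>) m (L2_span (E \<theta>) m f) (L2_span (E \<theta>) m e) \<le> 2 ^ m * (2 * \<delta>' / \<mu>' (m - 1))"
            using pert2[OF m1] by blast
          also have "\<dots> = 2 * (2 ^ m * \<delta>') / \<mu>' (m - 1)" by simp
          also have "\<dots> \<le> 2 * (C * sqrt t) / \<mu>' (m - 1)"
          proof (rule divide_right_mono)
            \<comment> \<open>Here the rank bound \<open>m \<le> DIM('e)\<close> removes the
              dependence on the sample.\<close>
            have "2 ^ m * \<delta>' \<le> 2 ^ DIM('e) * (\<delta> * sqrt t)"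
              using mdim dt a0 K0 t by (intro mult_mono power_increasing) (auto simp: \<delta>'_def)
            also have "\<dots> \<le> C * sqrt t"
              unfolding mult.assoc[symmetric] using a0 t by (intro mult_right_mono) (auto simp: C_def)
            finally show "2 * (2 ^ m * \<delta>') \<le> 2 * (C * sqrt t)" by simp
            show "0 \<le> \<mu>' (m - 1)" using sv m1 by (simp add: L2_spectral_def less_imp_le)
          qed
          also have "\<mu>' (m - 1) = \<mu> ! (m - 1)" using m1 by (simp add: \<mu>_def)
          finally show "subspace_dist (E \<theta>) m (L2_span (E \<theta>) m f) (L2_span (E \<theta>) m e) \<le> 2 * C * sqrt t / \<mu> ! (m - 1)"
            by simp
        qed
      qed
    qed
    show "?Q C \<theta> N \<eta>"
      unfolding Let_def v_def[symmetric] FV_def[symmetric]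
    proof (intro exI[of _ \<mu>] conjI, unfold lm)
      show "nonzero_eigenvalues (E \<theta>) FV \<mu>" unfolding \<mu>_def by (rule nonzero_eigenvalues_spectral[OF sv])
      show "L2_has_dim (E \<theta>) (L2_span (E \<theta>) N v) m"
        by (rule L2_has_dim_span_spectral[OF sv[unfolded FV_def] vL])
      show "m \<le> DIM('e)" by (rule mdim)
    qed (intro ballI allI impI main, auto)
  qed
qed

end
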